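(* Let $B$ be a Hopf algebra with bijective antipode $S$. Consider the Heisenberg double $\mathcal H(B^* )$ with the $\mathcal D(B)$-action and coaction $$(\mu\otimes m)\triangleright(\beta\# b)=\mu'''(m'\rightharpoonup\beta)\,{S^*}^{-1}(\mu'')\ \#\ \bigl((m''\,b\,S(m'''))\leftharpoonup {S^*}^{-1}(\mu')\bigr),\qquad \delta(\beta\# b)=(\beta''\otimes b')\otimes(\beta'\# b'').$$ Then $\mathcal H(B^* )$ is a braided ($\mathcal D(B)$-)commutative algebra. Moreover, $\mathcal H(B^* )$ is the braided product $$\mathcal H(B^* )=B^{*\mathrm{cop}}\bowtie B$$ (via $\beta\# b\leftrightarrow\beta\bowtie b$), where $B^{*\mathrm{cop}}$ and $B$ are (braided commutative) Yetter--Drinfeld $\mathcal D(B)$-module algebras by restriction, i.e. with the $\mathcal D(B)$-actions $$(\mu\otimes m)\triangleright\beta=\mu''(m\rightharpoonup\beta)\,{S^*}^{-1}(\mu'),\qquad (\mu\otimes m)\triangleright b=(m'\,b\,S(m''))\leftharpoonup{S^*}^{-1}(\mu)$$ and coactions $\delta:\beta\mapsto(\beta''\otimes1)\otimes\beta'$ and $\delta:b\mapsto(\varepsilon\otimes b')\otimes b''$, for $\beta\in B^*$, $b\in B$.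
   Context: Notation. Primes denote Sweedler components of the coproduct: $\Delta(b)=b'\otimes b''$, iterated $b'\otimes b''\otimes b'''$, etc. $\langle\ ,\ \rangle$ is evaluation; $B^*$ is the dual Hopf algebra of $B$, with product $\langle\alpha\beta,b\rangle=\langle\alpha,b'\rangle\langle\beta,b''\rangle$, coproduct $\beta\mapsto\beta'\otimes\beta''$ with $\langle\beta',a\rangle\langle\beta'',b\rangle=\langle\beta,ab\rangle$, unit $\varepsilon$ (the counit of $B$), and antipode $S^*$. $B^{*\mathrm{cop}}$ is $B^*$ with the same product and opposite coproduct (Sweedler primes on elements of $B^*$ always refer to the coproduct of $B^*$). Regular actions, for $b,m\in B$, $\beta,\mu\in B^*$: $b\rightharpoonup\beta=\langle\beta'',b\rangle\beta'$, $\ \beta\leftharpoonup m=\langle\beta',m\rangle\beta''$, $\ b\leftharpoonup\mu=\langle\mu,b'\rangle b''$. Heisenberg double: $\mathcal H(B^* )=B^*\# B$ is the vector space $B^*\otimes B$ with product $(\alpha\# a)(\beta\# b)=\alpha(a'\rightharpoonup\beta)\# a''b$. Drinfeld double: $\mathcal D(B)$ is the vector space $B^*\otimes B$ with product $(\mu\otimes m)(\nu\otimes n)=\mu(m'\rightharpoonup\nu\leftharpoonup S^{-1}(m'''))\otimes m''n$ and the coalgebra structure of $B^{*\mathrm{cop}}\otimes B$, i.e. $\Delta(\mu\otimes m)=(\mu''\otimes m')\otimes(\mu'\otimes m'')$. A left--left Yetter--Drinfeld $H$-module algebra is an algebra $X$ that is a left $H$-module algebra (action $\triangleright$) and a left $H$-comodule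 algebra (coaction $\delta:X\to H\otimes X$, $\delta(x)=x_{(-1)}\otimes x_{(0)}$, an algebra homomorphism) such that $(h'\triangleright x)_{(-1)}h''\otimes(h'\triangleright x)_{(0)}=h'x_{(-1)}\otimes(h''\triangleright x_{(0)})$ for all $h\in H$, $x\in X$. A left $H$-module and left $H$-comodule algebra $X$ is braided commutative ($H$-commutative) if $yx=(y_{(-1)}\triangleright x)\,y_{(0)}$ for all $x,y\in X$. The braided product $X\bowtie Y$ of two left--left Yetter--Drinfeld $H$-module algebras is $X\otimes Y$ (elements written $x\bowtie y$) with the product $(x\bowtie y)(v\bowtie u)=x(y_{(-1)}\triangleright v)\bowtie y_{(0)}u$, the diagonal action $h\triangleright(x\bowtie y)=(h'\triangleright x)\bowtie(h''\triangleright y)$ and the codiagonal coaction $x\bowtie y\mapsto x_{(-1)}y_{(-1)}\otimes(x_{(0)}\bowtie y_{(0)})$; it is a Yetter--Drinfeld $H$-module algebra. *)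

theory Defs
  imports Complex_Main "HOL-Library.Function_Algebras"
begin

text \<open>
  The ground field is an arbitrary type of class \<^class>\<open>field\<close>. A vector space is a subspace
  \<open>carrier V\<close> of an ambient vector space that is a type; \<open>scale V\<close> is the scalar multiplication
  of the ambient space. No finiteness of dimension is assumed anywhere.
\<close>

section \<open>Vector spaces and tensor products\<close>

record ('k, 'a) vspace =
  carrier :: "'a set"
  scale :: "'k \<Rightarrow> 'a \<Rightarrow> 'a"

locale kspace =
  fixes V :: "('k::field, 'a::ab_group_add, 'z) vspace_scheme" (structure)
  assumes ambient: "vector_space (scale V)"
    and subspace: "module.subspace (scale V) (carrier V)"

definition linear_on ::
  "('k::field, 'a::ab_group_add, 'z) vspace_scheme \<Rightarrow> ('k, 'b::ab_group_add, 'y) vspace_scheme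
    \<Rightarrow> ('a \<Rightarrow> 'b) \<Rightarrow> bool"
  where "linear_on V W f \<longleftrightarrow>
    (\<forall>v\<in>carrier V. f v \<in> carrier W) \<and>
    (\<forall>v\<in>carrier V. \<forall>w\<in>carrier V. f (v + w) = f v + f w) \<and>
    (\<forall>c. \<forall>v\<in>carrier V. f (scale V c v) = scale W c (f v))"

definition bilinear_on ::
  "('k::field, 'a::ab_group_add, 'z) vspace_scheme \<Rightarrow> ('k, 'b::ab_group_add, 'y) vspace_scheme
    \<Rightarrow> ('k, 'c::ab_group_add, 'x) vspace_scheme \<Rightarrow> ('a \<Rightarrow> 'b \<Rightarrow> 'c) \<Rightarrow> bool"
  where "bilinear_on U V W f \<longleftrightarrow>
    (\<forall>u\<in>carrier U. linear_on V W (f u)) \<and>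
    (\<forall>v\<in>carrier V. linear_on U W (\<lambda>u. f u v))"

definition scalars :: "('k::field, 'k) vspace"
  where "scalars = \<lparr>carrier = UNIV, scale = (*)\<rparr>"

definition fscale :: "'k::field \<Rightarrow> ('x \<Rightarrow> 'k) \<Rightarrow> ('x \<Rightarrow> 'k)"
  where "fscale c f = (\<lambda>x. c * f x)"

text \<open>
  Over a field, \<open>v \<otimes> w\<close> can be taken to be the function \<open>(f, g) \<mapsto> f v * g w\<close> on pairs of linear
  functionals (of the ambient spaces), because the canonical map from the tensor product to the
  bilinear forms on the duals is injective. The universal property of this model is
  \<open>sweedler_eq\<close> below.
\<close>

type_synonym ('k, 'a, 'b) tensor = "('a \<Rightarrow> 'k) \<times> ('b \<Rightarrow> 'k) \<Rightarrow> 'k"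

definition tens ::
  "('k::field, 'a::ab_group_add, 'z) vspace_scheme \<Rightarrow> ('k, 'b::ab_group_add, 'y) vspace_scheme
    \<Rightarrow> 'a \<Rightarrow> 'b \<Rightarrow> ('k, 'a, 'b) tensor"
  where "tens V W v w = (\<lambda>(f, g).
    if Vector_Spaces.linear (scale V) (*) f \<and> Vector_Spaces.linear (scale W) (*) g
    then f v * g w else 0)"

definition tensor_space ::
  "('k::field, 'a::ab_group_add, 'z) vspace_scheme \<Rightarrow> ('k, 'b::ab_group_add, 'y) vspace_scheme
    \<Rightarrow> ('k, ('k, 'a, 'b) tensor) vspace"
  where "tensor_space V W = \<lparr>
    carrier = module.span fscale {tens V W v w | v w. v \<in> carrier V \<and> w \<in> carrier W},
    scale = fscale\<rparr>"

text \<open>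
  \<open>sweedler V W t \<phi>\<close> is \<open>\<Sum>\<^sub>i \<phi> v\<^sub>i w\<^sub>i\<close> for any presentation \<open>t = \<Sum>\<^sub>i v\<^sub>i \<otimes> w\<^sub>i\<close>, that is, the value at \<open>t\<close>
  of the linear map on \<open>V \<otimes> W\<close> induced by a bilinear \<open>\<phi>\<close>.
\<close>

definition sweedler ::
  "('k::field, 'a::ab_group_add, 'z) vspace_scheme \<Rightarrow> ('k, 'b::ab_group_add, 'y) vspace_scheme
    \<Rightarrow> ('k, 'a, 'b) tensor \<Rightarrow> ('a \<Rightarrow> 'b \<Rightarrow> 'c::ab_group_add) \<Rightarrow> 'c"
  where "sweedler V W t \<phi> = (THE y. \<exists>ps. set ps \<subseteq> carrier V \<times> carrier W \<and>
    t = (\<Sum>(v, w)\<leftarrow>ps. tens V W v w) \<and> y = (\<Sum>(v, w)\<leftarrow>ps. \<phi> v w))"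

lemma kspace_closed:
  assumes "kspace V"
  shows "0 \<in> carrier V" "\<And>v w. v \<in> carrier V \<Longrightarrow> w \<in> carrier V \<Longrightarrow> v + w \<in> carrier V"
    "\<And>c v. v \<in> carrier V \<Longrightarrow> scale V c v \<in> carrier V" "\<And>v. v \<in> carrier V \<Longrightarrow> - v \<in> carrier V"
proof -
  interpret vector_space "scale V" using assms by (simp add: kspace_def)
  have s: "subspace (carrier V)" using assms by (simp add: kspace_def)
  show "0 \<in> carrier V" "\<And>v w. v \<in> carrier V \<Longrightarrow> w \<in> carrier V \<Longrightarrow> v + w \<in> carrier V"
    "\<And>c v. v \<in> carrier V \<Longrightarrow> scale V c v \<in> carrier V" "\<And>v. v \<in> carrier V \<Longrightarrow> - v \<in> carrier V"
    using s by (auto intro: subspace_0 subspace_add subspace_scale subspace_neg)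
qed

lemma linear_on_sum_list:
  assumes "kspace V" "linear_on V W f" "\<And>p. p \<in> set ps \<Longrightarrow> h p \<in> carrier V"
  shows "(\<Sum>p\<leftarrow>ps. h p) \<in> carrier V \<and> f (\<Sum>p\<leftarrow>ps. h p) = (\<Sum>p\<leftarrow>ps. f (h p))"
  using assms(3)
proof (induction ps)
  case Nil
  have "f (0 + 0) = f 0 + f 0"
    using assms(2) kspace_closed(1)[OF assms(1)] unfolding linear_on_def by blast
  then show ?case using kspace_closed(1)[OF assms(1)] by simp
next
  case (Cons p ps)
  then show ?case
    using assms(2) kspace_closed(2)[OF assms(1)] unfolding linear_on_def by auto
qed

lemma linear_on_sum:
  assumes "kspace V" "linear_on V W f" "finite I" "\<And>i. i \<in> I \<Longrightarrow> h i \<in> carrier V"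
  shows "(\<Sum>i\<in>I. h i) \<in> carrier V \<and> f (\<Sum>i\<in>I. h i) = (\<Sum>i\<in>I. f (h i))"
proof -
  obtain js where "set js = I" "distinct js" using finite_distinct_list[OF assms(3)] by blast
  then show ?thesis using linear_on_sum_list[OF assms(1,2), of js h] assms(4)
    by (simp add: sum_list_distinct_conv_sum_set)
qed

lemma functionals_separate:
  assumes "vector_space s" "\<And>g. Vector_Spaces.linear s (*) g \<Longrightarrow> g w = (0::'k::field)"
  shows "w = (0::'a::ab_group_add)"
proof (rule ccontr)
  interpret vector_space s by (rule assms(1))
  assume "w \<noteq> 0"
  then have i: "independent {w}" by simp
  let ?E = "extend_basis {w}"
  have "Vector_Spaces.linear s (*) (\<lambda>v. representation ?E v w)"
    using i by (intro linear_representation independent_extend_basis) auto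
  then have "representation ?E w w = 0" by (rule assms(2))
  moreover have "representation ?E w w = 1"
    using representation_basis[OF independent_extend_basis[OF i], of w] extend_basis_superset[OF i]
    by simp
  ultimately show False by simp
qed

lemma tens_sum_zero:
  fixes V :: "('k::field, 'a::ab_group_add, 'z) vspace_scheme"
    and W :: "('k, 'b::ab_group_add, 'y) vspace_scheme"
  assumes V: "kspace V" and W: "kspace W" and bil: "bilinear_on V W U \<phi>"
    and ps: "set ps \<subseteq> carrier V \<times> carrier W"
    and zero: "(\<Sum>(v, w)\<leftarrow>ps. tens V W v w) = 0"
  shows "(\<Sum>(v, w)\<leftarrow>ps. \<phi> v w) = 0"
proof -
  interpret V: vector_space "scale V" using V by (simp add: kspace_def)
  interpret W: vector_space "scale W" using W by (simp add: kspace_def)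
  obtain E where E: "E \<subseteq> carrier V" "V.independent E" "carrier V \<subseteq> V.span E"
    using V.maximal_independent_subset by blast
  have lin1: "linear_on V U (\<lambda>v. \<phi> v w)" if "w \<in> carrier W" for w
    using bil that unfolding bilinear_on_def by blast
  have lin2: "linear_on W U (\<phi> v)" if "v \<in> carrier V" for v
    using bil that unfolding bilinear_on_def by blast
  define R where "R = V.representation E"
  define F where "F = (\<Union>p\<in>set ps. {e. R (fst p) e \<noteq> 0})"
  have finF: "finite F" unfolding F_def R_def by (auto intro: V.finite_representation)
  have FE: "F \<subseteq> E" unfolding F_def R_def by (auto dest: V.representation_ne_zero)
  have expand: "v = (\<Sum>e\<in>F. scale V (R v e) e)" if "(v, w) \<in> set ps" for v w
  proof -
    have "v \<in> V.span E" using that ps E(3) by auto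
    then have "v = (\<Sum>e | R v e \<noteq> 0. scale V (R v e) e)"
      unfolding R_def using V.sum_nonzero_representation_eq[OF E(2)] by simp
    also have "\<dots> = (\<Sum>e\<in>F. scale V (R v e) e)"
      by (rule sum.mono_neutral_left[OF finF]) (use that in \<open>auto simp: F_def intro!: bexI[of _ "(v, w)"]\<close>)
    finally show ?thesis .
  qed
  have summand: "\<phi> v w = (\<Sum>e\<in>F. \<phi> e (scale W (R v e) w))" if "(v, w) \<in> set ps" for v w
  proof -
    have v: "v \<in> carrier V" and w: "w \<in> carrier W" using that ps by auto
    have "\<phi> v w = \<phi> (\<Sum>e\<in>F. scale V (R v e) e) w" using expand[OF that] by simp
    also have "\<dots> = (\<Sum>e\<in>F. \<phi> (scale V (R v e) e) w)"
      by (rule linear_on_sum[OF V lin1[OF w] finF, THEN conjunct2])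
        (use FE E(1) kspace_closed(3)[OF V] in blast)
    also have "\<dots> = (\<Sum>e\<in>F. \<phi> e (scale W (R v e) w))"
    proof (rule sum.cong)
      fix e assume "e \<in> F"
      then have "e \<in> carrier V" using FE E(1) by blast
      then show "\<phi> (scale V (R v e) e) w = \<phi> e (scale W (R v e) w)"
        using lin1[OF w] lin2[of e] w unfolding linear_on_def by auto
    qed simp
    finally show ?thesis .
  qed
  have coeff: "(\<Sum>(v, w)\<leftarrow>ps. scale W (R v e) w) = 0" if "e \<in> E" for e
  proof (rule functionals_separate[OF W.vector_space_axioms])
    fix g assume g: "Vector_Spaces.linear (scale W) (*) g"
    let ?E = "V.extend_basis E"
    have f: "Vector_Spaces.linear (scale V) (*) (\<lambda>v. V.representation ?E v e)"
      using V.independent_extend_basis[OF E(2)] V.span_extend_basis[OF E(2)]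
      by (rule V.linear_representation)
    interpret g: Vector_Spaces.linear "scale W" "(*)" g by (rule g)
    have "g (\<Sum>(v, w)\<leftarrow>qs. scale W (R v e) w)
        = (\<Sum>(v, w)\<leftarrow>qs. tens V W v w) (\<lambda>v. V.representation ?E v e, g)"
      if "set qs \<subseteq> carrier V \<times> carrier W" for qs
      using that
    proof (induction qs)
      case Nil then show ?case by (simp add: g.zero)
    next
      case (Cons q qs)
      obtain v w where q: "q = (v, w)" by force
      have "v \<in> V.span E" using Cons.prems q E(3) by auto
      then have "V.representation ?E v = R v"
        unfolding R_def
        using V.representation_extend[OF V.independent_extend_basis[OF E(2)]
            _ V.extend_basis_superset[OF E(2)]] by simp
      then show ?case using Cons q by (simp add: g.add g.scale tens_def f g)
    qed
    then show "g (\<Sum>(v, w)\<leftarrow>ps. scale W (R v e) w) = 0" using ps zero by simp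
  qed
  have "(\<Sum>(v, w)\<leftarrow>ps. \<phi> v w) = (\<Sum>(v, w)\<leftarrow>ps. \<Sum>e\<in>F. \<phi> e (scale W (R v e) w))"
    by (rule arg_cong[of _ _ sum_list], rule map_cong) (auto simp: summand)
  also have "\<dots> = (\<Sum>e\<in>F. \<Sum>(v, w)\<leftarrow>ps. \<phi> e (scale W (R v e) w))"
    by (induction ps) (auto simp: sum.distrib)
  also have "\<dots> = 0"
  proof (rule sum.neutral, rule ballI)
    fix e assume "e \<in> F"
    then have e: "e \<in> E" "e \<in> carrier V" using FE E(1) by auto
    have "\<phi> e (\<Sum>p\<leftarrow>ps. (\<lambda>(v, w). scale W (R v e) w) p)
        = (\<Sum>p\<leftarrow>ps. \<phi> e ((\<lambda>(v, w). scale W (R v e) w) p))"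
      by (rule linear_on_sum_list[OF W lin2[OF e(2)], THEN conjunct2])
        (use ps kspace_closed(3)[OF W] in auto)
    moreover have "\<phi> e 0 = 0"
      using linear_on_sum_list[OF W lin2[OF e(2)], of "[]"] by simp
    ultimately show "(\<Sum>(v, w)\<leftarrow>ps. \<phi> e (scale W (R v e) w)) = 0"
      using coeff[OF e(1)] by (simp add: case_prod_unfold)
  qed
  finally show ?thesis .
qed

lemma sweedler_eq:
  fixes V :: "('k::field, 'a::ab_group_add, 'z) vspace_scheme"
    and W :: "('k, 'b::ab_group_add, 'y) vspace_scheme"
  assumes V: "kspace V" and W: "kspace W" and bil: "bilinear_on V W U \<phi>"
    and ps: "set ps \<subseteq> carrier V \<times> carrier W"
  shows "sweedler V W (\<Sum>(v, w)\<leftarrow>ps. tens V W v w) \<phi> = (\<Sum>(v, w)\<leftarrow>ps. \<phi> v w)"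
  unfolding sweedler_def
proof (rule the_equality)
  show "\<exists>qs. set qs \<subseteq> carrier V \<times> carrier W
      \<and> (\<Sum>(v, w)\<leftarrow>ps. tens V W v w) = (\<Sum>(v, w)\<leftarrow>qs. tens V W v w)
      \<and> (\<Sum>(v, w)\<leftarrow>ps. \<phi> v w) = (\<Sum>(v, w)\<leftarrow>qs. \<phi> v w)"
    using ps by blast
next
  fix y assume "\<exists>qs. set qs \<subseteq> carrier V \<times> carrier W
      \<and> (\<Sum>(v, w)\<leftarrow>ps. tens V W v w) = (\<Sum>(v, w)\<leftarrow>qs. tens V W v w)
      \<and> y = (\<Sum>(v, w)\<leftarrow>qs. \<phi> v w)"
  then obtain qs where qs: "set qs \<subseteq> carrier V \<times> carrier W"
    and eq: "(\<Sum>(v, w)\<leftarrow>ps. tens V W v w) = (\<Sum>(v, w)\<leftarrow>qs. tens V W v w)"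
    and y: "y = (\<Sum>(v, w)\<leftarrow>qs. \<phi> v w)" by blast
  let ?n = "\<lambda>rs. map (\<lambda>(v, w). (- v, w)) rs"
  have neg_tens: "tens V W (- v) w = - tens V W v w" for v w
  proof
    fix p :: "('a \<Rightarrow> 'k) \<times> ('b \<Rightarrow> 'k)"
    have neg: "f (- v) = - f v" if "Vector_Spaces.linear (scale V) (*) f" for f :: "'a \<Rightarrow> 'k"
    proof -
      interpret f: Vector_Spaces.linear "scale V" "(*)" f by (rule that)
      show ?thesis by (rule f.neg)
    qed
    then show "tens V W (- v) w p = (- tens V W v w) p"
      by (cases p) (auto simp: tens_def dest: neg)
  qed
  have neg_\<phi>: "\<phi> (- v) w = - \<phi> v w" if "v \<in> carrier V" "w \<in> carrier W" for v w
  proof -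
    have lin: "linear_on V U (\<lambda>v. \<phi> v w)" using bil that unfolding bilinear_on_def by blast
    have "\<phi> (v + - v) w = \<phi> v w + \<phi> (- v) w"
      using lin that kspace_closed(4)[OF V] unfolding linear_on_def by blast
    moreover have "\<phi> 0 w = 0" using linear_on_sum_list[OF V lin, of "[]"] by simp
    ultimately show ?thesis by (simp add: eq_neg_iff_add_eq_0 add.commute)
  qed
  have "(\<Sum>(v, w)\<leftarrow>?n rs. tens V W v w) = - (\<Sum>(v, w)\<leftarrow>rs. tens V W v w)" for rs
    by (induction rs) (auto simp: neg_tens)
  then have "(\<Sum>(v, w)\<leftarrow>ps @ ?n qs. tens V W v w) = 0" using eq by simp
  moreover have "set (ps @ ?n qs) \<subseteq> carrier V \<times> carrier W"
    using ps qs kspace_closed(4)[OF V] by auto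
  ultimately have "(\<Sum>(v, w)\<leftarrow>ps @ ?n qs. \<phi> v w) = 0"
    using tens_sum_zero[OF V W bil] by blast
  moreover have "(\<Sum>(v, w)\<leftarrow>?n qs. \<phi> v w) = - (\<Sum>(v, w)\<leftarrow>qs. \<phi> v w)"
    using qs by (induction qs) (auto simp: neg_\<phi>)
  ultimately show "y = (\<Sum>(v, w)\<leftarrow>ps. \<phi> v w)" by (simp add: y)
qed


section \<open>Algebras and Hopf algebras\<close>

record ('k, 'a) algebra = "('k, 'a) vspace" +
  mult :: "'a \<Rightarrow> 'a \<Rightarrow> 'a" (infixl "\<cdot>\<index>" 70)
  unit :: "'a" ("\<one>\<index>")

record ('k, 'a) bialgebra = "('k, 'a) algebra" +
  comult :: "'a \<Rightarrow> ('k, 'a, 'a) tensor"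
  counit :: "'a \<Rightarrow> 'k"

record ('k, 'a) hopf = "('k, 'a) bialgebra" +
  antipode :: "'a \<Rightarrow> 'a"

text \<open>\<open>cop2 C c (\<lambda>c1 c2. \<dots>)\<close> and \<open>cop3 C c (\<lambda>c1 c2 c3. \<dots>)\<close> are the Sweedler sums over
  \<open>c' \<otimes> c''\<close> and \<open>c' \<otimes> c'' \<otimes> c'''\<close>.\<close>

definition cop2 ::
  "('k::field, 'a::ab_group_add, 'z) bialgebra_scheme \<Rightarrow> 'a \<Rightarrow> ('a \<Rightarrow> 'a \<Rightarrow> 'c::ab_group_add) \<Rightarrow> 'c"
  where "cop2 C c \<phi> = sweedler C C (comult C c) \<phi>"

definition cop3 ::
  "('k::field, 'a::ab_group_add, 'z) bialgebra_scheme
    \<Rightarrow> 'a \<Rightarrow> ('a \<Rightarrow> 'a \<Rightarrow> 'a \<Rightarrow> 'c::ab_group_add) \<Rightarrow> 'c"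
  where "cop3 C c \<phi> = cop2 C c (\<lambda>c1 d. cop2 C d (\<lambda>c2 c3. \<phi> c1 c2 c3))"

locale kalgebra = kspace A
  for A :: "('k::field, 'a::ab_group_add, 'z) algebra_scheme" (structure) +
  assumes mult_bilinear: "bilinear_on A A A (mult A)"
    and unit_closed: "\<one> \<in> carrier A"
    and mult_assoc: "\<lbrakk>x \<in> carrier A; y \<in> carrier A; z \<in> carrier A\<rbrakk> \<Longrightarrow> (x \<cdot> y) \<cdot> z = x \<cdot> (y \<cdot> z)"
    and unit_left: "x \<in> carrier A \<Longrightarrow> \<one> \<cdot> x = x"
    and unit_right: "x \<in> carrier A \<Longrightarrow> x \<cdot> \<one> = x"

locale kcoalgebra = kspace C
  for C :: "('k::field, 'a::ab_group_add, 'z) bialgebra_scheme" (structure) +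
  assumes comult_linear: "linear_on C (tensor_space C C) (comult C)"
    and counit_linear: "linear_on C scalars (counit C)"
    and coassoc: "c \<in> carrier C \<Longrightarrow>
      cop2 C c (\<lambda>d c3. cop2 C d (\<lambda>c1 c2. tens C (tensor_space C C) c1 (tens C C c2 c3)))
      = cop2 C c (\<lambda>c1 d. tens C (tensor_space C C) c1 (comult C d))"
    and counit_left: "c \<in> carrier C \<Longrightarrow> cop2 C c (\<lambda>c1 c2. scale C (counit C c1) c2) = c"
    and counit_right: "c \<in> carrier C \<Longrightarrow> cop2 C c (\<lambda>c1 c2. scale C (counit C c2) c1) = c"

locale hopf_algebra = kalgebra B + kcoalgebra B
  for B :: "('k::field, 'b::ab_group_add) hopf" (structure) +
  assumes comult_mult: "\<lbrakk>a \<in> carrier B; b \<in> carrier B\<rbrakk> \<Longrightarrow>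
      comult B (a \<cdot> b) = cop2 B a (\<lambda>a1 a2. cop2 B b (\<lambda>b1 b2. tens B B (a1 \<cdot> b1) (a2 \<cdot> b2)))"
    and comult_unit: "comult B \<one> = tens B B \<one> \<one>"
    and counit_mult: "\<lbrakk>a \<in> carrier B; b \<in> carrier B\<rbrakk> \<Longrightarrow>
      counit B (a \<cdot> b) = counit B a * counit B b"
    and counit_unit: "counit B \<one> = 1"
    and antipode_linear: "linear_on B B (antipode B)"
    and antipode_left: "b \<in> carrier B \<Longrightarrow>
      cop2 B b (\<lambda>b1 b2. antipode B b1 \<cdot> b2) = scale B (counit B b) \<one>"
    and antipode_right: "b \<in> carrier B \<Longrightarrow>
      cop2 B b (\<lambda>b1 b2. b1 \<cdot> antipode B b2) = scale B (counit B b) \<one>"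

definition inv_antipode :: "('k, 'b) hopf \<Rightarrow> 'b \<Rightarrow> 'b"
  where "inv_antipode B = inv_into (carrier B) (antipode B)"


section \<open>The dual Hopf algebra\<close>

text \<open>Functionals on \<open>carrier V\<close> are normalised to vanish outside \<open>carrier V\<close>.\<close>

definition functionals ::
  "('k::field, 'a::ab_group_add, 'z) vspace_scheme \<Rightarrow> ('a \<Rightarrow> 'k) set"
  where "functionals V = {f. linear_on V scalars f \<and> (\<forall>v. v \<notin> carrier V \<longrightarrow> f v = 0)}"

text \<open>
  For \<open>B\<close> of arbitrary dimension the dual Hopf algebra \<open>B\<^sup>*\<close> consists of those functionals \<open>\<beta>\<close> for
  which \<open>a \<otimes> b \<mapsto> \<langle>\<beta>, ab\<rangle>\<close> lies in the tensor square of the space of functionals (the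
  finite dual). For finite-dimensional \<open>B\<close> these are all functionals, see
  \<open>dual_space_finite_dimensional\<close> below.
\<close>

definition dual_space ::
  "('k::field, 'b::ab_group_add, 'z) algebra_scheme \<Rightarrow> ('k, 'b \<Rightarrow> 'k) vspace"
  where "dual_space B = \<lparr>
    carrier = {\<beta> \<in> functionals B. \<exists>ps. set ps \<subseteq> functionals B \<times> functionals B \<and>
      (\<forall>a\<in>carrier B. \<forall>b\<in>carrier B. \<beta> (a \<cdot>\<^bsub>B\<^esub> b) = (\<Sum>(f, g)\<leftarrow>ps. f a * g b))},
    scale = fscale\<rparr>"

lemma dual_space_finite_dimensional:
  fixes B :: "('k::field, 'b::ab_group_add, 'z) algebra_scheme" (structure)
  assumes B: "kalgebra B" and fin: "finite S" "carrier B = module.span (scale B) S"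
  shows "carrier (dual_space B) = functionals B"
proof (intro equalityI subsetI)
  fix \<beta> assume \<beta>: "\<beta> \<in> functionals B"
  interpret kalgebra B by (rule B)
  interpret vector_space "scale B" by (rule ambient)
  have B': "kspace B" by unfold_locales
  obtain E where E: "E \<subseteq> S" "independent E" "S \<subseteq> span E"
    using maximal_independent_subset by blast
  have finE: "finite E" using E(1) fin(1) finite_subset by blast
  have cB: "carrier B = span E"
    using E span_mono[OF E(1)] span_minimal[OF E(3) subspace_span] fin(2) by auto
  then have EB: "E \<subseteq> carrier B" by (simp add: span_superset)
  define f where "f e v = (if v \<in> carrier B then representation E v e else 0)" for e v
  define g where "g e b = (if b \<in> carrier B then \<beta> (e \<cdot> b) else 0)" for e b
  have lin\<beta>: "linear_on B scalars \<beta>" using \<beta> by (simp add: functionals_def)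
  have linl: "linear_on B B (\<lambda>b. a \<cdot> b)" if "a \<in> carrier B" for a
    using mult_bilinear that by (simp add: bilinear_on_def)
  have linr: "linear_on B B (\<lambda>a. a \<cdot> b)" if "b \<in> carrier B" for b
    using mult_bilinear that by (simp add: bilinear_on_def)
  have f: "f e \<in> functionals B" for e
    unfolding functionals_def linear_on_def scalars_def f_def
    using kspace_closed[OF B'] E(2) cB by (auto simp: representation_add representation_scale)
  have g: "g e \<in> functionals B" if "e \<in> E" for e
  proof -
    have "e \<in> carrier B" using that EB by blast
    then show ?thesis
      using linl[of e] lin\<beta> kspace_closed[OF B']
      unfolding functionals_def linear_on_def scalars_def g_def by auto
  qed
  obtain es where es: "set es = E" "distinct es" using finite_distinct_list[OF finE] by blast
  let ?ps = "map (\<lambda>e. (f e, g e)) es"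
  have "\<beta> (a \<cdot> b) = (\<Sum>(f, g)\<leftarrow>?ps. f a * g b)" if a: "a \<in> carrier B" and b: "b \<in> carrier B" for a b
  proof -
    have cl: "scale B (f e a) e \<in> carrier B" if "e \<in> E" for e
      using EB that by (auto intro: kspace_closed(3)[OF B'])
    have "a = (\<Sum>e\<in>E. scale B (f e a) e)"
      using sum_representation_eq[of E a E] E(2) cB a finE by (simp add: f_def)
    then have "\<beta> (a \<cdot> b) = \<beta> ((\<Sum>e\<in>E. scale B (f e a) e) \<cdot> b)" by simp
    also have "\<dots> = \<beta> (\<Sum>e\<in>E. scale B (f e a) e \<cdot> b)"
      using linear_on_sum[OF B' linr[OF b] finE cl] by simp
    also have "\<dots> = (\<Sum>e\<in>E. \<beta> (scale B (f e a) e \<cdot> b))"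
      using linear_on_sum[OF B' lin\<beta> finE, of "\<lambda>e. scale B (f e a) e \<cdot> b"]
        cl linr[OF b] unfolding linear_on_def by simp
    also have "\<dots> = (\<Sum>e\<in>E. f e a * g e b)"
    proof (rule sum.cong)
      fix e assume "e \<in> E"
      then have "e \<in> carrier B" using EB by blast
      then show "\<beta> (scale B (f e a) e \<cdot> b) = f e a * g e b"
        using linr[OF b] lin\<beta> b unfolding linear_on_def by (simp add: g_def scalars_def)
    qed simp
    finally show ?thesis
      using sum_list_distinct_conv_sum_set[OF es(2), of "\<lambda>e. f e a * g e b"] es(1)
      by (simp add: comp_def)
  qed
  moreover have "set ?ps \<subseteq> functionals B \<times> functionals B" using f g es by auto
  ultimately show "\<beta> \<in> carrier (dual_space B)"
    using \<beta> unfolding dual_space_def vspace.simps by blast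
qed (simp add: dual_space_def)

definition dual :: "('k::field, 'b::ab_group_add) hopf \<Rightarrow> ('k, 'b \<Rightarrow> 'k) hopf"
  where "dual B = \<lparr>
    carrier = carrier (dual_space B),
    scale = fscale,
    mult = (\<lambda>\<alpha> \<beta> b. if b \<in> carrier B then cop2 B b (\<lambda>b1 b2. \<alpha> b1 * \<beta> b2) else 0),
    unit = (\<lambda>b. if b \<in> carrier B then counit B b else 0),
    comult = (\<lambda>\<beta>. THE t. t \<in> carrier (tensor_space (dual_space B) (dual_space B)) \<and>
      (\<forall>a\<in>carrier B. \<forall>b\<in>carrier B.
        sweedler (dual_space B) (dual_space B) t (\<lambda>\<beta>1 \<beta>2. \<beta>1 a * \<beta>2 b) = \<beta> (a \<cdot>\<^bsub>B\<^esub> b))),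
    counit = (\<lambda>\<beta>. \<beta> \<one>\<^bsub>B\<^esub>),
    antipode = (\<lambda>\<beta> b. if b \<in> carrier B then \<beta> (antipode B b) else 0)\<rparr>"

text \<open>The regular actions \<open>b \<rightharpoonup> \<beta>\<close>, \<open>\<beta> \<leftharpoonup> m\<close> and \<open>b \<leftharpoonup> \<mu>\<close>, in this order.\<close>

definition lreg :: "('k::field, 'b::ab_group_add) hopf \<Rightarrow> 'b \<Rightarrow> ('b \<Rightarrow> 'k) \<Rightarrow> ('b \<Rightarrow> 'k)"
  where "lreg B b \<beta> = cop2 (dual B) \<beta> (\<lambda>\<beta>1 \<beta>2. fscale (\<beta>2 b) \<beta>1)"

definition rreg :: "('k::field, 'b::ab_group_add) hopf \<Rightarrow> ('b \<Rightarrow> 'k) \<Rightarrow> 'b \<Rightarrow> ('b \<Rightarrow> 'k)"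
  where "rreg B \<beta> m = cop2 (dual B) \<beta> (\<lambda>\<beta>1 \<beta>2. fscale (\<beta>1 m) \<beta>2)"

definition rcoreg :: "('k::field, 'b::ab_group_add) hopf \<Rightarrow> 'b \<Rightarrow> ('b \<Rightarrow> 'k) \<Rightarrow> 'b"
  where "rcoreg B b \<mu> = cop2 B b (\<lambda>b1 b2. scale B (\<mu> b1) b2)"


section \<open>The Drinfeld double\<close>

definition drinfeld_double ::
  "('k::field, 'b::ab_group_add) hopf \<Rightarrow> ('k, ('k, 'b \<Rightarrow> 'k, 'b) tensor) bialgebra"
  where "drinfeld_double B = (let D = tensor_space (dual B) B in \<lparr>
    carrier = carrier D,
    scale = scale D,
    mult = (\<lambda>x y. sweedler (dual B) B x (\<lambda>\<mu> m. sweedler (dual B) B y (\<lambda>\<nu> n.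
      cop3 B m (\<lambda>m1 m2 m3.
        tens (dual B) B
          (\<mu> \<cdot>\<^bsub>dual B\<^esub> rreg B (lreg B m1 \<nu>) (inv_antipode B m3))
          (m2 \<cdot>\<^bsub>B\<^esub> n))))),
    unit = tens (dual B) B \<one>\<^bsub>dual B\<^esub> \<one>\<^bsub>B\<^esub>,
    comult = (\<lambda>x. sweedler (dual B) B x (\<lambda>\<mu> m.
      cop2 (dual B) \<mu> (\<lambda>\<mu>1 \<mu>2. cop2 B m (\<lambda>m1 m2.
        tens D D (tens (dual B) B \<mu>2 m1) (tens (dual B) B \<mu>1 m2))))),
    counit = (\<lambda>x. sweedler (dual B) B x (\<lambda>\<mu> m. counit (dual B) \<mu> * counit B m))\<rparr>)"


section \<open>Yetter--Drinfeld module algebras\<close>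

record ('k, 'x, 'h) yd_algebra = "('k, 'x) algebra" +
  act :: "'h \<Rightarrow> 'x \<Rightarrow> 'x"
  coact :: "'x \<Rightarrow> ('k, 'h, 'x) tensor"

locale module_algebra = kalgebra X
  for H :: "('k::field, 'h::ab_group_add, 'y) bialgebra_scheme"
    and X :: "('k, 'x::ab_group_add, 'h, 'z) yd_algebra_scheme" +
  assumes act_bilinear: "bilinear_on H X X (act X)"
    and act_mult: "\<lbrakk>h \<in> carrier H; k \<in> carrier H; x \<in> carrier X\<rbrakk> \<Longrightarrow>
      act X (h \<cdot>\<^bsub>H\<^esub> k) x = act X h (act X k x)"
    and act_unit: "x \<in> carrier X \<Longrightarrow> act X \<one>\<^bsub>H\<^esub> x = x"
    and act_on_mult: "\<lbrakk>h \<in> carrier H; x \<in> carrier X; y \<in> carrier X\<rbrakk> \<Longrightarrow>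
      act X h (x \<cdot>\<^bsub>X\<^esub> y) = cop2 H h (\<lambda>h1 h2. act X h1 x \<cdot>\<^bsub>X\<^esub> act X h2 y)"
    and act_on_unit: "h \<in> carrier H \<Longrightarrow> act X h \<one>\<^bsub>X\<^esub> = scale X (counit H h) \<one>\<^bsub>X\<^esub>"

locale comodule_algebra = kalgebra X
  for H :: "('k::field, 'h::ab_group_add, 'y) bialgebra_scheme"
    and X :: "('k, 'x::ab_group_add, 'h, 'z) yd_algebra_scheme" +
  assumes coact_linear: "linear_on X (tensor_space H X) (coact X)"
    and coact_coassoc: "x \<in> carrier X \<Longrightarrow>
      sweedler H X (coact X x) (\<lambda>h x0. cop2 H h (\<lambda>h1 h2.
        tens H (tensor_space H X) h1 (tens H X h2 x0)))
      = sweedler H X (coact X x) (\<lambda>h x0. tens H (tensor_space H X) h (coact X x0))"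
    and coact_counit: "x \<in> carrier X \<Longrightarrow>
      sweedler H X (coact X x) (\<lambda>h x0. scale X (counit H h) x0) = x"
    and coact_mult: "\<lbrakk>x \<in> carrier X; y \<in> carrier X\<rbrakk> \<Longrightarrow>
      coact X (x \<cdot>\<^bsub>X\<^esub> y) = sweedler H X (coact X x) (\<lambda>h x0. sweedler H X (coact X y) (\<lambda>k y0.
        tens H X (h \<cdot>\<^bsub>H\<^esub> k) (x0 \<cdot>\<^bsub>X\<^esub> y0)))"
    and coact_unit: "coact X \<one>\<^bsub>X\<^esub> = tens H X \<one>\<^bsub>H\<^esub> \<one>\<^bsub>X\<^esub>"

locale yd_module_algebra = module_algebra H X + comodule_algebra H X
  for H :: "('k::field, 'h::ab_group_add, 'y) bialgebra_scheme"
    and X :: "('k, 'x::ab_group_add, 'h, 'z) yd_algebra_scheme" +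
  assumes yetter_drinfeld: "\<lbrakk>h \<in> carrier H; x \<in> carrier X\<rbrakk> \<Longrightarrow>
      cop2 H h (\<lambda>h1 h2. sweedler H X (coact X (act X h1 x)) (\<lambda>k x0. tens H X (k \<cdot>\<^bsub>H\<^esub> h2) x0))
      = cop2 H h (\<lambda>h1 h2. sweedler H X (coact X x) (\<lambda>k x0. tens H X (h1 \<cdot>\<^bsub>H\<^esub> k) (act X h2 x0)))"

locale braided_commutative = module_algebra H X + comodule_algebra H X
  for H :: "('k::field, 'h::ab_group_add, 'y) bialgebra_scheme"
    and X :: "('k, 'x::ab_group_add, 'h, 'z) yd_algebra_scheme" +
  assumes braided_comm: "\<lbrakk>x \<in> carrier X; y \<in> carrier X\<rbrakk> \<Longrightarrow>
      y \<cdot>\<^bsub>X\<^esub> x = sweedler H X (coact X y) (\<lambda>h y0. act X h x \<cdot>\<^bsub>X\<^esub> y0)"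

definition braided_product ::
  "('k::field, 'h::ab_group_add, 'w) bialgebra_scheme
    \<Rightarrow> ('k, 'x::ab_group_add, 'h, 'z) yd_algebra_scheme
    \<Rightarrow> ('k, 'y::ab_group_add, 'h, 'v) yd_algebra_scheme
    \<Rightarrow> ('k, ('k, 'x, 'y) tensor, 'h) yd_algebra"
  where "braided_product H X Y = (let T = tensor_space X Y in \<lparr>
    carrier = carrier T,
    scale = scale T,
    mult = (\<lambda>s t. sweedler X Y s (\<lambda>x y. sweedler X Y t (\<lambda>v u.
      sweedler H Y (coact Y y) (\<lambda>h y0. tens X Y (x \<cdot>\<^bsub>X\<^esub> act X h v) (y0 \<cdot>\<^bsub>Y\<^esub> u))))),
    unit = tens X Y \<one>\<^bsub>X\<^esub> \<one>\<^bsub>Y\<^esub>,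
    act = (\<lambda>h t. cop2 H h (\<lambda>h1 h2. sweedler X Y t (\<lambda>x y. tens X Y (act X h1 x) (act Y h2 y)))),
    coact = (\<lambda>t. sweedler X Y t (\<lambda>x y.
      sweedler H X (coact X x) (\<lambda>h x0. sweedler H Y (coact Y y) (\<lambda>k y0.
        tens H T (h \<cdot>\<^bsub>H\<^esub> k) (tens X Y x0 y0)))))\<rparr>)"

text \<open>Equality of Yetter--Drinfeld module algebras: the same space with the same operations.
  Operations are compared on the carriers only.\<close>

definition yd_algebra_eq ::
  "('k::field, 'h::ab_group_add, 'w) bialgebra_scheme
    \<Rightarrow> ('k, 'x::ab_group_add, 'h) yd_algebra \<Rightarrow> ('k, 'x, 'h) yd_algebra \<Rightarrow> bool"
  where "yd_algebra_eq H X Y \<longleftrightarrow>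
    carrier X = carrier Y \<and> scale X = scale Y \<and> unit X = unit Y \<and>
    (\<forall>x\<in>carrier X. \<forall>y\<in>carrier X. x \<cdot>\<^bsub>X\<^esub> y = x \<cdot>\<^bsub>Y\<^esub> y) \<and>
    (\<forall>h\<in>carrier H. \<forall>x\<in>carrier X. act X h x = act Y h x) \<and>
    (\<forall>x\<in>carrier X. coact X x = coact Y x)"

text \<open>The Yetter--Drinfeld structure of \<open>X\<close> is the restriction of that of \<open>Y\<close> along \<open>i\<close>.\<close>

definition yd_restriction ::
  "('k::field, 'h::ab_group_add, 'w) bialgebra_scheme
    \<Rightarrow> ('k, 'x::ab_group_add, 'h) yd_algebra \<Rightarrow> ('k, 'y::ab_group_add, 'h) yd_algebra
    \<Rightarrow> ('x \<Rightarrow> 'y) \<Rightarrow> bool"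
  where "yd_restriction H X Y i \<longleftrightarrow>
    linear_on X Y i \<and> inj_on i (carrier X) \<and> i \<one>\<^bsub>X\<^esub> = \<one>\<^bsub>Y\<^esub> \<and>
    (\<forall>x\<in>carrier X. \<forall>y\<in>carrier X. i (x \<cdot>\<^bsub>X\<^esub> y) = i x \<cdot>\<^bsub>Y\<^esub> i y) \<and>
    (\<forall>h\<in>carrier H. \<forall>x\<in>carrier X. act Y h (i x) = i (act X h x)) \<and>
    (\<forall>x\<in>carrier X. coact Y (i x) = sweedler H X (coact X x) (\<lambda>h x0. tens H Y h (i x0)))"


section \<open>The Heisenberg double and its two factors\<close>

definition heisenberg_double ::
  "('k::field, 'b::ab_group_add) hopf
    \<Rightarrow> ('k, ('k, 'b \<Rightarrow> 'k, 'b) tensor, ('k, 'b \<Rightarrow> 'k, 'b) tensor) yd_algebra"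
  where "heisenberg_double B = (let T = tensor_space (dual B) B in \<lparr>
    carrier = carrier T,
    scale = scale T,
    mult = (\<lambda>x y. sweedler (dual B) B x (\<lambda>\<alpha> a. sweedler (dual B) B y (\<lambda>\<beta> b.
      cop2 B a (\<lambda>a1 a2. tens (dual B) B (\<alpha> \<cdot>\<^bsub>dual B\<^esub> lreg B a1 \<beta>) (a2 \<cdot>\<^bsub>B\<^esub> b))))),
    unit = tens (dual B) B \<one>\<^bsub>dual B\<^esub> \<one>\<^bsub>B\<^esub>,
    act = (\<lambda>d x. sweedler (dual B) B d (\<lambda>\<mu> m. sweedler (dual B) B x (\<lambda>\<beta> b.
      cop3 (dual B) \<mu> (\<lambda>\<mu>1 \<mu>2 \<mu>3. cop3 B m (\<lambda>m1 m2 m3.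
        tens (dual B) B
          (\<mu>3 \<cdot>\<^bsub>dual B\<^esub> lreg B m1 \<beta> \<cdot>\<^bsub>dual B\<^esub> inv_antipode (dual B) \<mu>2)
          (rcoreg B (m2 \<cdot>\<^bsub>B\<^esub> b \<cdot>\<^bsub>B\<^esub> antipode B m3) (inv_antipode (dual B) \<mu>1))))))),
    coact = (\<lambda>x. sweedler (dual B) B x (\<lambda>\<beta> b.
      cop2 (dual B) \<beta> (\<lambda>\<beta>1 \<beta>2. cop2 B b (\<lambda>b1 b2.
        tens (drinfeld_double B) T (tens (dual B) B \<beta>2 b1) (tens (dual B) B \<beta>1 b2)))))\<rparr>)"

text \<open>\<open>B\<^sup>*\<^sup>c\<^sup>o\<^sup>p\<close>, with the multiplication of \<open>B\<^sup>*\<close>. The opposite coproduct only enters through the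
  coaction.\<close>

definition dual_cop_yd ::
  "('k::field, 'b::ab_group_add) hopf
    \<Rightarrow> ('k, 'b \<Rightarrow> 'k, ('k, 'b \<Rightarrow> 'k, 'b) tensor) yd_algebra"
  where "dual_cop_yd B = \<lparr>
    carrier = carrier (dual B),
    scale = scale (dual B),
    mult = mult (dual B),
    unit = unit (dual B),
    act = (\<lambda>d \<beta>. sweedler (dual B) B d (\<lambda>\<mu> m. cop2 (dual B) \<mu> (\<lambda>\<mu>1 \<mu>2.
      \<mu>2 \<cdot>\<^bsub>dual B\<^esub> lreg B m \<beta> \<cdot>\<^bsub>dual B\<^esub> inv_antipode (dual B) \<mu>1))),
    coact = (\<lambda>\<beta>. cop2 (dual B) \<beta> (\<lambda>\<beta>1 \<beta>2.
      tens (drinfeld_double B) (dual B) (tens (dual B) B \<beta>2 \<one>\<^bsub>B\<^esub>) \<beta>1))\<rparr>"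

definition hopf_yd ::
  "('k::field, 'b::ab_group_add) hopf \<Rightarrow> ('k, 'b, ('k, 'b \<Rightarrow> 'k, 'b) tensor) yd_algebra"
  where "hopf_yd B = \<lparr>
    carrier = carrier B,
    scale = scale B,
    mult = mult B,
    unit = unit B,
    act = (\<lambda>d b. sweedler (dual B) B d (\<lambda>\<mu> m. cop2 B m (\<lambda>m1 m2.
      rcoreg B (m1 \<cdot>\<^bsub>B\<^esub> b \<cdot>\<^bsub>B\<^esub> antipode B m2) (inv_antipode (dual B) \<mu>)))),
    coact = (\<lambda>b. cop2 B b (\<lambda>b1 b2.
      tens (drinfeld_double B) B (tens (dual B) B \<one>\<^bsub>dual B\<^esub> b1) b2))\<rparr>"

end

theory Submission
  imports Defs
begin

text \<open>
  On the common space \<open>B\<^sup>* \<otimes> B\<close>, the coaction of \<open>\<H>(B\<^sup>*)\<close> is the coproduct of \<open>\<D>(B)\<close>, and it is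
  multiplicative from the product of \<open>\<H>(B\<^sup>*)\<close> to that of \<open>\<D>(B) \<otimes> \<H>(B\<^sup>*)\<close>. The identity map
  \<open>\<D>(B) \<rightarrow> \<H>(B\<^sup>*)\<close> has the convolution inverse \<open>\<iota>(\<mu> \<otimes> m) = (1 # S m)(S\<^sup>*\<^sup>-\<^sup>1 \<mu> # 1)\<close>, so that
  \<open>\<H>(B\<^sup>*)\<close> is a cleft Galois object over \<open>\<D>(B)\<close>. The given action is \<open>h \<rhd> x = h' x \<iota>(h'')\<close>, computed
  in \<open>\<H>(B\<^sup>*)\<close>: the Miyashita--Ulbrich action, which makes every Galois object a braided commutative
  Yetter--Drinfeld module algebra. Indeed \<open>(h' \<rhd> x) h'' = h x\<close>, and the Yetter--Drinfeld condition
  follows by applying the coaction to this identity and cancelling \<open>h''\<close>. The two factors inherit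
  the structure along the retracts \<open>\<beta> \<mapsto> \<beta> # 1\<close> and \<open>b \<mapsto> 1 # b\<close> of \<open>\<H>(B\<^sup>*)\<close>.
\<close>

section \<open>Linear maps and sums over tensors\<close>

text \<open>The shape of \<iota> is forced: \<mu> # m is the product of \<mu> # 1 and 1 # m, so its
  convolution inverse inverts each factor and reverses their order. The coproduct of
  \<open>D\<close> is opposite on the dual, which is why the inverse antipode stands on that factor.
  The computation that ties the two doubles together is the multiplicativity of the coaction; there
  the twist by \<open>S\<^sup>-\<^sup>1\<close> in the product of \<open>D\<close> cancels against
  the action inside the Heisenberg product. \<open>B\<close> may have infinite dimension. Its dual
  is then the finite dual, and that the coproduct of the finite dual lands in its own tensor square
  has to be proved. The finite dual need not separate the points of \<open>B\<close>. Therefore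
  identities in the dual and its tensor powers are tested by evaluation on \<open>B\<close>, while
  identities in \<open>B\<close> are derived by Sweedler calculus alone. Sums run over a chosen
  presentation of a tensor, so that exchanging sums and linearity in the summand are facts about
  finite lists; independence of the presentation enters where the tensor itself varies.\<close>

lemma fscale_vector_space: "vector_space fscale"
  by unfold_locales (auto simp: fscale_def fun_eq_iff algebra_simps)

lemma kspace_tensor_space [simp]: "kspace (tensor_space V W)"
proof -
  interpret vector_space "fscale :: 'x::field \<Rightarrow> ('y \<Rightarrow> 'x) \<Rightarrow> _" by (rule fscale_vector_space)
  show ?thesis
    unfolding kspace_def tensor_space_def by (simp add: vector_space_axioms subspace_span)
qed

lemma kspace_scalars [simp]: "kspace (scalars :: ('k::field, 'k) vspace)"
proof -
  interpret vector_space "(*) :: 'k \<Rightarrow> 'k \<Rightarrow> 'k" by unfold_locales (auto simp: algebra_simps)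
  show ?thesis
    unfolding kspace_def scalars_def by (simp add: vector_space_axioms)
qed

lemma carrier_scalars [simp]: "carrier scalars = UNIV"
  and scale_scalars [simp]: "scale scalars = (*)"
  and scale_tensor_space [simp]: "scale (tensor_space V W) = fscale"
  by (simp_all add: scalars_def tensor_space_def)

section \<open>Rules for linear and bilinear maps on carriers\<close>

lemma linear_onD:
  assumes "linear_on V W f"
  shows "v \<in> carrier V \<Longrightarrow> f v \<in> carrier W"
    and "v \<in> carrier V \<Longrightarrow> w \<in> carrier V \<Longrightarrow> f (v + w) = f v + f w"
    and "v \<in> carrier V \<Longrightarrow> f (scale V c v) = scale W c (f v)"
  using assms unfolding linear_on_def by blast+

lemma linear_on_zero: "kspace V \<Longrightarrow> linear_on V W f \<Longrightarrow> f 0 = 0"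
  using linear_on_sum_list[of V W f "[]"] by simp

lemma linear_on_id [simp]: "linear_on V V (\<lambda>x. x)"
  by (simp add: linear_on_def)

lemma linear_on_compose: "linear_on V W f \<Longrightarrow> linear_on U V g \<Longrightarrow> linear_on U W (\<lambda>x. f (g x))"
  by (simp add: linear_on_def)

text \<open>Linearity also evaluates the map at \<open>v + w\<close> and \<open>scale V c v\<close>;
  closure of the carrier makes the equality available there. Used as a congruence rule, it lets an
  operation be replaced by an explicit sum that is valid only on the carriers.\<close>

lemma linear_on_cong:
  assumes "kspace V" "\<And>v. v \<in> carrier V \<Longrightarrow> f v = g v"
  shows "linear_on V W f \<longleftrightarrow> linear_on V W g"
  using assms(2) kspace_closed[OF assms(1)] unfolding linear_on_def by auto

lemma kspace_same_space:
  assumes "carrier V = carrier V'" "scale V = scale V'"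
  shows "kspace V \<longleftrightarrow> kspace V'"
  using assms unfolding kspace_def by simp

text \<open>Tensors look only at carriers and scalings. Hence the several records over one space (a
  dual, a double, a module algebra) have the same tensor products.\<close>

lemma tensor_same_space:
  assumes "carrier V = carrier V'" "scale V = scale V'" "carrier W = carrier W'" "scale W
      = scale W'"
  shows "tens V W = tens V' W'" "tensor_space V W = tensor_space V' W'"
    "sweedler V W = sweedler V' W'"
proof -
  show t: "tens V W = tens V' W'" by (simp add: fun_eq_iff tens_def assms)
  show "tensor_space V W = tensor_space V' W'" by (simp add: tensor_space_def t assms)
  show "sweedler V W = sweedler V' W'" by (simp add: fun_eq_iff sweedler_def t assms)
qed

lemma kspace_scale:
  assumes "kspace V"
  shows "scale V c (v + w) = scale V c v + scale V c w"
    "scale V (c + d) v = scale V c v + scale V d v"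
    "scale V c (scale V d v) = scale V (c * d) v" "scale V 1 v = v"
    "scale V c 0 = 0" "scale V 0 v = 0"
proof -
  interpret vector_space "scale V" using assms by (simp add: kspace_def)
  show "scale V c (v + w) = scale V c v + scale V c w"
    "scale V (c + d) v = scale V c v + scale V d v"
    "scale V c (scale V d v) = scale V (c * d) v" "scale V 1 v = v"
    "scale V c 0 = 0" "scale V 0 v = 0"
    by (simp_all add: scale_left_distrib scale_right_distrib)
qed

text \<open>Rules of this form, with an arbitrary linear inner map \<open>g\<close>, compose. The
  simplifier can therefore prove linearity of a nested expression in one variable by descending to
  that variable.\<close>

lemma linear_on_scale [simp]:
  assumes "kspace W" "linear_on U W g"
  shows "linear_on U W (\<lambda>x. scale W c (g x))"
  using linear_onD[OF assms(2)] kspace_closed[OF assms(1)] kspace_scale[OF assms(1)]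
  unfolding linear_on_def by (simp add: mult.commute)

lemma linear_on_scale_left [simp]:
  assumes "kspace W" "w \<in> carrier W" "linear_on U scalars g"
  shows "linear_on U W (\<lambda>x. scale W (g x) w)"
  using linear_onD[OF assms(3)] kspace_closed[OF assms(1)] kspace_scale[OF assms(1)] assms(2)
  unfolding linear_on_def by simp

text \<open>On spaces of functions the simplifier rewrites \<open>scale W\<close> to
  \<open>fscale\<close>, and the rule for \<open>scale W\<close> no longer matches. The space is
  recovered from the side condition.\<close>

lemma linear_on_fscale [simp]:
  assumes "scale W = fscale" "kspace W" "linear_on U W g"
  shows "linear_on U W (\<lambda>x. fscale c (g x))"
  using linear_on_scale[OF assms(2,3), of c] assms(1) by simp

lemma linear_on_fscale_left [simp]:
  assumes "scale W = fscale" "kspace W" "w \<in> carrier W" "linear_on U scalars g"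
  shows "linear_on U W (\<lambda>x. fscale (g x) w)"
  using linear_on_scale_left[OF assms(2-)] assms(1) by simp

lemma linear_on_times [simp]:
  assumes "linear_on U scalars g"
  shows "linear_on U scalars (\<lambda>x. g x * c)" "linear_on U scalars (\<lambda>x. c * g x)"
  using assms unfolding linear_on_def by (auto simp: algebra_simps)

lemma linear_on_add [simp]:
  assumes "kspace W" "linear_on U W f" "linear_on U W g"
  shows "linear_on U W (\<lambda>x. f x + g x)"
  using linear_onD[OF assms(2)] linear_onD[OF assms(3)] kspace_closed[OF assms(1)]
    kspace_scale[OF assms(1)]
  unfolding linear_on_def by (simp add: algebra_simps)

lemma bilinear_onI:
  assumes "\<And>u. u \<in> carrier U \<Longrightarrow> linear_on V W (f u)"
    "\<And>v. v \<in> carrier V \<Longrightarrow> linear_on U W (\<lambda>u. f u v)"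
  shows "bilinear_on U V W f"
  using assms unfolding bilinear_on_def by blast

lemma bilinear_onD:
  assumes "bilinear_on U V W f" "kspace V"
  shows "u \<in> carrier U \<Longrightarrow> linear_on X V g \<Longrightarrow> linear_on X W (\<lambda>x. f u (g x))"
    "v \<in> carrier V \<Longrightarrow> linear_on X U h \<Longrightarrow> linear_on X W (\<lambda>x. f (h x) v)"
    "u \<in> carrier U \<Longrightarrow> v \<in> carrier V \<Longrightarrow> f u v \<in> carrier W"
  using assms linear_on_compose[of V W "f u" X g] linear_on_compose[of U W "\<lambda>u. f u v" X h]
  unfolding bilinear_on_def by (auto dest: linear_onD)

section \<open>Pure tensors and presentations\<close>

lemma tens_in_tensor_space [simp]:
  assumes "v \<in> carrier V" "w \<in> carrier W"
  shows "tens V W v w \<in> carrier (tensor_space V W)"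
proof -
  interpret vector_space "fscale :: 'x::field \<Rightarrow> ('y \<Rightarrow> 'x) \<Rightarrow> _" by (rule fscale_vector_space)
  show ?thesis using assms unfolding tensor_space_def by (auto intro: span_base)
qed

lemma linear_mapD:
  assumes "Vector_Spaces.linear s t f"
  shows "f (x + y) = f x + f y" "f (s c x) = t c (f x)"
proof -
  interpret Vector_Spaces.linear s t f by (rule assms)
  show "f (x + y) = f x + f y" "f (s c x) = t c (f x)" by (simp_all add: add scale)
qed

lemma tens_additive:
  "tens V W (v + v') w = tens V W v w + tens V W v' w"
  "tens V W v (w + w') = tens V W v w + tens V W v w'"
  "tens V W (scale V c v) w = fscale c (tens V W v w)"
  "tens V W v (scale W c w) = fscale c (tens V W v w)"
  by (auto simp: fun_eq_iff tens_def fscale_def linear_mapD algebra_simps)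

lemma linear_on_tens [simp]:
  "w \<in> carrier W \<Longrightarrow> linear_on U V f \<Longrightarrow> linear_on U (tensor_space V W) (\<lambda>x. tens V W (f x) w)"
  "v \<in> carrier V \<Longrightarrow> linear_on U W g \<Longrightarrow> linear_on U (tensor_space V W) (\<lambda>x. tens V W v (g x))"
  by (simp_all add: linear_on_def tens_additive)

text \<open>Scalars can be absorbed into the first factors, so the sums of pure tensors already form
  a subspace and contain the span that defines the tensor space.\<close>

lemma tensor_representation:
  assumes "kspace V" "kspace W" "t \<in> carrier (tensor_space V W)"
  obtains ps where "set ps \<subseteq> carrier V \<times> carrier W" "t = (\<Sum>(v, w)\<leftarrow>ps. tens V W v w)"
proof -
  interpret vector_space "fscale :: 'x::field \<Rightarrow> ('y \<Rightarrow> 'x) \<Rightarrow> _" by (rule fscale_vector_space)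
  let ?S = "{t. \<exists>ps. set ps \<subseteq> carrier V \<times> carrier W \<and> t = (\<Sum>(v, w)\<leftarrow>ps. tens V W v w)}"
  have "subspace ?S"
  proof (rule subspaceI)
    show "0 \<in> ?S" by (auto intro: exI[of _ "[]"])
    show "x + y \<in> ?S" if "x \<in> ?S" "y \<in> ?S" for x y
    proof -
      from that obtain ps qs where "set ps \<subseteq> carrier V \<times> carrier W" "x = (\<Sum>(v, w)\<leftarrow>ps. tens V W v w)"
        "set qs \<subseteq> carrier V \<times> carrier W" "y = (\<Sum>(v, w)\<leftarrow>qs. tens V W v w)" by blast
      then show ?thesis by (auto intro!: exI[of _ "ps @ qs"])
    qed
    show "fscale c x \<in> ?S" if "x \<in> ?S" for c x
    proof -
      from that obtain ps where ps: "set ps \<subseteq> carrier V \<times> carrier W"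
        "x = (\<Sum>(v, w)\<leftarrow>ps. tens V W v w)" by blast
      have "fscale c (\<Sum>(v, w)\<leftarrow>ps. tens V W v w)
          = (\<Sum>(v, w)\<leftarrow>map (\<lambda>(v, w). (scale V c v, w)) ps. tens V W v w)"
        by (induction ps) (auto simp: tens_additive scale_right_distrib simp del: plus_fun_apply
          zero_fun_apply)
      then show ?thesis using ps kspace_closed(3)[OF assms(1)]
        by (intro CollectI exI[of _ "map (\<lambda>(v, w). (scale V c v, w)) ps"]) auto
    qed
  qed
  moreover have "{tens V W v w | v w. v \<in> carrier V \<and> w \<in> carrier W} \<subseteq> ?S"
  proof clarify
    fix v w assume "v \<in> carrier V" "w \<in> carrier W"
    then show "\<exists>ps. set ps \<subseteq> carrier V \<times> carrier W \<and> tens V W v w = (\<Sum>(v, w)\<leftarrow>ps. tens V W v w)"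
      by (intro exI[of _ "[(v, w)]"]) simp
  qed
  ultimately have "carrier (tensor_space V W) \<subseteq> ?S"
    unfolding tensor_space_def by (simp add: span_minimal)
  with assms(3) that show ?thesis by blast
qed

text \<open>In contrast to \<open>sweedler\<close>, the following sum depends linearly on \<open>\<phi>\<close> without any bilinearity
  assumption, so that proofs of multilinearity of nested sums do not multiply.\<close>

definition tensor_rep ::
  "('k::field, 'a::ab_group_add, 'z) vspace_scheme \<Rightarrow> ('k, 'b::ab_group_add, 'y) vspace_scheme
    \<Rightarrow> ('k, 'a, 'b) tensor \<Rightarrow> ('a \<times> 'b) list"
  where "tensor_rep V W t = (SOME ps. set ps \<subseteq> carrier V \<times> carrier W \<and>
    t = (\<Sum>(v, w)\<leftarrow>ps. tens V W v w))"

definition tsum ::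
  "('k::field, 'a::ab_group_add, 'z) vspace_scheme \<Rightarrow> ('k, 'b::ab_group_add, 'y) vspace_scheme
    \<Rightarrow> ('k, 'a, 'b) tensor \<Rightarrow> ('a \<Rightarrow> 'b \<Rightarrow> 'c::ab_group_add) \<Rightarrow> 'c"
  where "tsum V W t \<phi> = (\<Sum>(v, w)\<leftarrow>tensor_rep V W t. \<phi> v w)"

lemma tensor_rep:
  assumes "kspace V" "kspace W" "t \<in> carrier (tensor_space V W)"
  shows "set (tensor_rep V W t) \<subseteq> carrier V \<times> carrier W"
    "t = (\<Sum>(v, w)\<leftarrow>tensor_rep V W t. tens V W v w)"
proof -
  have "\<exists>ps. set ps \<subseteq> carrier V \<times> carrier W \<and> t = (\<Sum>(v, w)\<leftarrow>ps. tens V W v w)"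
    using tensor_representation[OF assms] by blast
  from someI_ex[OF this] show "set (tensor_rep V W t) \<subseteq> carrier V \<times> carrier W"
    "t = (\<Sum>(v, w)\<leftarrow>tensor_rep V W t. tens V W v w)"
    unfolding tensor_rep_def by blast+
qed

text \<open>By \<open>sweedler_eq\<close> any two presentations of a tensor give a bilinear map the
  same sum; so the chosen presentation may be exchanged for \<open>ps\<close>.\<close>

lemma tsum_eq:
  assumes "kspace V" "kspace W" "bilinear_on V W U \<phi>" "set ps \<subseteq> carrier V \<times> carrier W"
  shows "tsum V W (\<Sum>(v, w)\<leftarrow>ps. tens V W v w) \<phi> = (\<Sum>(v, w)\<leftarrow>ps. \<phi> v w)"
proof -
  have "(\<Sum>(v, w)\<leftarrow>ps. tens V W v w) \<in> carrier (tensor_space V W)"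
    using assms(4)
    by (induction ps) (auto simp del: plus_fun_apply intro!: kspace_closed(1,2)[OF
      kspace_tensor_space])
  from tensor_rep[OF assms(1,2) this] show ?thesis
    using sweedler_eq[OF assms] sweedler_eq[OF assms(1-3)] unfolding tsum_def by metis
qed

text \<open>Typically \<open>\<phi>\<close> still contains inner occurrences of
  \<open>sweedler\<close> or \<open>cop2\<close> and \<open>\<psi>\<close> is their translation. A
  presentation by carrier elements cannot tell the two apart, so bilinearity is demanded of
  \<open>\<psi>\<close> alone and nested definitions are translated in one pass. The target
  \<open>U\<close> occurs only in these side conditions and is supplied at each use.\<close>

lemma sweedler_eq_tsum:
  assumes "kspace V" "kspace W" "t \<in> carrier (tensor_space V W)"
    and eq: "\<And>v w. v \<in> carrier V \<Longrightarrow> w \<in> carrier W \<Longrightarrow> \<phi> v w = \<psi> v w"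
    and lin: "\<And>v. v \<in> carrier V \<Longrightarrow> linear_on W U (\<psi> v)"
      "\<And>w. w \<in> carrier W \<Longrightarrow> linear_on V U (\<lambda>v. \<psi> v w)"
  shows "sweedler V W t \<phi> = tsum V W t \<psi>"
proof -
  have "bilinear_on V W U \<psi>" using lin by (rule bilinear_onI)
  have sum: "(\<Sum>(v, w)\<leftarrow>ps. \<phi> v w) = (\<Sum>(v, w)\<leftarrow>ps. \<psi> v w)" if "set ps \<subseteq> carrier V \<times> carrier W" for ps
    using that eq by (intro arg_cong[where f=sum_list] map_cong) auto
  have "sweedler V W t \<phi> = sweedler V W t \<psi>"
    unfolding sweedler_def by (rule arg_cong[where f=The]) (use sum in \<open>auto simp: fun_eq_iff\<close>)
  then show ?thesis
    using tensor_rep[OF assms(1-3)] sweedler_eq[OF assms(1,2) \<open>bilinear_on V W U \<psi>\<close>]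
    unfolding tsum_def by metis
qed

lemma tsum_cong:
  assumes "kspace V" "kspace W" "t = t'" "t' \<in> carrier (tensor_space V W)"
    "\<And>v w. v \<in> carrier V \<Longrightarrow> w \<in> carrier W \<Longrightarrow> \<phi> v w = \<psi> v w"
  shows "tsum V W t \<phi> = tsum V W t' \<psi>"
  unfolding tsum_def assms(3)
  using tensor_rep(1)[OF assms(1,2,4)] assms(5) by (intro arg_cong[where f=sum_list] map_cong) auto

lemma tsum_closed [simp]:
  assumes "kspace V" "kspace W" "kspace U" "t \<in> carrier (tensor_space V W)"
    "\<And>v w. v \<in> carrier V \<Longrightarrow> w \<in> carrier W \<Longrightarrow> \<phi> v w \<in> carrier U"
  shows "tsum V W t \<phi> \<in> carrier U"
proof -
  have "(\<Sum>(v, w)\<leftarrow>ps. \<phi> v w) \<in> carrier U" if "set ps \<subseteq> carrier V \<times> carrier W" for ps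
    using that by (induction ps) (auto intro!: kspace_closed(1,2)[OF assms(3)] assms(5))
  then show ?thesis using tensor_rep(1)[OF assms(1,2,4)] by (simp add: tsum_def)
qed

lemma linear_on_tsum:
  assumes "kspace V" "kspace W" "kspace X" "linear_on X Y f" "t \<in> carrier (tensor_space V W)"
    "\<And>v w. v \<in> carrier V \<Longrightarrow> w \<in> carrier W \<Longrightarrow> \<phi> v w \<in> carrier X"
  shows "f (tsum V W t \<phi>) = tsum V W t (\<lambda>v w. f (\<phi> v w))"
proof -
  let ?ps = "tensor_rep V W t"
  have "f (\<Sum>p\<leftarrow>?ps. (\<lambda>(v, w). \<phi> v w) p) = (\<Sum>p\<leftarrow>?ps. f ((\<lambda>(v, w). \<phi> v w) p))"
    by (rule linear_on_sum_list[OF assms(3,4), THEN conjunct2])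
      (use tensor_rep(1)[OF assms(1,2,5)] assms(6) in auto)
  then show ?thesis by (simp add: tsum_def case_prod_unfold)
qed

text \<open>Both presentations are fixed lists, so this is the exchange of two finite sums.\<close>

lemma tsum_swap:
  "tsum V W t (\<lambda>v w. tsum X Y s (\<lambda>x y. \<phi> v w x y))
    = tsum X Y s (\<lambda>x y. tsum V W t (\<lambda>v w. \<phi> v w x y))"
proof -
  have "(\<Sum>p\<leftarrow>ps. \<Sum>q\<leftarrow>qs. f p q) = (\<Sum>q\<leftarrow>qs. \<Sum>p\<leftarrow>ps. f p q)"
    for ps :: "('p \<times> 'q) list" and qs :: "('r \<times> 's) list" and f :: "_ \<Rightarrow> _ \<Rightarrow> 'z::ab_group_add"
    by (induction ps) (simp_all add: sum_list_addf)
  then show ?thesis by (simp add: tsum_def case_prod_unfold)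
qed

text \<open>The chosen presentation of a pure tensor may differ from the one-element list;
  bilinearity of \<open>\<phi>\<close> makes up for the difference.\<close>

lemma tsum_tens [simp]:
  assumes "kspace V" "kspace W" "v \<in> carrier V" "w \<in> carrier W"
    "\<And>v. v \<in> carrier V \<Longrightarrow> linear_on W U (\<phi> v)"
    "\<And>w. w \<in> carrier W \<Longrightarrow> linear_on V U (\<lambda>v. \<phi> v w)"
  shows "tsum V W (tens V W v w) \<phi> = \<phi> v w"
  using tsum_eq[OF assms(1,2) bilinear_onI[OF assms(5,6)], of "[(v, w)]"] assms(1-4) by simp

text \<open>The presentations chosen for \<open>t\<close>, \<open>t'\<close> and
  \<open>t + t'\<close> are unrelated. Bilinearity allows the last to be replaced by the
  concatenation of presentations of the first two, and likewise for multiples.\<close>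

lemma linear_on_tsum_arg [simp]:
  assumes "kspace V" "kspace W" "kspace X" "linear_on U (tensor_space V W) g"
    "\<And>v. v \<in> carrier V \<Longrightarrow> linear_on W X (\<phi> v)"
    "\<And>w. w \<in> carrier W \<Longrightarrow> linear_on V X (\<lambda>v. \<phi> v w)"
  shows "linear_on U X (\<lambda>x. tsum V W (g x) \<phi>)"
proof -
  interpret vector_space "fscale :: 'x::field \<Rightarrow> ('y \<Rightarrow> 'x) \<Rightarrow> _" by (rule fscale_vector_space)
  have bil: "bilinear_on V W X \<phi>" using assms(5,6) by (rule bilinear_onI)
  have cl: "\<phi> v w \<in> carrier X" if "v \<in> carrier V" "w \<in> carrier W" for v w
    using linear_onD(1)[OF assms(5)] that by blast
  have "linear_on (tensor_space V W) X (\<lambda>t. tsum V W t \<phi>)"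
    unfolding linear_on_def
  proof (intro conjI ballI allI)
    fix t assume t: "t \<in> carrier (tensor_space V W)"
    show "tsum V W t \<phi> \<in> carrier X" using assms t cl by (intro tsum_closed) auto
    obtain ps where ps: "set ps \<subseteq> carrier V \<times> carrier W" "t = (\<Sum>(v, w)\<leftarrow>ps. tens V W v w)"
      using tensor_representation[OF assms(1,2) t] .
    show "tsum V W (t + t') \<phi> = tsum V W t \<phi> + tsum V W t' \<phi>"
      if t': "t' \<in> carrier (tensor_space V W)" for t'
    proof -
      obtain qs where qs: "set qs \<subseteq> carrier V \<times> carrier W" "t' = (\<Sum>(v, w)\<leftarrow>qs. tens V W v w)"
        using tensor_representation[OF assms(1,2) t'] .
      then show ?thesis
        using ps tsum_eq[OF assms(1,2) bil, of ps] tsum_eq[OF assms(1,2) bil, of qs]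
          tsum_eq[OF assms(1,2) bil, of "ps @ qs"]
        by (simp)
    qed
    fix c
    have eq: "fscale c t = (\<Sum>(v, w)\<leftarrow>map (\<lambda>(v, w). (scale V c v, w)) ps. tens V W v w)"
      unfolding ps(2)
        by (induction ps) (auto simp: tens_additive scale_right_distrib simp del: plus_fun_apply
          zero_fun_apply)
    have "tsum V W (fscale c t) \<phi> = (\<Sum>(v, w)\<leftarrow>map (\<lambda>(v, w). (scale V c v, w)) ps. \<phi> v w)"
      unfolding eq
      by (rule tsum_eq[OF assms(1,2) bil]) (use ps(1) kspace_closed(3)[OF assms(1)] in auto)
    also have "\<dots> = scale X c (\<Sum>(v, w)\<leftarrow>ps. \<phi> v w)"
      using ps(1) linear_onD(3)[OF assms(6)]
      by (induction ps) (auto simp: kspace_scale[OF assms(3)])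
    finally show "tsum V W (scale (tensor_space V W) c t) \<phi> = scale X c (tsum V W t \<phi>)"
      using tsum_eq[OF assms(1,2) bil ps(1)] ps(2) by simp
  qed
  from linear_on_compose[OF this assms(4)] show ?thesis .
qed

text \<open>Here the tensor is constant, hence so is the list of pairs, and a finite sum of linear
  maps is linear.\<close>

lemma linear_on_tsum_param [simp]:
  assumes "kspace V" "kspace W" "kspace X" "kspace U" "t \<in> carrier (tensor_space V W)"
    "\<And>v w. v \<in> carrier V \<Longrightarrow> w \<in> carrier W \<Longrightarrow> linear_on U X (\<lambda>x. \<phi> x v w)"
  shows "linear_on U X (\<lambda>x. tsum V W t (\<phi> x))"
proof -
  have zero: "linear_on U X (\<lambda>x. 0)"
    using kspace_closed(1)[OF assms(3)] kspace_scale(5)[OF assms(3)] by (simp add: linear_on_def)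
  have "linear_on U X (\<lambda>x. \<Sum>(v, w)\<leftarrow>ps. \<phi> x v w)" if "set ps \<subseteq> carrier V \<times> carrier W" for ps
    using that
  proof (induction ps)
    case (Cons p ps)
    obtain v w where p: "p = (v, w)" by force
    show ?case using Cons p assms(6)[of v w] assms(3) by simp
  qed (use zero in simp)
  then show ?thesis using tensor_rep(1)[OF assms(1,2,5)] by (simp add: tsum_def)
qed

lemma tensor_expand:
  assumes "kspace V" "kspace W" "t \<in> carrier (tensor_space V W)"
  shows "tsum V W t (tens V W) = t"
  using tensor_rep(2)[OF assms] by (simp add: tsum_def)

lemma linear_on_tensor_expand:
  assumes "kspace V" "kspace W" "linear_on (tensor_space V W) X f" "t \<in> carrier (tensor_space V W)"
  shows "f t = tsum V W t (\<lambda>v w. f (tens V W v w))"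
  using linear_on_tsum[OF assms(1,2) kspace_tensor_space assms(3,4), of "tens V W"]
    tensor_expand[OF assms(1,2,4)] by simp

text \<open>All identities in the doubles are reduced to pure tensors by this principle; the
  linearity premises are left to the simplification rules above.\<close>

lemma tensor_ext:
  assumes "kspace V" "kspace W" "linear_on (tensor_space V W) X f"
    "linear_on (tensor_space V W) X g"
    "\<And>v w. v \<in> carrier V \<Longrightarrow> w \<in> carrier W \<Longrightarrow> f (tens V W v w) = g (tens V W v w)"
    "t \<in> carrier (tensor_space V W)"
  shows "f t = g t"
  unfolding linear_on_tensor_expand[OF assms(1-3,6)] linear_on_tensor_expand[OF assms(1,2,4,6)]
  using assms by (intro tsum_cong) auto

section \<open>Sweedler calculus\<close>

definition csum ::
  "('k::field, 'a::ab_group_add, 'z) bialgebra_scheme \<Rightarrow> 'a \<Rightarrow> ('a \<Rightarrow> 'a \<Rightarrow> 'c::ab_group_add) \<Rightarrow> 'c"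
  where "csum C c \<phi> = tsum C C (comult C c) \<phi>"

lemma csum_swap:
  "csum C c (\<lambda>x y. csum D d (\<lambda>u v. \<phi> x y u v)) = csum D d (\<lambda>u v. csum C c (\<lambda>x y. \<phi> x y u v))"
  unfolding csum_def by (rule tsum_swap)

section \<open>Rules inside an algebra, a coalgebra and a Hopf algebra\<close>

context kalgebra
begin

lemma kspace [simp]: "kspace A"
  by (rule kspace_axioms)

declare unit_closed [simp] unit_left [simp] unit_right [simp]

lemma mult_closed [simp]: "x \<in> carrier A \<Longrightarrow> y \<in> carrier A \<Longrightarrow> x \<cdot> y \<in> carrier A"
  using bilinear_onD(3)[OF mult_bilinear] by simp

lemma linear_on_mult [simp]:
  "a \<in> carrier A \<Longrightarrow> linear_on U A g \<Longrightarrow> linear_on U A (\<lambda>x. a \<cdot> g x)"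
  "a \<in> carrier A \<Longrightarrow> linear_on U A g \<Longrightarrow> linear_on U A (\<lambda>x. g x \<cdot> a)"
  using bilinear_onD(1,2)[OF mult_bilinear] by simp_all

lemma scale_closed [simp]: "x \<in> carrier A \<Longrightarrow> scale A c x \<in> carrier A"
  by (rule kspace_closed(3)[OF kspace])

lemma mult_scale [simp]:
  assumes "x \<in> carrier A" "y \<in> carrier A"
  shows "scale A c x \<cdot> y = scale A c (x \<cdot> y)" "x \<cdot> scale A c y = scale A c (x \<cdot> y)"
  using linear_onD(3)[OF linear_on_mult(2)[OF assms(2) linear_on_id], OF assms(1)]
    linear_onD(3)[OF linear_on_mult(1)[OF assms(1) linear_on_id], OF assms(2)] by simp_all

end

context kcoalgebra
begin

lemma kspaceC [simp]: "kspace C"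
  by (rule kspace_axioms)

lemma comult_closed [simp]: "c \<in> carrier C \<Longrightarrow> comult C c \<in> carrier (tensor_space C C)"
  by (rule linear_onD(1)[OF comult_linear])

lemma csum_cong:
  assumes "c = d" "d \<in> carrier C"
    "\<And>x y. x \<in> carrier C \<Longrightarrow> y \<in> carrier C \<Longrightarrow> \<phi> x y = \<psi> x y"
  shows "csum C c \<phi> = csum C d \<psi>"
  unfolding csum_def using assms by (intro tsum_cong) auto

lemma csum_closed [simp]:
  assumes "kspace U" "c \<in> carrier C"
    "\<And>x y. x \<in> carrier C \<Longrightarrow> y \<in> carrier C \<Longrightarrow> \<phi> x y \<in> carrier U"
  shows "csum C c \<phi> \<in> carrier U"
  unfolding csum_def using assms by simp

lemma linear_on_csum:
  assumes "kspace X" "linear_on X Y f" "c \<in> carrier C"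
    "\<And>x y. x \<in> carrier C \<Longrightarrow> y \<in> carrier C \<Longrightarrow> \<phi> x y \<in> carrier X"
  shows "f (csum C c \<phi>) = csum C c (\<lambda>x y. f (\<phi> x y))"
  unfolding csum_def using assms by (intro linear_on_tsum) auto

lemma linear_on_comult [simp]: "linear_on U C g \<Longrightarrow> linear_on U (tensor_space C C) (\<lambda>x.
    comult C (g x))"
  by (rule linear_on_compose[OF comult_linear])

lemma linear_on_counit [simp]: "linear_on U C g \<Longrightarrow> linear_on U scalars (\<lambda>x. counit C (g x))"
  by (rule linear_on_compose[OF counit_linear])

lemma linear_on_csum_arg [simp]:
  assumes "kspace X" "linear_on U C g"
    "\<And>v. v \<in> carrier C \<Longrightarrow> linear_on C X (\<phi> v)"
    "\<And>w. w \<in> carrier C \<Longrightarrow> linear_on C X (\<lambda>v. \<phi> v w)"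
  shows "linear_on U X (\<lambda>x. csum C (g x) \<phi>)"
  unfolding csum_def using assms by simp

lemma linear_on_csum_param [simp]:
  assumes "kspace X" "kspace U" "c \<in> carrier C"
    "\<And>v w. v \<in> carrier C \<Longrightarrow> w \<in> carrier C \<Longrightarrow> linear_on U X (\<lambda>x. \<phi> x v w)"
  shows "linear_on U X (\<lambda>x. csum C c (\<phi> x))"
  unfolding csum_def using assms by simp

lemma cop2_eq_csum:
  assumes "c \<in> carrier C"
    "\<And>v w. v \<in> carrier C \<Longrightarrow> w \<in> carrier C \<Longrightarrow> \<phi> v w = \<psi> v w"
    "\<And>v. v \<in> carrier C \<Longrightarrow> linear_on C U (\<psi> v)"
    "\<And>w. w \<in> carrier C \<Longrightarrow> linear_on C U (\<lambda>v. \<psi> v w)"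
  shows "cop2 C c \<phi> = csum C c \<psi>"
  unfolding cop2_def csum_def using assms by (intro sweedler_eq_tsum) auto

lemma cop3_eq_csum:
  assumes "c \<in> carrier C" "kspace U"
    "\<And>u v w. u \<in> carrier C \<Longrightarrow> v \<in> carrier C \<Longrightarrow> w \<in> carrier C \<Longrightarrow> \<phi> u v w = \<psi> u v w"
    "\<And>u v. u \<in> carrier C \<Longrightarrow> v \<in> carrier C \<Longrightarrow> linear_on C U (\<psi> u v)"
    "\<And>u w. u \<in> carrier C \<Longrightarrow> w \<in> carrier C \<Longrightarrow> linear_on C U (\<lambda>v. \<psi> u v w)"
    "\<And>v w. v \<in> carrier C \<Longrightarrow> w \<in> carrier C \<Longrightarrow> linear_on C U (\<lambda>u. \<psi> u v w)"
  shows "cop3 C c \<phi> = csum C c (\<lambda>u d. csum C d (\<lambda>v w. \<psi> u v w))"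
  unfolding cop3_def
proof (rule cop2_eq_csum[where U=U])
  fix u d assume "u \<in> carrier C" "d \<in> carrier C"
  then show "cop2 C d (\<lambda>v w. \<phi> u v w) = csum C d (\<lambda>v w. \<psi> u v w)"
    using assms by (intro cop2_eq_csum) auto
qed (use assms in auto)

text \<open>The coassociativity axiom equates two elements of C \<otimes> (C \<otimes> C). Applying
  the linear map \<open>?F\<close> induced by the trilinear \<open>\<phi>\<close> to both of them
  gives the two iterated sums.\<close>

lemma csum_coassoc:
  assumes X: "kspace X" and c: "c \<in> carrier C"
    and lin: "\<And>u v. u \<in> carrier C \<Longrightarrow> v \<in> carrier C \<Longrightarrow> linear_on C X (\<phi> u v)"
      "\<And>u w. u \<in> carrier C \<Longrightarrow> w \<in> carrier C \<Longrightarrow> linear_on C X (\<lambda>v. \<phi> u v w)"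
      "\<And>v w. v \<in> carrier C \<Longrightarrow> w \<in> carrier C \<Longrightarrow> linear_on C X (\<lambda>u. \<phi> u v w)"
  shows "csum C c (\<lambda>d w. csum C d (\<lambda>u v. \<phi> u v w)) = csum C c (\<lambda>u d. csum C d (\<lambda>v w. \<phi> u v w))"
proof -
  let ?T = "tensor_space C (tensor_space C C)"
  let ?F = "\<lambda>t. tsum C (tensor_space C C) t (\<lambda>u e. tsum C C e (\<lambda>v w. \<phi> u v w))"
  have F: "linear_on ?T X ?F" using X lin by simp
  have Ft: "?F (tens C (tensor_space C C) u (tens C C v w)) = \<phi> u v w"
    if "u \<in> carrier C" "v \<in> carrier C" "w \<in> carrier C" for u v w
    using X lin that by (simp add: tsum_tens[where U=X])
  have Fd: "?F (tens C (tensor_space C C) u (comult C d)) = csum C d (\<lambda>v w. \<phi> u v w)"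
    if "u \<in> carrier C" "d \<in> carrier C" for u d
    using X lin that by (simp add: tsum_tens[where U=X] csum_def)
  have "cop2 C c (\<lambda>d w. cop2 C d (\<lambda>u v. tens C (tensor_space C C) u (tens C C v w)))
      = csum C c (\<lambda>d w. csum C d (\<lambda>u v. tens C (tensor_space C C) u (tens C C v w)))"
    using c by (intro cop2_eq_csum[where U="?T"]) auto
  moreover have "cop2 C c (\<lambda>u d. tens C (tensor_space C C) u (comult C d))
      = csum C c (\<lambda>u d. tens C (tensor_space C C) u (comult C d))"
    using c by (intro cop2_eq_csum[where U="?T"]) auto
  ultimately have "csum C c (\<lambda>d w. csum C d (\<lambda>u v. tens C (tensor_space C C) u (tens C C v w)))
      = csum C c (\<lambda>u d. tens C (tensor_space C C) u (comult C d))"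
    using coassoc[OF c] by simp
  from arg_cong[OF this, of ?F]
  have "csum C c (\<lambda>d w. ?F (csum C d (\<lambda>u v. tens C (tensor_space C C) u (tens C C v w))))
      = csum C c (\<lambda>u d. ?F (tens C (tensor_space C C) u (comult C d)))"
    using c by (subst (asm) (1 2) linear_on_csum[OF _ F]) auto
  moreover have "csum C c (\<lambda>d w. ?F (csum C d (\<lambda>u v. tens C (tensor_space C C) u (tens C C v w))))
      = csum C c (\<lambda>d w. csum C d (\<lambda>u v. \<phi> u v w))"
    using c by (intro csum_cong refl) (auto simp: linear_on_csum[OF _ F] Ft intro!: csum_cong)
  moreover have "csum C c (\<lambda>u d. ?F (tens C (tensor_space C C) u (comult C d)))
      = csum C c (\<lambda>u d. csum C d (\<lambda>v w. \<phi> u v w))"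
    using c by (intro csum_cong refl Fd) auto
  ultimately show ?thesis by simp
qed

text \<open>This is the counit axiom with the linear map \<open>f\<close> applied and moved under
  the sum.\<close>

lemma csum_counit:
  assumes "linear_on C X f" "c \<in> carrier C"
  shows "csum C c (\<lambda>x y. scale X (counit C x) (f y)) = f c"
    "csum C c (\<lambda>x y. scale X (counit C y) (f x)) = f c"
proof -
  have "cop2 C c (\<lambda>x y. scale C (counit C x) y) = csum C c (\<lambda>x y. scale C (counit C x) y)"
    "cop2 C c (\<lambda>x y. scale C (counit C y) x) = csum C c (\<lambda>x y. scale C (counit C y) x)"
    using assms by (auto intro!: cop2_eq_csum[where U=C])
  then have "f c = f (csum C c (\<lambda>x y. scale C (counit C x) y))"
    "f c = f (csum C c (\<lambda>x y. scale C (counit C y) x))"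
    using counit_left[OF assms(2)] counit_right[OF assms(2)] by simp_all
  moreover have "csum C c (\<lambda>x y. f (scale C (counit C x) y))
      = csum C c (\<lambda>x y. scale X (counit C x) (f y))"
    "csum C c (\<lambda>x y. f (scale C (counit C y) x)) = csum C c (\<lambda>x y. scale X (counit C y) (f x))"
    using assms linear_onD(3)[OF assms(1)] by (auto intro!: csum_cong)
  ultimately show "csum C c (\<lambda>x y. scale X (counit C x) (f y)) = f c"
    "csum C c (\<lambda>x y. scale X (counit C y) (f x)) = f c"
    using assms kspace_closed(3)[OF kspaceC] by (simp_all add: linear_on_csum[OF _ assms(1)])
qed

end

context hopf_algebra
begin

lemma csum_mult:
  assumes "kspace X" "a \<in> carrier B" "b \<in> carrier B"
    "\<And>u. u \<in> carrier B \<Longrightarrow> linear_on B X (\<phi> u)"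
    "\<And>v. v \<in> carrier B \<Longrightarrow> linear_on B X (\<lambda>u. \<phi> u v)"
  shows "csum B (a \<cdot> b) \<phi> = csum B a (\<lambda>a1 a2. csum B b (\<lambda>b1 b2. \<phi> (a1 \<cdot> b1) (a2 \<cdot> b2)))"
proof -
  let ?T = "tensor_space B B"
  have F: "linear_on ?T X (\<lambda>t. tsum B B t \<phi>)" using assms by simp
  have "cop2 B b (\<lambda>b1 b2. tens B B (a1 \<cdot> b1) (a2 \<cdot> b2))
      = csum B b (\<lambda>b1 b2. tens B B (a1 \<cdot> b1) (a2 \<cdot> b2))"
    if "a1 \<in> carrier B" "a2 \<in> carrier B" for a1 a2
    using assms that by (intro cop2_eq_csum[where U="?T"]) auto
  then have "cop2 B a (\<lambda>a1 a2. cop2 B b (\<lambda>b1 b2. tens B B (a1 \<cdot> b1) (a2 \<cdot> b2)))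
      = csum B a (\<lambda>a1 a2. csum B b (\<lambda>b1 b2. tens B B (a1 \<cdot> b1) (a2 \<cdot> b2)))"
    using assms by (intro cop2_eq_csum[where U="?T"]) auto
  then show ?thesis
    unfolding csum_def[of B "a \<cdot> b"] comult_mult[OF assms(2,3)] using assms
    by (auto simp: linear_on_csum[OF _ F] tsum_tens[where U=X] intro!: csum_cong)
qed

lemma csum_unit:
  assumes "kspace X"
    "\<And>u. u \<in> carrier B \<Longrightarrow> linear_on B X (\<phi> u)"
    "\<And>v. v \<in> carrier B \<Longrightarrow> linear_on B X (\<lambda>u. \<phi> u v)"
  shows "csum B \<one> \<phi> = \<phi> \<one> \<one>"
  unfolding csum_def comult_unit using assms by (simp add: tsum_tens[where U=X])

lemma antipode_closed [simp]: "b \<in> carrier B \<Longrightarrow> antipode B b \<in> carrier B"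
  by (rule linear_onD(1)[OF antipode_linear])

lemma linear_on_antipode [simp]: "linear_on U B g \<Longrightarrow> linear_on U B (\<lambda>x. antipode B (g x))"
  by (rule linear_on_compose[OF antipode_linear])

lemma csum_antipode:
  assumes "linear_on B X f" "b \<in> carrier B"
  shows "csum B b (\<lambda>x y. f (antipode B x \<cdot> y)) = scale X (counit B b) (f \<one>)"
    "csum B b (\<lambda>x y. f (x \<cdot> antipode B y)) = scale X (counit B b) (f \<one>)"
proof -
  have l: "csum B b (\<lambda>x y. antipode B x \<cdot> y) = scale B (counit B b) \<one>"
    unfolding antipode_left[OF assms(2), symmetric]
    by (rule cop2_eq_csum[where U=B, symmetric]) (use assms(2) in simp_all)
  have r: "csum B b (\<lambda>x y. x \<cdot> antipode B y) = scale B (counit B b) \<one>"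
    unfolding antipode_right[OF assms(2), symmetric]
    by (rule cop2_eq_csum[where U=B, symmetric]) (use assms(2) in simp_all)
  from l[THEN arg_cong[where f=f]] r[THEN arg_cong[where f=f]]
  show "csum B b (\<lambda>x y. f (antipode B x \<cdot> y)) = scale X (counit B b) (f \<one>)"
    "csum B b (\<lambda>x y. f (x \<cdot> antipode B y)) = scale X (counit B b) (f \<one>)"
    using assms(2) linear_onD(3)[OF assms(1)] by (simp_all add: linear_on_csum[OF _ assms(1)])
qed

lemma antipode_unit [simp]: "antipode B \<one> = \<one>"
  using csum_antipode(1)[of B "\<lambda>x. x" \<one>]
    by (simp add: csum_unit[where X=B] counit_unit kspace_scale)

text \<open>Both sides equal \<open>\<Sum> S(a' b') a'' b'' S(b''') S(a''')\<close>.\<close>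

lemma antipode_mult:
  assumes a: "a \<in> carrier B" and b: "b \<in> carrier B"
  shows "antipode B (a \<cdot> b) = antipode B b \<cdot> antipode B a"
proof -
  let ?S = "antipode B"
  let ?\<phi> = "\<lambda>a1 a2 a3 b1 b2 b3. ?S (a1 \<cdot> b1) \<cdot> (a2 \<cdot> (b2 \<cdot> (?S b3 \<cdot> ?S a3)))"
  have "csum B a (\<lambda>a1 d. csum B d (\<lambda>a2 a3. csum B b (\<lambda>b1 e. csum B e (\<lambda>b2 b3.
      ?\<phi> a1 a2 a3 b1 b2 b3))))
      = csum B a (\<lambda>a1 d. csum B d (\<lambda>a2 a3. csum B b (\<lambda>b1 e.
        scale B (counit B e) (?S (a1 \<cdot> b1) \<cdot> (a2 \<cdot> ?S a3)))))"
  proof -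
    have "csum B e (\<lambda>b2 b3. ?\<phi> a1 a2 a3 b1 b2 b3)
        = scale B (counit B e) (?S (a1 \<cdot> b1) \<cdot> (a2 \<cdot> ?S a3))"
      if "a1 \<in> carrier B" "a2 \<in> carrier B" "a3 \<in> carrier B" "b1 \<in> carrier B" "e \<in> carrier B"
      for a1 a2 a3 b1 e
      using that csum_antipode(2)[of B "\<lambda>u. ?S (a1 \<cdot> b1) \<cdot> (a2 \<cdot> (u \<cdot> ?S a3))" e]
      by (simp add: mult_assoc cong: csum_cong)
    with a b show ?thesis by (simp cong: csum_cong)
  qed
  also have "\<dots> = csum B a (\<lambda>a1 d. csum B d (\<lambda>a2 a3. ?S (a1 \<cdot> b) \<cdot> (a2 \<cdot> ?S a3)))"
    using a b by (intro csum_cong refl csum_counit(2)) auto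
  also have "\<dots> = csum B a (\<lambda>a1 d. scale B (counit B d) (?S (a1 \<cdot> b)))"
  proof (intro csum_cong refl a)
    fix a1 d assume "a1 \<in> carrier B" "d \<in> carrier B"
    then show "csum B d (\<lambda>a2 a3. ?S (a1 \<cdot> b) \<cdot> (a2 \<cdot> ?S a3)) = scale B (counit B d) (?S (a1 \<cdot> b))"
      using csum_antipode(2)[of B "\<lambda>u. ?S (a1 \<cdot> b) \<cdot> u" d] b by simp
  qed
  also have "\<dots> = ?S (a \<cdot> b)"
    using a b by (intro csum_counit(2)) auto
  finally have 1: "csum B a (\<lambda>a1 d. csum B d (\<lambda>a2 a3. csum B b (\<lambda>b1 e. csum B e (\<lambda>b2 b3.
      ?\<phi> a1 a2 a3 b1 b2 b3))))
    = ?S (a \<cdot> b)" .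
  have "csum B a (\<lambda>a1 d. csum B d (\<lambda>a2 a3. csum B b (\<lambda>b1 e. csum B e (\<lambda>b2 b3.
      ?\<phi> a1 a2 a3 b1 b2 b3))))
    = csum B a (\<lambda>d a3. csum B d (\<lambda>a1 a2. csum B b (\<lambda>e b3. csum B e (\<lambda>b1 b2.
      ?\<phi> a1 a2 a3 b1 b2 b3))))"
    using a b by (simp add: csum_coassoc[where X=B] cong: csum_cong)
  also have "\<dots>
      = csum B a (\<lambda>d a3. csum B b (\<lambda>e b3. csum B d (\<lambda>a1 a2. csum B e (\<lambda>b1 b2.
        ?\<phi> a1 a2 a3 b1 b2 b3))))"
    by (subst csum_swap) (rule refl)
  also have "\<dots> = csum B a (\<lambda>d a3. csum B b (\<lambda>e b3. scale B (counit B (d \<cdot> e)) (?S b3 \<cdot> ?S a3)))"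
  proof (intro csum_cong refl a b)
    fix d e a3 b3 assume *: "d \<in> carrier B" "e \<in> carrier B" "a3 \<in> carrier B" "b3 \<in> carrier B"
    \<comment> \<open>After regrouping, the first two components of \<open>a\<close> and of
      \<open>b\<close> are the coproducts of \<open>d\<close> and \<open>e\<close>, whose product is
      the coproduct of \<open>d \<cdot> e\<close>. The left antipode axiom then applies to
      \<open>d \<cdot> e\<close> as a whole.\<close>
    have "csum B d (\<lambda>a1 a2. csum B e (\<lambda>b1 b2. ?\<phi> a1 a2 a3 b1 b2 b3))
        = csum B (d \<cdot> e) (\<lambda>u v. ?S u \<cdot> v \<cdot> (?S b3 \<cdot> ?S a3))"
      using * by (simp add: csum_mult[where X=B] mult_assoc cong: csum_cong)
    also have "\<dots> = scale B (counit B (d \<cdot> e)) (?S b3 \<cdot> ?S a3)"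
      using * csum_antipode(1)[of B "\<lambda>u. u \<cdot> (?S b3 \<cdot> ?S a3)"] by simp
    finally show "csum B d (\<lambda>a1 a2. csum B e (\<lambda>b1 b2. ?\<phi> a1 a2 a3 b1 b2 b3))
        = scale B (counit B (d \<cdot> e)) (?S b3 \<cdot> ?S a3)" .
  qed
  also have "\<dots> = csum B a (\<lambda>d a3. scale B (counit B d) (?S b \<cdot> ?S a3))"
  proof (intro csum_cong refl a)
    fix d a3 assume *: "d \<in> carrier B" "a3 \<in> carrier B"
    have "csum B b (\<lambda>e b3. scale B (counit B e) (scale B (counit B d) (?S b3 \<cdot> ?S a3)))
        = scale B (counit B d) (?S b \<cdot> ?S a3)"
      using * b by (intro csum_counit(1)) auto
    then show "csum B b (\<lambda>e b3. scale B (counit B (d \<cdot> e)) (?S b3 \<cdot> ?S a3))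
        = scale B (counit B d) (?S b \<cdot> ?S a3)"
      using * b by (simp add: counit_mult kspace_scale(3)[OF kspace] mult.commute cong: csum_cong)
  qed
  also have "\<dots> = ?S b \<cdot> ?S a"
    using a b by (intro csum_counit(1)) auto
  finally show ?thesis using 1 by simp
qed

end

section \<open>Cleft objects\<close>

text \<open>The coaction is the comultiplication of \<open>H\<close>, and the identity map \<open>H \<rightarrow> X\<close> has the convolution
  inverse \<open>\<iota>\<close>. The action is the Miyashita--Ulbrich action.\<close>

locale cleft_object = kcoalgebra H
  for H :: "('k::field, 'h::ab_group_add) bialgebra" (structure)
    and X :: "('k, 'h, 'h) yd_algebra" and \<iota> :: "'h \<Rightarrow> 'h" +
  assumes algebra: "kalgebra X"
    and same_space: "carrier X = carrier H" "scale X = scale H"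
    and mult_bilinearH: "bilinear_on H H H (mult H)"
    and same_unit: "\<one>\<^bsub>X\<^esub> = \<one>"
    and comult_unitH: "comult H \<one> = tens H H \<one> \<one>"
    and counit_unitH: "counit H \<one> = 1"
    and coact_eq: "coact X = comult H"
    and comult_multX: "\<lbrakk>x \<in> carrier H; y \<in> carrier H\<rbrakk> \<Longrightarrow> comult H (x \<cdot>\<^bsub>X\<^esub> y)
      = csum H x (\<lambda>x1 x2. csum H y (\<lambda>y1 y2. tens H H (x1 \<cdot> y1) (x2 \<cdot>\<^bsub>X\<^esub> y2)))"
    and linear_\<iota>: "linear_on H H \<iota>"
    and \<iota>_left: "x \<in> carrier H \<Longrightarrow> csum H x (\<lambda>x1 x2. \<iota> x1 \<cdot>\<^bsub>X\<^esub> x2) = scale H (counit H x) \<one>"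
    and \<iota>_right: "x \<in> carrier H \<Longrightarrow> csum H x (\<lambda>x1 x2. x1 \<cdot>\<^bsub>X\<^esub> \<iota> x2) = scale H (counit H x) \<one>"
    and act_eq: "\<lbrakk>h \<in> carrier H; x \<in> carrier H\<rbrakk> \<Longrightarrow> act X h x = csum H h (\<lambda>h1 h2. h1 \<cdot>\<^bsub>X\<^esub> x \<cdot>\<^bsub>X\<^esub> \<iota> h2)"
begin

abbreviation multX (infixl "\<bullet>" 70) where "x \<bullet> y \<equiv> x \<cdot>\<^bsub>X\<^esub> y"
abbreviation actX (infixr "\<rhd>" 69) where "h \<rhd> x \<equiv> act X h x"

lemma linear_from_X: "linear_on X V f = linear_on H V f"
  and linear_to_X: "linear_on W X g = linear_on W H g"
  using same_space by (simp_all add: linear_on_def)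

lemma tens_X:
  "tens H X = tens H H" "tensor_space H X = tensor_space H H" "sweedler H X = sweedler H H"
  using same_space tensor_same_space[of H H X H] by simp_all

lemmas linear_on_X = linear_from_X linear_to_X tens_X

interpretation A: kalgebra X by (rule algebra)

lemma multX_closed [simp]: "x \<in> carrier H \<Longrightarrow> y \<in> carrier H \<Longrightarrow> x \<bullet> y \<in> carrier H"
  using A.mult_closed by (simp add: same_space)

lemma multH_closed [simp]: "x \<in> carrier H \<Longrightarrow> y \<in> carrier H \<Longrightarrow> x \<cdot> y \<in> carrier H"
  using bilinear_onD(3)[OF mult_bilinearH] by simp

lemma linear_on_multX [simp]:
  "a \<in> carrier H \<Longrightarrow> linear_on U H g \<Longrightarrow> linear_on U H (\<lambda>x. a \<bullet> g x)"
  "a \<in> carrier H \<Longrightarrow> linear_on U H g \<Longrightarrow> linear_on U H (\<lambda>x. g x \<bullet> a)"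
  by - (rule A.linear_on_mult[unfolded linear_on_X same_space], assumption+)+

lemma linear_on_multH [simp]:
  "a \<in> carrier H \<Longrightarrow> linear_on U H g \<Longrightarrow> linear_on U H (\<lambda>x. a \<cdot> g x)"
  "a \<in> carrier H \<Longrightarrow> linear_on U H g \<Longrightarrow> linear_on U H (\<lambda>x. g x \<cdot> a)"
  using bilinear_onD(1,2)[OF mult_bilinearH] by simp_all

lemma multX_assoc: "x \<in> carrier H \<Longrightarrow> y \<in> carrier H \<Longrightarrow> z \<in> carrier H \<Longrightarrow> x \<bullet> y \<bullet> z = x \<bullet> (y \<bullet> z)"
  using A.mult_assoc by (simp add: same_space)

lemma multX_unit [simp]:
  "\<one> \<in> carrier H" "x \<in> carrier H \<Longrightarrow> \<one> \<bullet> x = x" "x \<in> carrier H \<Longrightarrow> x \<bullet> \<one> = x"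
  using A.unit_closed A.unit_left A.unit_right by (simp_all add: same_space same_unit)

lemma linear_on_\<iota> [simp]: "linear_on U H g \<Longrightarrow> linear_on U H (\<lambda>x. \<iota> (g x))"
  by (rule linear_on_compose[OF linear_\<iota>])

lemma \<iota>_closed [simp]: "x \<in> carrier H \<Longrightarrow> \<iota> x \<in> carrier H"
  by (rule linear_onD(1)[OF linear_\<iota>])

lemma csum_\<iota>:
  assumes "linear_on H Y f" "x \<in> carrier H"
  shows "csum H x (\<lambda>x1 x2. f (\<iota> x1 \<bullet> x2)) = scale Y (counit H x) (f \<one>)"
    "csum H x (\<lambda>x1 x2. f (x1 \<bullet> \<iota> x2)) = scale Y (counit H x) (f \<one>)"
  using arg_cong[OF \<iota>_left[OF assms(2)], of f] arg_cong[OF \<iota>_right[OF assms(2)], of f]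
    assms(2) linear_onD(3)[OF assms(1)]
  by (simp_all add: linear_on_csum[OF _ assms(1)])

lemma csum_multX:
  assumes "kspace Y" "a \<in> carrier H" "b \<in> carrier H"
    "\<And>u. u \<in> carrier H \<Longrightarrow> linear_on H Y (\<phi> u)"
    "\<And>v. v \<in> carrier H \<Longrightarrow> linear_on H Y (\<lambda>u. \<phi> u v)"
  shows "csum H (a \<bullet> b) \<phi> = csum H a (\<lambda>a1 a2. csum H b (\<lambda>b1 b2. \<phi> (a1 \<cdot> b1) (a2 \<bullet> b2)))"
proof -
  have F: "linear_on (tensor_space H H) Y (\<lambda>t. tsum H H t \<phi>)" using assms by simp
  show ?thesis
    unfolding csum_def[of H "a \<bullet> b"] comult_multX[OF assms(2,3)] using assms
    by (auto simp: linear_on_csum[OF _ F] tsum_tens[where U=Y] intro!: csum_cong)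
qed

lemma act_closed [simp]: "h \<in> carrier H \<Longrightarrow> x \<in> carrier H \<Longrightarrow> h \<rhd> x \<in> carrier H"
  by (simp add: act_eq)

lemma linear_on_act [simp]:
  assumes "kspace U"
  shows "h \<in> carrier H \<Longrightarrow> linear_on U H g \<Longrightarrow> linear_on U H (\<lambda>x. h \<rhd> g x)"
    "x \<in> carrier H \<Longrightarrow> linear_on U H g \<Longrightarrow> linear_on U H (\<lambda>h. g h \<rhd> x)"
proof -
  assume g: "linear_on U H g"
  note cl = linear_onD(1)[OF g]
  show "linear_on U H (\<lambda>x. h \<rhd> g x)" if "h \<in> carrier H"
    using that g assms cl by (subst linear_on_cong[OF assms act_eq]) auto
  show "linear_on U H (\<lambda>h. g h \<rhd> x)" if "x \<in> carrier H"
    using that g assms cl by (subst linear_on_cong[OF assms act_eq]) auto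
qed

text \<open>The action ends in \<open>\<iota>\<close>, which cancels against the next component. The
  trailing factor \<open>a\<close> allows this cancellation inside products that are bracketed to
  the right.\<close>

lemma act_multX:
  assumes "y \<in> carrier H" "x \<in> carrier H" "a \<in> carrier H"
  shows "csum H y (\<lambda>y1 y2. (y1 \<rhd> x) \<bullet> (y2 \<bullet> a)) = y \<bullet> x \<bullet> a"
proof -
  have "csum H y (\<lambda>y1 y2. (y1 \<rhd> x) \<bullet> (y2 \<bullet> a))
      = csum H y (\<lambda>d y2. csum H d (\<lambda>u v. u \<bullet> x \<bullet> \<iota> v \<bullet> (y2 \<bullet> a)))"
    using assms
    by (intro csum_cong refl)
      (simp_all add: act_eq linear_on_csum[where X=H and Y=H and f="\<lambda>t. t \<bullet> (_ \<bullet> a)"])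
  also have "\<dots> = csum H y (\<lambda>u d. csum H d (\<lambda>v y2. u \<bullet> x \<bullet> (\<iota> v \<bullet> y2 \<bullet> a)))"
    using assms by (simp add: csum_coassoc[where X=H] multX_assoc cong: csum_cong)
  also have "\<dots> = csum H y (\<lambda>u d. scale H (counit H d) (u \<bullet> x \<bullet> a))"
  proof (intro csum_cong refl assms(1))
    fix u d assume "u \<in> carrier H" "d \<in> carrier H"
    then show "csum H d (\<lambda>v y2. u \<bullet> x \<bullet> (\<iota> v \<bullet> y2 \<bullet> a)) = scale H (counit H d) (u \<bullet> x \<bullet> a)"
      using csum_\<iota>(1)[of H "\<lambda>t. u \<bullet> x \<bullet> (t \<bullet> a)" d] assms by simp
  qed
  also have "\<dots> = y \<bullet> x \<bullet> a"
    using assms by (intro csum_counit(2)) auto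
  finally show ?thesis .
qed

lemma act_multX_unit:
  assumes "y \<in> carrier H" "x \<in> carrier H"
  shows "csum H y (\<lambda>y1 y2. (y1 \<rhd> x) \<bullet> y2) = y \<bullet> x"
  using act_multX[of y x \<one>] assms by (simp cong: csum_cong)

text \<open>Both sides equal \<open>\<Sum> (h' \<bullet> k')' \<rhd> x \<bullet> (h' \<bullet> k')'' \<bullet> \<iota> k'' \<bullet> \<iota> h''\<close>: this is the
  multiplicativity of the translation map \<open>h \<mapsto> h' \<otimes> \<iota> h''\<close>.\<close>

lemma act_act:
  assumes h: "h \<in> carrier H" and k: "k \<in> carrier H" and x: "x \<in> carrier H"
  shows "(h \<cdot> k) \<rhd> x = h \<rhd> k \<rhd> x"
proof -
  let ?L = "csum H h (\<lambda>h1 h2. csum H k (\<lambda>k1 k2.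
    csum H (h1 \<bullet> k1) (\<lambda>y1 y2. (y1 \<rhd> x) \<bullet> (y2 \<bullet> (\<iota> k2 \<bullet> \<iota> h2)))))"
  have "?L = csum H h (\<lambda>h1 h2. csum H k (\<lambda>k1 k2. h1 \<bullet> (k1 \<bullet> x \<bullet> \<iota> k2) \<bullet> \<iota> h2))"
    using h k x by (simp add: act_multX multX_assoc cong: csum_cong)
  also have "\<dots> = csum H h (\<lambda>h1 h2. h1 \<bullet> (k \<rhd> x) \<bullet> \<iota> h2)"
  proof (intro csum_cong refl h)
    fix h1 h2 assume "h1 \<in> carrier H" "h2 \<in> carrier H"
    then show "csum H k (\<lambda>k1 k2. h1 \<bullet> (k1 \<bullet> x \<bullet> \<iota> k2) \<bullet> \<iota> h2) = h1 \<bullet> (k \<rhd> x) \<bullet> \<iota> h2"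
      using k x by (simp add: act_eq linear_on_csum[where X=H and Y=H and f="\<lambda>t. h1 \<bullet> t \<bullet> \<iota> h2"])
  qed
  also have "\<dots> = h \<rhd> k \<rhd> x" using h k x by (simp add: act_eq[of h])
  finally have L: "?L = h \<rhd> k \<rhd> x" .
  \<comment> \<open>For the second evaluation the coproduct of \<open>h1 \<bullet> k1\<close> is
    expanded; the components of \<open>k\<close>, and then those of \<open>h\<close>, cancel against
    \<open>\<iota>\<close>.\<close>
  have "?L = csum H h (\<lambda>h1 h2. csum H k (\<lambda>k1 k2. csum H h1 (\<lambda>p q. csum H k1 (\<lambda>r s.
      (p \<cdot> r \<rhd> x) \<bullet> (q \<bullet> (s \<bullet> \<iota> k2 \<bullet> \<iota> h2))))))"
    using h k x by (simp add: csum_multX[where Y=H] multX_assoc cong: csum_cong)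
  also have "\<dots> = csum H h (\<lambda>h1 h2. csum H h1 (\<lambda>p q. csum H k (\<lambda>k1 k2. csum H k1 (\<lambda>r s.
      (p \<cdot> r \<rhd> x) \<bullet> (q \<bullet> (s \<bullet> \<iota> k2 \<bullet> \<iota> h2))))))"
    by (subst (2) csum_swap) (rule refl)
  also have "\<dots> = csum H h (\<lambda>h1 h2. csum H h1 (\<lambda>p q. csum H k (\<lambda>r e. csum H e (\<lambda>s k2.
      (p \<cdot> r \<rhd> x) \<bullet> (q \<bullet> (s \<bullet> \<iota> k2 \<bullet> \<iota> h2))))))"
    using h k x by (simp add: csum_coassoc[where X=H] cong: csum_cong)
  also have "\<dots> = csum H h (\<lambda>h1 h2. csum H h1 (\<lambda>p q. csum H k (\<lambda>r e.
      scale H (counit H e) ((p \<cdot> r \<rhd> x) \<bullet> (q \<bullet> \<iota> h2)))))"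
  proof -
    have "csum H e (\<lambda>s k2. (p \<cdot> r \<rhd> x) \<bullet> (q \<bullet> (s \<bullet> \<iota> k2 \<bullet> \<iota> h2)))
        = scale H (counit H e) ((p \<cdot> r \<rhd> x) \<bullet> (q \<bullet> \<iota> h2))"
      if "p \<in> carrier H" "q \<in> carrier H" "r \<in> carrier H" "e \<in> carrier H" "h2 \<in> carrier H"
      for p q r e h2
      using that x csum_\<iota>(2)[of H "\<lambda>t. (p \<cdot> r \<rhd> x) \<bullet> (q \<bullet> (t \<bullet> \<iota> h2))" e] by simp
    then show ?thesis using h k by (simp cong: csum_cong)
  qed
  also have "\<dots> = csum H h (\<lambda>h1 h2. csum H h1 (\<lambda>p q. (p \<cdot> k \<rhd> x) \<bullet> (q \<bullet> \<iota> h2)))"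
    using h k x by (intro csum_cong refl csum_counit(2)) auto
  also have "\<dots> = csum H h (\<lambda>p d. csum H d (\<lambda>q h2. (p \<cdot> k \<rhd> x) \<bullet> (q \<bullet> \<iota> h2)))"
    using h k x by (intro csum_coassoc[where X=H]) auto
  also have "\<dots> = csum H h (\<lambda>p d. scale H (counit H d) (p \<cdot> k \<rhd> x))"
  proof (intro csum_cong refl h)
    fix p d assume "p \<in> carrier H" "d \<in> carrier H"
    then show "csum H d (\<lambda>q h2. (p \<cdot> k \<rhd> x) \<bullet> (q \<bullet> \<iota> h2)) = scale H (counit H d) (p \<cdot> k \<rhd> x)"
      using csum_\<iota>(2)[of H "\<lambda>t. (p \<cdot> k \<rhd> x) \<bullet> t" d] k x by simp
  qed
  also have "\<dots> = (h \<cdot> k) \<rhd> x"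
    using h k x by (intro csum_counit(2)) auto
  finally show ?thesis using L by simp
qed

text \<open>Writing out only the second action exposes \<Sum> (h' \<rhd> x) \<bullet> h'', which
  collapses to h \<bullet> x by \<open>act_multX\<close>. What remains is the definition of the
  action on the product.\<close>

lemma act_on_multX:
  assumes h: "h \<in> carrier H" and x: "x \<in> carrier H" and y: "y \<in> carrier H"
  shows "h \<rhd> (x \<bullet> y) = csum H h (\<lambda>h1 h2. (h1 \<rhd> x) \<bullet> (h2 \<rhd> y))"
proof -
  have "csum H h (\<lambda>h1 h2. (h1 \<rhd> x) \<bullet> (h2 \<rhd> y))
      = csum H h (\<lambda>h1 d. csum H d (\<lambda>u v. (h1 \<rhd> x) \<bullet> (u \<bullet> (y \<bullet> \<iota> v))))"
  proof (intro csum_cong refl h)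
    fix h1 d assume "h1 \<in> carrier H" "d \<in> carrier H"
    then show "(h1 \<rhd> x) \<bullet> (d \<rhd> y) = csum H d (\<lambda>u v. (h1 \<rhd> x) \<bullet> (u \<bullet> (y \<bullet> \<iota> v)))"
      using x y by (simp add: act_eq[of d] multX_assoc
        linear_on_csum[where X=H and Y=H and f="\<lambda>t. (h1 \<rhd> x) \<bullet> t"] cong: csum_cong)
  qed
  also have "\<dots> = csum H h (\<lambda>d v. csum H d (\<lambda>h1 u. (h1 \<rhd> x) \<bullet> (u \<bullet> (y \<bullet> \<iota> v))))"
    using h x y by (intro csum_coassoc[where X=H, symmetric]) auto
  also have "\<dots> = h \<rhd> (x \<bullet> y)"
    using h x y
      by (simp add: act_multX cong: csum_cong) (simp add: act_eq multX_assoc cong: csum_cong)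
  finally show ?thesis by simp
qed

text \<open>Both sides are evaluations of \<open>?E\<close>, the sum of (h' \<bullet> x)' \<otimes>
  (h' \<bullet> x)'' \<bullet> \<iota>(h''). Expanding the coproduct of the product at once gives
  the right side. Replacing h' \<bullet> x by \<Sum> (u \<rhd> x) \<bullet> v before expanding gives
  the left side, because the second component of \<open>v\<close> cancels against
  \<open>\<iota>\<close>.\<close>

lemma yetter_drinfeldX:
  assumes h: "h \<in> carrier H" and x: "x \<in> carrier H"
  shows "csum H h (\<lambda>h1 h2. csum H (h1 \<rhd> x) (\<lambda>k y. tens H H (k \<cdot> h2) y))
    = csum H h (\<lambda>h1 h2. csum H x (\<lambda>k y. tens H H (h1 \<cdot> k) (h2 \<rhd> y)))"
proof -
  let ?T = "tensor_space H H"
  let ?E = "csum H h (\<lambda>h1 h2. csum H (h1 \<bullet> x) (\<lambda>k y. tens H H k (y \<bullet> \<iota> h2)))"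
  have "?E = csum H h (\<lambda>h1 h2. csum H h1 (\<lambda>p q. csum H x (\<lambda>r s. tens H H (p \<cdot> r) (q \<bullet> s \<bullet> \<iota> h2))))"
    using h x by (simp add: csum_multX[where Y="?T"] cong: csum_cong)
  also have "\<dots>
      = csum H h (\<lambda>p d. csum H d (\<lambda>q h2. csum H x (\<lambda>r s. tens H H (p \<cdot> r) (q \<bullet> s \<bullet> \<iota> h2))))"
    using h x by (intro csum_coassoc[where X="?T"]) auto
  also have "\<dots> = csum H h (\<lambda>p d. csum H x (\<lambda>r s. tens H H (p \<cdot> r) (d \<rhd> s)))"
  proof (rule csum_cong[OF refl h])
    fix p d assume *: "p \<in> carrier H" "d \<in> carrier H"
    have "csum H d (\<lambda>q h2. csum H x (\<lambda>r s. tens H H (p \<cdot> r) (q \<bullet> s \<bullet> \<iota> h2)))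
        = csum H x (\<lambda>r s. csum H d (\<lambda>q h2. tens H H (p \<cdot> r) (q \<bullet> s \<bullet> \<iota> h2)))"
      by (rule csum_swap)
    also have "\<dots> = csum H x (\<lambda>r s. tens H H (p \<cdot> r) (d \<rhd> s))"
      using * x by (intro csum_cong refl)
        (simp_all add: act_eq linear_on_csum[where X=H and Y="?T" and f="\<lambda>t. tens H H (p \<cdot> _) t"])
    finally show "csum H d (\<lambda>q h2. csum H x (\<lambda>r s. tens H H (p \<cdot> r) (q \<bullet> s \<bullet> \<iota> h2)))
        = csum H x (\<lambda>r s. tens H H (p \<cdot> r) (d \<rhd> s))" .
  qed
  finally have E1: "?E = csum H h (\<lambda>h1 h2. csum H x (\<lambda>k y. tens H H (h1 \<cdot> k) (h2 \<rhd> y)))" .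
  let ?\<phi> = "\<lambda>k y m n h2. tens H H (k \<cdot> m) (y \<bullet> (n \<bullet> \<iota> h2))"
  have "?E
      = csum H h (\<lambda>h1 h2. csum H h1 (\<lambda>u v. csum H (u \<rhd> x) (\<lambda>k y. csum H v (\<lambda>m n. ?\<phi> k y m n h2))))"
  proof (rule csum_cong[OF refl h])
    fix h1 h2 assume *: "h1 \<in> carrier H" "h2 \<in> carrier H"
    \<comment> \<open>Linearity in \<open>z\<close> permits the expression for
      \<open>h1 \<bullet> x\<close> to be substituted under the coproduct and the sum to be drawn
      out.\<close>
    have "linear_on H ?T (\<lambda>z. csum H z (\<lambda>k y. tens H H k (y \<bullet> \<iota> h2)))"
      using * by simp
    from linear_on_csum[OF _ this, where c=h1 and \<phi>="\<lambda>u v. (u \<rhd> x) \<bullet> v"]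
    have "csum H (h1 \<bullet> x) (\<lambda>k y. tens H H k (y \<bullet> \<iota> h2))
        = csum H h1 (\<lambda>u v. csum H ((u \<rhd> x) \<bullet> v) (\<lambda>k y. tens H H k (y \<bullet> \<iota> h2)))"
      using * x by (simp add: act_multX_unit)
    then show "csum H (h1 \<bullet> x) (\<lambda>k y. tens H H k (y \<bullet> \<iota> h2))
        = csum H h1 (\<lambda>u v. csum H (u \<rhd> x) (\<lambda>k y. csum H v (\<lambda>m n. ?\<phi> k y m n h2)))"
      using * x by (simp add: csum_multX[where Y="?T"] multX_assoc cong: csum_cong)
  qed
  also have "\<dots>
      = csum H h (\<lambda>u d. csum H d (\<lambda>v h2. csum H (u \<rhd> x) (\<lambda>k y. csum H v (\<lambda>m n. ?\<phi> k y m n h2))))"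
    using h x by (intro csum_coassoc[where X="?T"]) auto
  also have "\<dots>
      = csum H h (\<lambda>u d. csum H (u \<rhd> x) (\<lambda>k y. csum H d (\<lambda>v h2. csum H v (\<lambda>m n. ?\<phi> k y m n h2))))"
    by (subst (2) csum_swap) (rule refl)
  also have "\<dots>
      = csum H h (\<lambda>u d. csum H (u \<rhd> x) (\<lambda>k y. csum H d (\<lambda>m e. csum H e (\<lambda>n h2. ?\<phi> k y m n h2))))"
    using h x by (simp add: csum_coassoc[where X="?T"] cong: csum_cong)
  also have "\<dots> = csum H h (\<lambda>u d. csum H (u \<rhd> x) (\<lambda>k y. tens H H (k \<cdot> d) y))"
  proof (intro csum_cong refl h)
    fix u d k y assume *: "u \<in> carrier H" "d \<in> carrier H" "k \<in> carrier H" "y \<in> carrier H"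
    have "csum H d (\<lambda>m e. csum H e (\<lambda>n h2. ?\<phi> k y m n h2))
        = csum H d (\<lambda>m e. scale ?T (counit H e) (tens H H (k \<cdot> m) y))"
    proof (intro csum_cong refl)
      fix m e assume "m \<in> carrier H" "e \<in> carrier H"
      then show "csum H e (\<lambda>n h2. ?\<phi> k y m n h2) = scale ?T (counit H e) (tens H H (k \<cdot> m) y)"
        using * csum_\<iota>(2)[of ?T "\<lambda>t. tens H H (k \<cdot> m) (y \<bullet> t)" e] by simp
    qed (use * in auto)
    also have "\<dots> = tens H H (k \<cdot> d) y" using * by (intro csum_counit(2)) auto
    finally show "csum H d (\<lambda>m e. csum H e (\<lambda>n h2. ?\<phi> k y m n h2)) = tens H H (k \<cdot> d) y" .
  qed (use x in auto)
  finally show ?thesis using E1 by simp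
qed

theorem yd_module_algebra: "yd_module_algebra H X"
proof (unfold_locales)
  let ?T = "tensor_space H H"
  show "bilinear_on H X X (act X)"
    by (rule bilinear_onI) (simp_all add: linear_on_X same_space)
  show "act X (h \<cdot> k) x = h \<rhd> k \<rhd> x"
    if "h \<in> carrier H" "k \<in> carrier H" "x \<in> carrier X" for h k x
    using that act_act by (simp add: same_space)
  have "\<iota> \<one> = \<one>"
    using csum_\<iota>(1)[of H "\<lambda>x. x" \<one>]
    by (simp add: csum_def[of H \<one>] comult_unitH tsum_tens[where U=H] counit_unitH kspace_scale)
  then show "\<one> \<rhd> x = x" if "x \<in> carrier X" for x
    using that by (simp add: same_space act_eq csum_def comult_unitH tsum_tens[where U=H])
  show "h \<rhd> (x \<bullet> y) = cop2 H h (\<lambda>h1 h2. (h1 \<rhd> x) \<bullet> (h2 \<rhd> y))"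
    if "h \<in> carrier H" "x \<in> carrier X" "y \<in> carrier X" for h x y
    using that by (subst cop2_eq_csum[where U=H]) (auto simp: same_space act_on_multX)
  show "h \<rhd> \<one>\<^bsub>X\<^esub> = scale X (counit H h) \<one>\<^bsub>X\<^esub>" if "h \<in> carrier H" for h
    using that \<iota>_right by (simp add: same_space same_unit act_eq cong: csum_cong)
  show "linear_on X (tensor_space H X) (coact X)"
    using comult_linear by (simp add: linear_on_X coact_eq)
  show "coact X \<one>\<^bsub>X\<^esub> = tens H X \<one> \<one>\<^bsub>X\<^esub>"
    by (simp add: coact_eq same_unit comult_unitH linear_on_X)
  fix x assume x: "x \<in> carrier X"
  show "sweedler H X (coact X x) (\<lambda>h x0. cop2 H h (\<lambda>h1 h2.
      tens H (tensor_space H X) h1 (tens H X h2 x0)))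
      = sweedler H X (coact X x) (\<lambda>h x0. tens H (tensor_space H X) h (coact X x0))"
    using coassoc[of x] x unfolding cop2_def linear_on_X coact_eq same_space by simp
  show "sweedler H X (coact X x) (\<lambda>h x0. scale X (counit H h) x0) = x"
    using counit_left[of x] x unfolding cop2_def linear_on_X coact_eq same_space by simp
  show "coact X (x \<bullet> y) = sweedler H X (coact X x) (\<lambda>h x0. sweedler H X (coact X y) (\<lambda>k y0.
        tens H X (h \<cdot> k) (x0 \<bullet> y0)))" if y: "y \<in> carrier X" for y
  proof -
    have "cop2 H x (\<lambda>h x0. cop2 H y (\<lambda>k y0. tens H H (h \<cdot> k) (x0 \<bullet> y0)))
        = csum H x (\<lambda>h x0. csum H y (\<lambda>k y0. tens H H (h \<cdot> k) (x0 \<bullet> y0)))"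
      using x y
        by (intro cop2_eq_csum[where U="?T"])
          (auto simp: same_space intro!: cop2_eq_csum[where U="?T"])
    then show ?thesis
      using comult_multX[of x y] x y unfolding cop2_def linear_on_X coact_eq same_space by simp
  qed
  fix h assume h: "h \<in> carrier H"
  have "cop2 H h (\<lambda>h1 h2. cop2 H (h1 \<rhd> x) (\<lambda>k x0. tens H H (k \<cdot> h2) x0))
      = csum H h (\<lambda>h1 h2. csum H (h1 \<rhd> x) (\<lambda>k x0. tens H H (k \<cdot> h2) x0))"
    using h x
      by (intro cop2_eq_csum[where U="?T"])
        (auto simp: same_space intro!: cop2_eq_csum[where U="?T"])
  moreover have "cop2 H h (\<lambda>h1 h2. cop2 H x (\<lambda>k x0. tens H H (h1 \<cdot> k) (h2 \<rhd> x0)))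
      = csum H h (\<lambda>h1 h2. csum H x (\<lambda>k x0. tens H H (h1 \<cdot> k) (h2 \<rhd> x0)))"
    using h x
      by (intro cop2_eq_csum[where U="?T"])
        (auto simp: same_space intro!: cop2_eq_csum[where U="?T"])
  ultimately show "cop2 H h (\<lambda>h1 h2. sweedler H X (coact X (h1 \<rhd> x)) (\<lambda>k x0. tens H X (k \<cdot> h2) x0))
      = cop2 H h (\<lambda>h1 h2. sweedler H X (coact X x) (\<lambda>k x0. tens H X (h1 \<cdot> k) (h2 \<rhd> x0)))"
    using yetter_drinfeldX[of h x] h x unfolding cop2_def linear_on_X coact_eq same_space by simp
qed

theorem braided_commutative: "braided_commutative H X"
proof -
  have eq: "y \<bullet> x = sweedler H X (coact X y) (\<lambda>h y0. (h \<rhd> x) \<bullet> y0)"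
    if "x \<in> carrier X" "y \<in> carrier X" for x y
    using that unfolding same_space coact_eq linear_on_X cop2_def[symmetric]
    by (subst cop2_eq_csum[where U=H]) (auto simp: act_multX_unit)
  interpret yd_module_algebra H X by (rule yd_module_algebra)
  show ?thesis by unfold_locales (rule eq)
qed

end

section \<open>Restriction of Yetter--Drinfeld structures\<close>

text \<open>The map \<open>r\<close> is a linear splitting of \<open>i\<close> and need not respect
  products. It yields explicit left inverses of H \<otimes> i and H \<otimes> (H \<otimes> i), so
  equations between coactions can be tested in \<open>Y\<close>.\<close>

locale yd_retract = kcoalgebra H + X: kalgebra X + Y: yd_module_algebra H Y
  for H :: "('k::field, 'h::ab_group_add) bialgebra" (structure)
    and X :: "('k, 'x::ab_group_add, 'h) yd_algebra" and Y :: "('k, 'y::ab_group_add, 'h)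
        yd_algebra" +
  fixes i :: "'x \<Rightarrow> 'y" and r :: "'y \<Rightarrow> 'x"
  assumes mult_bilinearH: "bilinear_on H H H (mult H)" and unit_closedH: "\<one> \<in> carrier H"
    and act_bilinearX: "bilinear_on H X X (act X)"
    and coact_linearX: "linear_on X (tensor_space H X) (coact X)"
    and restriction: "yd_restriction H X Y i"
    and linear_r: "linear_on Y X r" and retraction: "x \<in> carrier X \<Longrightarrow> r (i x) = x"
begin

lemma i_simps:
  "linear_on X Y i" "i \<one>\<^bsub>X\<^esub> = \<one>\<^bsub>Y\<^esub>"
  "x \<in> carrier X \<Longrightarrow> y \<in> carrier X \<Longrightarrow> i (x \<cdot>\<^bsub>X\<^esub> y) = i x \<cdot>\<^bsub>Y\<^esub> i y"
  "h \<in> carrier H \<Longrightarrow> x \<in> carrier X \<Longrightarrow> i (act X h x) = act Y h (i x)"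
  "x \<in> carrier X \<Longrightarrow> coact Y (i x) = sweedler H X (coact X x) (\<lambda>h x0. tens H Y h (i x0))"
  using restriction unfolding yd_restriction_def by auto

lemma linear_on_i [simp]: "linear_on U X g \<Longrightarrow> linear_on U Y (\<lambda>x. i (g x))"
  by (rule linear_on_compose[OF i_simps(1)])

lemma linear_on_r [simp]: "linear_on U Y g \<Longrightarrow> linear_on U X (\<lambda>x. r (g x))"
  by (rule linear_on_compose[OF linear_r])

lemma i_closed [simp]: "x \<in> carrier X \<Longrightarrow> i x \<in> carrier Y"
  by (rule linear_onD(1)[OF i_simps(1)])

lemma r_closed [simp]: "y \<in> carrier Y \<Longrightarrow> r y \<in> carrier X"
  by (rule linear_onD(1)[OF linear_r])

lemma i_inj: "x \<in> carrier X \<Longrightarrow> y \<in> carrier X \<Longrightarrow> i x = i y \<Longrightarrow> x = y"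
  using retraction by metis

lemma multH [simp]:
  "h \<in> carrier H \<Longrightarrow> k \<in> carrier H \<Longrightarrow> h \<cdot> k \<in> carrier H"
  "h \<in> carrier H \<Longrightarrow> linear_on U H g \<Longrightarrow> linear_on U H (\<lambda>x. h \<cdot> g x)"
  "h \<in> carrier H \<Longrightarrow> linear_on U H g \<Longrightarrow> linear_on U H (\<lambda>x. g x \<cdot> h)"
  using bilinear_onD[OF mult_bilinearH] by simp_all

lemma actX [simp]:
  "h \<in> carrier H \<Longrightarrow> x \<in> carrier X \<Longrightarrow> act X h x \<in> carrier X"
  "h \<in> carrier H \<Longrightarrow> linear_on U X g \<Longrightarrow> linear_on U X (\<lambda>x. act X h (g x))"
  "x \<in> carrier X \<Longrightarrow> linear_on V H f \<Longrightarrow> linear_on V X (\<lambda>h. act X (f h) x)"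
  using bilinear_onD[OF act_bilinearX] by simp_all

lemma actY [simp]:
  "h \<in> carrier H \<Longrightarrow> x \<in> carrier Y \<Longrightarrow> act Y h x \<in> carrier Y"
  "h \<in> carrier H \<Longrightarrow> linear_on U Y g \<Longrightarrow> linear_on U Y (\<lambda>x. act Y h (g x))"
  "x \<in> carrier Y \<Longrightarrow> linear_on V H f \<Longrightarrow> linear_on V Y (\<lambda>h. act Y (f h) x)"
  using bilinear_onD[OF Y.act_bilinear] by simp_all

lemma coact_closed [simp]:
  "x \<in> carrier X \<Longrightarrow> coact X x \<in> carrier (tensor_space H X)"
  "y \<in> carrier Y \<Longrightarrow> coact Y y \<in> carrier (tensor_space H Y)"
  using linear_onD(1)[OF coact_linearX] linear_onD(1)[OF Y.coact_linear] by auto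

lemma linear_on_coactX [simp]: "linear_on U X g \<Longrightarrow> linear_on U (tensor_space H X) (\<lambda>x.
    coact X (g x))"
  by (rule linear_on_compose[OF coact_linearX])

lemma linear_on_coactY [simp]: "linear_on U Y g \<Longrightarrow> linear_on U (tensor_space H Y) (\<lambda>x.
    coact Y (g x))"
  by (rule linear_on_compose[OF Y.coact_linear])

lemma coactY_i: "x \<in> carrier X \<Longrightarrow> coact Y (i x) = tsum H X (coact X x) (\<lambda>h x0. tens H Y h (i x0))"
  unfolding i_simps(5) by (rule sweedler_eq_tsum[where U="tensor_space H Y"]) auto

text \<open>This carries a sum over the coaction from \<open>X\<close> to \<open>Y\<close>, where
  the axioms are known, and back.\<close>

lemma tsum_coactY_i:
  assumes "kspace U" "x \<in> carrier X"
    "\<And>h. h \<in> carrier H \<Longrightarrow> linear_on Y U (\<phi> h)"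
    "\<And>y. y \<in> carrier Y \<Longrightarrow> linear_on H U (\<lambda>h. \<phi> h y)"
  shows "tsum H Y (coact Y (i x)) \<phi> = tsum H X (coact X x) (\<lambda>h x0. \<phi> h (i x0))"
proof -
  have L: "linear_on (tensor_space H Y) U (\<lambda>t. tsum H Y t \<phi>)" using assms by simp
  show ?thesis
    unfolding coactY_i[OF assms(2)] using assms
    by (subst linear_on_tsum[OF _ _ _ L]) (auto simp: tsum_tens[where U=U] intro!: tsum_cong)
qed

text \<open>This is id \<otimes> i; compatibility of \<open>i\<close> with the coactions says that
  it maps the coaction of \<open>x\<close> to that of \<open>i x\<close>.\<close>

definition J :: "('k, 'h, 'x) tensor \<Rightarrow> ('k, 'h, 'y) tensor"
  where "J t = tsum H X t (\<lambda>h x. tens H Y h (i x))"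

lemma linear_on_J [simp]:
  "linear_on U (tensor_space H X) g \<Longrightarrow> linear_on U (tensor_space H Y) (\<lambda>x. J (g x))"
  unfolding J_def by simp

lemma linear_J: "linear_on (tensor_space H X) (tensor_space H Y) J"
  using linear_on_J[of "tensor_space H X" "\<lambda>x. x"] by simp

lemma J_closed [simp]: "t \<in> carrier (tensor_space H X) \<Longrightarrow> J t \<in> carrier (tensor_space H Y)"
  by (rule linear_onD(1)[OF linear_J])

lemma J_tens [simp]: "h \<in> carrier H \<Longrightarrow> x \<in> carrier X \<Longrightarrow> J (tens H X h x) = tens H Y h (i x)"
  unfolding J_def by (rule tsum_tens[where U="tensor_space H Y"]) auto

lemma J_coact: "x \<in> carrier X \<Longrightarrow> J (coact X x) = coact Y (i x)"
  by (simp add: J_def coactY_i)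

text \<open>The map \<open>?R\<close>, which is id \<otimes> r, is a left inverse of
  \<open>J\<close>.\<close>

lemma J_inj:
  assumes "s \<in> carrier (tensor_space H X)" "t \<in> carrier (tensor_space H X)" "J s = J t"
  shows "s = t"
proof -
  let ?R = "\<lambda>t. tsum H Y t (\<lambda>h y. tens H X h (r y))"
  have "?R (J t) = t" if "t \<in> carrier (tensor_space H X)" for t
    by (rule tensor_ext[where f="\<lambda>t. ?R (J t)" and g="\<lambda>t. t" and X="tensor_space H X"])
      (use that in \<open>auto simp: tsum_tens[where U="tensor_space H X"] retraction\<close>)
  then show ?thesis using assms by metis
qed

text \<open>The same argument with one more factor \<open>H\<close>, for comparing the two sides of
  coassociativity of the coaction.\<close>

lemma J3_inj:
  fixes s t :: "('k, 'h, ('k, 'h, 'x) tensor) tensor"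
  assumes "s \<in> carrier (tensor_space H (tensor_space H X))"
    "t \<in> carrier (tensor_space H (tensor_space H X))"
    "tsum H (tensor_space H X) s (\<lambda>h w. tens H (tensor_space H Y) h (J w))
      = tsum H (tensor_space H X) t (\<lambda>h w. tens H (tensor_space H Y) h (J w))"
  shows "s = t"
proof -
  let ?R = "\<lambda>t. tsum H Y t (\<lambda>h y. tens H X h (r y))"
  have RJ: "?R (J t) = t" if "t \<in> carrier (tensor_space H X)" for t
    by (rule tensor_ext[where f="\<lambda>t. ?R (J t)" and g="\<lambda>t. t" and X="tensor_space H X"])
      (use that in \<open>auto simp: tsum_tens[where U="tensor_space H X"] retraction\<close>)
  let ?E = "\<lambda>t. tsum H (tensor_space H X) t (\<lambda>h w. tens H (tensor_space H Y) h (J w))"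
  let ?Q = "\<lambda>t. tsum H (tensor_space H Y) t (\<lambda>h w. tens H (tensor_space H X) h (?R w))"
  have "?Q (?E t) = t" if "t \<in> carrier (tensor_space H (tensor_space H X))" for t
    by (rule tensor_ext[where f="\<lambda>t. ?Q (?E t)" and g="\<lambda>t.
        t" and X="tensor_space H (tensor_space H X)"])
      (use that in \<open>auto simp: tsum_tens[where U="tensor_space H (tensor_space H X)"]
        tsum_tens[where U="tensor_space H (tensor_space H Y)"] RJ\<close>)
  then show ?thesis using assms by metis
qed

text \<open>Each axiom holds in \<open>Y\<close> at the images under \<open>i\<close>. Since
  \<open>i\<close>, \<open>J\<close> and its analogue with two factors \<open>H\<close> reflect
  equations, it holds in \<open>X\<close>.\<close>

theorem yd_module_algebra_retract: "yd_module_algebra H X"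
proof unfold_locales
  let ?HX = "tensor_space H X" and ?HY = "tensor_space H Y"
  let ?HHX = "tensor_space H ?HX" and ?HHY = "tensor_space H ?HY"
  show "bilinear_on H X X (act X)" by (rule act_bilinearX)
  show "linear_on X ?HX (coact X)" by (rule coact_linearX)
  show "act X (h \<cdot> k) x = act X h (act X k x)"
    if "h \<in> carrier H" "k \<in> carrier H" "x \<in> carrier X" for h k x
    by (rule i_inj) (use that in \<open>auto simp: i_simps Y.act_mult\<close>)
  show "act X \<one> x = x" if "x \<in> carrier X" for x
    by (rule i_inj) (use that unit_closedH in \<open>auto simp: i_simps Y.act_unit\<close>)
  show "act X h (x \<cdot>\<^bsub>X\<^esub> y) = cop2 H h (\<lambda>h1 h2. act X h1 x \<cdot>\<^bsub>X\<^esub> act X h2 y)"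
    if "h \<in> carrier H" "x \<in> carrier X" "y \<in> carrier X" for h x y
  proof -
    have "cop2 H h (\<lambda>h1 h2. act Y h1 (i x) \<cdot>\<^bsub>Y\<^esub> act Y h2 (i y))
        = csum H h (\<lambda>h1 h2. act Y h1 (i x) \<cdot>\<^bsub>Y\<^esub> act Y h2 (i y))"
      using that by (intro cop2_eq_csum[where U=Y]) auto
    then have "i (act X h (x \<cdot>\<^bsub>X\<^esub> y)) = i (csum H h (\<lambda>h1 h2. act X h1 x \<cdot>\<^bsub>X\<^esub> act X h2 y))"
      using that Y.act_on_mult[of h "i x" "i y"]
        by (simp add: i_simps linear_on_csum[OF _ i_simps(1)] cong: csum_cong)
    then have "act X h (x \<cdot>\<^bsub>X\<^esub> y) = csum H h (\<lambda>h1 h2. act X h1 x \<cdot>\<^bsub>X\<^esub> act X h2 y)"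
      using that by (intro i_inj) auto
    also have "\<dots> = cop2 H h (\<lambda>h1 h2. act X h1 x \<cdot>\<^bsub>X\<^esub> act X h2 y)"
      using that by (intro cop2_eq_csum[where U=X, symmetric]) auto
    finally show ?thesis .
  qed
  show "act X h \<one>\<^bsub>X\<^esub> = scale X (counit H h) \<one>\<^bsub>X\<^esub>" if "h \<in> carrier H" for h
    using that Y.act_on_unit[of h] linear_onD(3)[OF i_simps(1), of "\<one>\<^bsub>X\<^esub>"]
    by (intro i_inj) (auto simp: i_simps)
  show "coact X \<one>\<^bsub>X\<^esub> = tens H X \<one> \<one>\<^bsub>X\<^esub>"
    using Y.coact_unit unit_closedH by (intro J_inj) (auto simp: J_coact i_simps)
  fix x assume x: "x \<in> carrier X"
  show "sweedler H X (coact X x) (\<lambda>h x0. cop2 H h (\<lambda>h1 h2. tens H ?HX h1 (tens H X h2 x0)))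
      = sweedler H X (coact X x) (\<lambda>h x0. tens H ?HX h (coact X x0))"
  proof -
    have "sweedler H X (coact X x) (\<lambda>h x0. cop2 H h (\<lambda>h1 h2. tens H ?HX h1 (tens H X h2 x0)))
        = tsum H X (coact X x) (\<lambda>h x0. csum H h (\<lambda>h1 h2. tens H ?HX h1 (tens H X h2 x0)))"
      using x
        by (intro sweedler_eq_tsum[where U="?HHX"]) (auto intro!: cop2_eq_csum[where U="?HHX"])
    also have "\<dots> = tsum H X (coact X x) (\<lambda>h x0. tens H ?HX h (coact X x0))" (is "?L = ?R")
    proof (rule J3_inj)
      let ?E = "\<lambda>t. tsum H ?HX t (\<lambda>h w. tens H ?HY h (J w))"
      have E: "linear_on ?HHX ?HHY ?E" by simp
      show "?L \<in> carrier ?HHX" "?R \<in> carrier ?HHX" using x by simp_all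
      have "?E ?L
          = tsum H X (coact X x) (\<lambda>h x0. csum H h (\<lambda>h1 h2. tens H ?HY h1 (tens H Y h2 (i x0))))"
        using x
          by (simp add: linear_on_tsum[OF _ _ _ E] linear_on_csum[OF _ E] tsum_tens[where
            U="?HHY"] cong: tsum_cong csum_cong)
      also have "\<dots>
          = tsum H Y (coact Y (i x)) (\<lambda>h y. csum H h (\<lambda>h1 h2. tens H ?HY h1 (tens H Y h2 y)))"
        using x by (intro tsum_coactY_i[where U="?HHY", symmetric]) auto
      also have "\<dots>
          = sweedler H Y (coact Y (i x)) (\<lambda>h y. cop2 H h (\<lambda>h1 h2. tens H ?HY h1 (tens H Y h2 y)))"
        using x
          by (intro sweedler_eq_tsum[where U="?HHY", symmetric])
            (auto intro!: cop2_eq_csum[where U="?HHY"])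
      also have "\<dots> = sweedler H Y (coact Y (i x)) (\<lambda>h y. tens H ?HY h (coact Y y))"
        using x by (simp add: Y.coact_coassoc)
      also have "\<dots> = tsum H Y (coact Y (i x)) (\<lambda>h y. tens H ?HY h (coact Y y))"
        using x by (intro sweedler_eq_tsum[where U="?HHY"]) auto
      also have "\<dots> = tsum H X (coact X x) (\<lambda>h x0. tens H ?HY h (coact Y (i x0)))"
        using x by (intro tsum_coactY_i[where U="?HHY"]) auto
      also have "\<dots> = ?E ?R"
        using x
          by (simp add: linear_on_tsum[OF _ _ _ E] tsum_tens[where U="?HHY"] J_coact cong:
            tsum_cong)
      finally show "?E ?L = ?E ?R" .
    qed
    also have "\<dots> = sweedler H X (coact X x) (\<lambda>h x0. tens H ?HX h (coact X x0))"
      using x by (intro sweedler_eq_tsum[where U="?HHX", symmetric]) auto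
    finally show ?thesis .
  qed
  show "sweedler H X (coact X x) (\<lambda>h x0. scale X (counit H h) x0) = x"
  proof -
    have "sweedler H X (coact X x) (\<lambda>h x0. scale X (counit H h) x0)
        = tsum H X (coact X x) (\<lambda>h x0. scale X (counit H h) x0)"
      using x by (intro sweedler_eq_tsum[where U=X]) auto
    also have "\<dots> = x"
    proof (rule i_inj)
      have "i (tsum H X (coact X x) (\<lambda>h x0. scale X (counit H h) x0))
          = tsum H X (coact X x) (\<lambda>h x0. scale Y (counit H h) (i x0))"
        using x linear_onD(3)[OF i_simps(1)]
          by (simp add: linear_on_tsum[OF _ _ _ i_simps(1)] cong: tsum_cong)
      also have "\<dots> = tsum H Y (coact Y (i x)) (\<lambda>h y. scale Y (counit H h) y)"
        using x by (intro tsum_coactY_i[where U=Y, symmetric]) auto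
      also have "\<dots> = sweedler H Y (coact Y (i x)) (\<lambda>h y. scale Y (counit H h) y)"
        using x by (intro sweedler_eq_tsum[where U=Y, symmetric]) auto
      finally show "i (tsum H X (coact X x) (\<lambda>h x0. scale X (counit H h) x0)) = i x"
        using x by (simp add: Y.coact_counit)
    qed (use x in auto)
    finally show ?thesis .
  qed
  show "coact X (x \<cdot>\<^bsub>X\<^esub> y) = sweedler H X (coact X x) (\<lambda>h x0. sweedler H X (coact X y) (\<lambda>k y0.
        tens H X (h \<cdot> k) (x0 \<cdot>\<^bsub>X\<^esub> y0)))" if y: "y \<in> carrier X" for y
  proof -
    have "coact X (x \<cdot>\<^bsub>X\<^esub> y)
        = tsum H X (coact X x) (\<lambda>h x0. tsum H X (coact X y) (\<lambda>k y0. tens H X (h \<cdot> k) (x0 \<cdot>\<^bsub>X\<^esub> y0)))"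
      (is "_ = ?R")
    proof (rule J_inj)
      have "J ?R
          = tsum H X (coact X x) (\<lambda>h x0. tsum H X (coact X y) (\<lambda>k y0.
            tens H Y (h \<cdot> k) (i x0 \<cdot>\<^bsub>Y\<^esub> i y0)))"
        using x y by (simp add: linear_on_tsum[OF _ _ _ linear_J] i_simps cong: tsum_cong)
      also have "\<dots>
          = tsum H X (coact X x) (\<lambda>h x0. tsum H Y (coact Y (i y)) (\<lambda>k y0.
            tens H Y (h \<cdot> k) (i x0 \<cdot>\<^bsub>Y\<^esub> y0)))"
        using x y by (intro tsum_cong tsum_coactY_i[where U="?HY", symmetric]) auto
      also have "\<dots> = tsum H Y (coact Y (i x)) (\<lambda>h x0. tsum H Y (coact Y (i y)) (\<lambda>k y0.
          tens H Y (h \<cdot> k) (x0 \<cdot>\<^bsub>Y\<^esub> y0)))"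
        using x y by (intro tsum_coactY_i[where U="?HY", symmetric]) auto
      also have "\<dots> = sweedler H Y (coact Y (i x)) (\<lambda>h x0. sweedler H Y (coact Y (i y)) (\<lambda>k y0.
          tens H Y (h \<cdot> k) (x0 \<cdot>\<^bsub>Y\<^esub> y0)))"
        using x y
          by (intro sweedler_eq_tsum[where U="?HY", symmetric])
            (auto intro!: sweedler_eq_tsum[where U="?HY"])
      finally show "J (coact X (x \<cdot>\<^bsub>X\<^esub> y)) = J ?R"
        using x y Y.coact_mult[of "i x" "i y"] by (simp add: J_coact i_simps)
    qed (use x y in auto)
    also have "\<dots> = sweedler H X (coact X x) (\<lambda>h x0. sweedler H X (coact X y) (\<lambda>k y0.
        tens H X (h \<cdot> k) (x0 \<cdot>\<^bsub>X\<^esub> y0)))"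
      using x y
        by (intro sweedler_eq_tsum[where U="?HX", symmetric])
          (auto intro!: sweedler_eq_tsum[where U="?HX"])
    finally show ?thesis .
  qed
  fix h assume h: "h \<in> carrier H"
  show "cop2 H h (\<lambda>h1 h2. sweedler H X (coact X (act X h1 x)) (\<lambda>k x0. tens H X (k \<cdot> h2) x0))
      = cop2 H h (\<lambda>h1 h2. sweedler H X (coact X x) (\<lambda>k x0. tens H X (h1 \<cdot> k) (act X h2 x0)))"
  proof -
    have "cop2 H h (\<lambda>h1 h2. sweedler H X (coact X (act X h1 x)) (\<lambda>k x0. tens H X (k \<cdot> h2) x0))
        = csum H h (\<lambda>h1 h2. tsum H X (coact X (act X h1 x)) (\<lambda>k x0. tens H X (k \<cdot> h2) x0))"
      using h x
        by (intro cop2_eq_csum[where U="?HX"]) (auto intro!: sweedler_eq_tsum[where U="?HX"])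
    also have "\<dots>
        = csum H h (\<lambda>h1 h2. tsum H X (coact X x) (\<lambda>k x0. tens H X (h1 \<cdot> k) (act X h2 x0)))"
            (is "?L = ?R")
    proof (rule J_inj)
      show "?L \<in> carrier ?HX" "?R \<in> carrier ?HX" using h x by simp_all
      have "J ?L
          = csum H h (\<lambda>h1 h2. tsum H X (coact X (act X h1 x)) (\<lambda>k x0. tens H Y (k \<cdot> h2) (i x0)))"
        using h x
          by (simp add: linear_on_csum[OF _ linear_J] linear_on_tsum[OF _ _ _ linear_J] cong:
            csum_cong tsum_cong)
      also have "\<dots>
          = csum H h (\<lambda>h1 h2. tsum H Y (coact Y (act Y h1 (i x))) (\<lambda>k y. tens H Y (k \<cdot> h2) y))"
      proof (rule csum_cong[OF refl h])
        fix h1 h2 assume "h1 \<in> carrier H" "h2 \<in> carrier H"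
        then show "tsum H X (coact X (act X h1 x)) (\<lambda>k x0. tens H Y (k \<cdot> h2) (i x0))
            = tsum H Y (coact Y (act Y h1 (i x))) (\<lambda>k y. tens H Y (k \<cdot> h2) y)"
          using x tsum_coactY_i[of ?HY "act X h1 x" "\<lambda>k y. tens H Y (k \<cdot> h2) y"]
            by (simp add: i_simps)
      qed
      also have "\<dots>
          = cop2 H h (\<lambda>h1 h2. sweedler H Y (coact Y (act Y h1 (i x))) (\<lambda>k y. tens H Y (k \<cdot> h2) y))"
        using h x
          by (intro cop2_eq_csum[where U="?HY", symmetric])
            (auto intro!: sweedler_eq_tsum[where U="?HY"])
      also have "\<dots>
          = cop2 H h (\<lambda>h1 h2. sweedler H Y (coact Y (i x)) (\<lambda>k y. tens H Y (h1 \<cdot> k) (act Y h2 y)))"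
        using h x by (intro Y.yetter_drinfeld) auto
      also have "\<dots>
          = csum H h (\<lambda>h1 h2. tsum H Y (coact Y (i x)) (\<lambda>k y. tens H Y (h1 \<cdot> k) (act Y h2 y)))"
        using h x
          by (intro cop2_eq_csum[where U="?HY"]) (auto intro!: sweedler_eq_tsum[where U="?HY"])
      also have "\<dots>
          = csum H h (\<lambda>h1 h2. tsum H X (coact X x) (\<lambda>k x0. tens H Y (h1 \<cdot> k) (act Y h2 (i x0))))"
        using h x by (intro csum_cong refl tsum_coactY_i[where U="?HY"]) auto
      also have "\<dots> = J ?R"
        using h x
          by (simp add: linear_on_csum[OF _ linear_J] linear_on_tsum[OF _ _ _ linear_J] i_simps
            cong: csum_cong tsum_cong)
      finally show "J ?L = J ?R" .
    qed
    also have "\<dots>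
        = cop2 H h (\<lambda>h1 h2. sweedler H X (coact X x) (\<lambda>k x0. tens H X (h1 \<cdot> k) (act X h2 x0)))"
      using h x
        by (intro cop2_eq_csum[where U="?HX", symmetric])
          (auto intro!: sweedler_eq_tsum[where U="?HX"])
    finally show ?thesis .
  qed
qed

theorem braided_commutative_retract:
  assumes "braided_commutative H Y"
  shows "braided_commutative H X"
proof -
  interpret Z: braided_commutative H Y by (rule assms)
  have eq: "y \<cdot>\<^bsub>X\<^esub> x = sweedler H X (coact X y) (\<lambda>h y0. act X h x \<cdot>\<^bsub>X\<^esub> y0)"
    if x: "x \<in> carrier X" and y: "y \<in> carrier X" for x y
  proof -
    have "y \<cdot>\<^bsub>X\<^esub> x = tsum H X (coact X y) (\<lambda>h y0. act X h x \<cdot>\<^bsub>X\<^esub> y0)"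
    proof (rule i_inj)
      have "i (tsum H X (coact X y) (\<lambda>h y0. act X h x \<cdot>\<^bsub>X\<^esub> y0))
          = tsum H X (coact X y) (\<lambda>h y0. act Y h (i x) \<cdot>\<^bsub>Y\<^esub> i y0)"
        using x y by (simp add: linear_on_tsum[OF _ _ _ i_simps(1)] i_simps cong: tsum_cong)
      also have "\<dots> = tsum H Y (coact Y (i y)) (\<lambda>h y0. act Y h (i x) \<cdot>\<^bsub>Y\<^esub> y0)"
        using x y by (intro tsum_coactY_i[where U=Y, symmetric]) auto
      also have "\<dots> = sweedler H Y (coact Y (i y)) (\<lambda>h y0. act Y h (i x) \<cdot>\<^bsub>Y\<^esub> y0)"
        using x y by (intro sweedler_eq_tsum[where U=Y, symmetric]) auto
      finally show "i (y \<cdot>\<^bsub>X\<^esub> x) = i (tsum H X (coact X y) (\<lambda>h y0. act X h x \<cdot>\<^bsub>X\<^esub> y0))"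
        using x y Z.braided_comm[of "i x" "i y"] by (simp add: i_simps)
    qed (use x y in auto)
    also have "\<dots> = sweedler H X (coact X y) (\<lambda>h y0. act X h x \<cdot>\<^bsub>X\<^esub> y0)"
      using x y by (intro sweedler_eq_tsum[where U=X, symmetric]) auto
    finally show ?thesis .
  qed
  interpret yd_module_algebra H X by (rule yd_module_algebra_retract)
  show ?thesis by unfold_locales (rule eq)
qed

end

section \<open>The inverse antipode\<close>

locale bijective_hopf_algebra = hopf_algebra B
  for B :: "('k::field, 'b::ab_group_add) hopf" (structure) +
  assumes bij_antipode: "bij_betw (antipode B) (carrier B) (carrier B)"
begin

lemma inv_antipode_closed [simp]: "b \<in> carrier B \<Longrightarrow> inv_antipode B b \<in> carrier B"
  using bij_betw_imp_surj_on[OF bij_antipode] by (metis inv_antipode_def inv_into_into)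

lemma antipode_inv_antipode [simp]:
  "b \<in> carrier B \<Longrightarrow> antipode B (inv_antipode B b) = b"
  "b \<in> carrier B \<Longrightarrow> inv_antipode B (antipode B b) = b"
  using bij_antipode unfolding inv_antipode_def
  by (simp_all add: bij_betw_def inv_into_f_f f_inv_into_f)

lemma inv_antipode_eqI: "a \<in> carrier B \<Longrightarrow> antipode B a = b \<Longrightarrow> inv_antipode B b = a"
  by auto

lemma linear_inv_antipode: "linear_on B B (inv_antipode B)"
  unfolding linear_on_def
  using linear_onD[OF antipode_linear] kspace_closed[OF kspace]
  by (auto intro!: inv_antipode_eqI)

lemma linear_on_inv_antipode [simp]:
  "linear_on U B g \<Longrightarrow> linear_on U B (\<lambda>x. inv_antipode B (g x))"
  by (rule linear_on_compose[OF linear_inv_antipode])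

lemma inv_antipode_unit [simp]: "inv_antipode B \<one> = \<one>"
  by (rule inv_antipode_eqI) auto

lemma inv_antipode_mult:
  "a \<in> carrier B \<Longrightarrow> b \<in> carrier B \<Longrightarrow>
    inv_antipode B (a \<cdot> b) = inv_antipode B b \<cdot> inv_antipode B a"
  by (rule inv_antipode_eqI) (auto simp: antipode_mult)

text \<open>The inverse antipode reverses products, so applying it inside the antipode axioms turns
  \<open>S(x) y\<close> into \<open>S\<^sup>-\<^sup>1(y) x\<close> and \<open>x S(y)\<close> into
  \<open>y S\<^sup>-\<^sup>1(x)\<close>.\<close>

lemma csum_inv_antipode:
  assumes f: "linear_on B X f" and b: "b \<in> carrier B"
  shows "csum B b (\<lambda>x y. f (inv_antipode B y \<cdot> x)) = scale X (counit B b) (f \<one>)"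
    "csum B b (\<lambda>x y. f (y \<cdot> inv_antipode B x)) = scale X (counit B b) (f \<one>)"
proof -
  let ?f = "\<lambda>x. f (inv_antipode B x)"
  have f': "linear_on B X ?f" by (rule linear_on_compose[OF f]) simp
  have "csum B b (\<lambda>x y. f (inv_antipode B y \<cdot> x)) = csum B b (\<lambda>x y. ?f (antipode B x \<cdot> y))"
    "csum B b (\<lambda>x y. f (y \<cdot> inv_antipode B x)) = csum B b (\<lambda>x y. ?f (x \<cdot> antipode B y))"
    using b by (auto simp: inv_antipode_mult intro!: csum_cong)
  then show "csum B b (\<lambda>x y. f (inv_antipode B y \<cdot> x)) = scale X (counit B b) (f \<one>)"
    "csum B b (\<lambda>x y. f (y \<cdot> inv_antipode B x)) = scale X (counit B b) (f \<one>)"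
    by (simp_all add: csum_antipode[OF f' b])
qed

end

section \<open>The dual Hopf algebra\<close>

text \<open>A constant in place of plain application: rules about evaluation get a rigid head to
  match, which an application of a variable would not offer.\<close>

definition ev :: "('b \<Rightarrow> 'k) \<Rightarrow> 'b \<Rightarrow> 'k"
  where "ev \<beta> b = \<beta> b"

text \<open>Let t = \<Sum> v \<otimes> w with functions v. For every point x the vector \<Sum> v(x)
  w vanishes, by the separating maps \<open>e i\<close> if x lies in \<open>P\<close> and because
  all v(x) are 0 otherwise. Hence for every functional g the function \<Sum> g(w) v vanishes at each
  point, so it is 0; applying f to it gives the value of t at (f, g).\<close>

lemma tensor_separated:
  fixes V :: "('k::field, 'x \<Rightarrow> 'k, 'z) vspace_scheme" and W :: "('k, 'w::ab_group_add, 'y)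
      vspace_scheme"
  assumes V: "kspace V" "scale V = fscale" and W: "kspace W"
    and E: "\<And>i. i \<in> I \<Longrightarrow> linear_on W scalars (e i)"
      "\<And>w. w \<in> carrier W \<Longrightarrow> (\<And>i. i \<in> I \<Longrightarrow> e i w = 0) \<Longrightarrow> w = 0"
    and P: "\<And>v x. v \<in> carrier V \<Longrightarrow> x \<notin> P \<Longrightarrow> v x = 0"
    and t: "t \<in> carrier (tensor_space V W)"
    and zero: "\<And>x i. x \<in> P \<Longrightarrow> i \<in> I \<Longrightarrow> tsum V W t (\<lambda>v w. ev v x * e i w) = 0"
  shows "t = 0"
proof
  fix p :: "(('x \<Rightarrow> 'k) \<Rightarrow> 'k) \<times> ('w \<Rightarrow> 'k)"
  obtain f g where p: "p = (f, g)" by force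
  let ?ps = "tensor_rep V W t"
  have ps: "set ?ps \<subseteq> carrier V \<times> carrier W" "t = (\<Sum>(v, w)\<leftarrow>?ps. tens V W v w)"
    using tensor_rep[OF V(1) W t] by auto
  have sum_apply: "(\<Sum>(v, w)\<leftarrow>qs. h v w) y = (\<Sum>(v, w)\<leftarrow>qs. h v w y)"
    for qs :: "(('x \<Rightarrow> 'k) \<times> 'w) list" and h :: "_ \<Rightarrow> _ \<Rightarrow> 'q \<Rightarrow> 'k" and y
    by (induction qs) auto
  show "t p = 0 p"
  proof (cases "Vector_Spaces.linear (scale V) (*) f \<and> Vector_Spaces.linear (scale W) (*) g")
    case False
    have "t p = (\<Sum>(v, w)\<leftarrow>?ps. tens V W v w p)" by (subst ps(2)) (rule sum_apply)
    also have "\<dots> = (\<Sum>(v, w)\<leftarrow>?ps. 0)"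
      using False by (intro arg_cong[where f=sum_list] map_cong) (auto simp: p tens_def)
    finally show ?thesis by (simp add: case_prod_unfold)
  next
    case True
    interpret f: Vector_Spaces.linear "scale V" "(*)" f using True by simp
    interpret g: Vector_Spaces.linear "scale W" "(*)" g using True by simp
    let ?w = "\<lambda>x. \<Sum>(v, w)\<leftarrow>?ps. scale W (v x) w"
    have w: "?w x = 0" for x
    proof (cases "x \<in> P")
      case True
      have *: "(\<Sum>p\<leftarrow>?ps. (\<lambda>(v, w). scale W (v x) w) p) \<in> carrier W
        \<and> e i (\<Sum>p\<leftarrow>?ps. (\<lambda>(v, w). scale W (v x) w) p) = (\<Sum>p\<leftarrow>?ps. e i ((\<lambda>(v, w). scale W (v x) w) p))"
        if "i \<in> I" for i
        by (rule linear_on_sum_list[OF W E(1)[OF that]]) (use ps(1) kspace_closed(3)[OF W] in auto)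
      have cl: "?w x \<in> carrier W"
        by (rule linear_on_sum_list[OF W linear_on_id, THEN conjunct1])
          (use ps(1) kspace_closed(3)[OF W] in auto)
      show ?thesis
      proof (rule E(2)[OF cl])
        fix i assume i: "i \<in> I"
        have "e i (?w x) = (\<Sum>p\<leftarrow>?ps. e i ((\<lambda>(v, w). scale W (v x) w) p))"
          using *[OF i] by simp
        also have "\<dots> = (\<Sum>(v, w)\<leftarrow>?ps. ev v x * e i w)"
          using ps(1) linear_onD(3)[OF E(1)[OF i]]
          by (intro arg_cong[where f=sum_list] map_cong) (auto simp: ev_def)
        also have "\<dots> = 0" using zero[OF True i] by (simp add: tsum_def)
        finally show "e i (?w x) = 0" .
      qed
    next
      case False
      have "?w x = (\<Sum>(v, w)\<leftarrow>?ps. 0)"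
        using False ps(1) P kspace_scale(6)[OF W]
        by (intro arg_cong[where f=sum_list] map_cong) auto
      then show ?thesis by (simp add: case_prod_unfold)
    qed
    have "g (\<Sum>(v, w)\<leftarrow>qs. scale W (v x) w) = (\<Sum>(v, w)\<leftarrow>qs. fscale (g w) v) x" for x qs
      by (induction qs) (auto simp: g.zero g.add g.scale fscale_def)
    from this[of _ ?ps] have 0: "(\<Sum>(v, w)\<leftarrow>?ps. fscale (g w) v) = 0"
      by (simp add: fun_eq_iff w g.zero)
    have "t p = (\<Sum>(v, w)\<leftarrow>?ps. tens V W v w p)" by (subst ps(2)) (rule sum_apply)
    also have "\<dots> = (\<Sum>(v, w)\<leftarrow>?ps. g w * f v)"
      using True by (intro arg_cong[where f=sum_list] map_cong) (auto simp: p tens_def)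
    also have "\<dots> = f (\<Sum>(v, w)\<leftarrow>qs. fscale (g w) v)" if "qs = ?ps" for qs
    proof -
      have "(\<Sum>(v, w)\<leftarrow>qs. g w * f v) = f (\<Sum>(v, w)\<leftarrow>qs. fscale (g w) v)" for qs
        by (induction qs) (auto simp: f.zero f.add f.scale[unfolded V(2)] simp del: plus_fun_apply
          zero_fun_apply)
      then show ?thesis using that by simp
    qed
    finally show ?thesis using 0 by (simp add: f.zero)
  qed
qed

section \<open>Functionals and the finite dual\<close>

definition functional_space ::
  "('k::field, 'a::ab_group_add, 'z) vspace_scheme \<Rightarrow> ('k, 'a \<Rightarrow> 'k) vspace"
  where "functional_space V = \<lparr>carrier = functionals V, scale = fscale\<rparr>"

text \<open>Produces the normal form that \<open>functionals\<close> demands, in which agreement on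
  the carrier means equality.\<close>

definition restrict0 :: "('k, 'a, 'z) vspace_scheme \<Rightarrow> ('a \<Rightarrow> 'k::zero) \<Rightarrow> 'a \<Rightarrow> 'k"
  where "restrict0 V f = (\<lambda>v. if v \<in> carrier V then f v else 0)"

lemma functionalsD:
  "f \<in> functionals V \<Longrightarrow> linear_on V scalars f" "f \<in> functionals V \<Longrightarrow> v \<notin> carrier V \<Longrightarrow> f v = 0"
  by (auto simp: functionals_def)

lemma restrict0_functional:
  assumes "kspace V" "linear_on V scalars f"
  shows "restrict0 V f \<in> functionals V"
  using assms(2) kspace_closed[OF assms(1)]
  by (simp add: functionals_def restrict0_def linear_on_def)

lemma functionals_eqI:
  assumes "f \<in> functionals V" "g \<in> functionals V" "\<And>v. v \<in> carrier V \<Longrightarrow> ev f v = ev g v"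
  shows "f = g"
proof
  fix v show "f v = g v"
    using assms by (cases "v \<in> carrier V") (auto simp: functionals_def ev_def)
qed

lemma carrier_functional_space [simp]: "carrier (functional_space V) = functionals V"
  and scale_functional_space [simp]: "scale (functional_space V) = fscale"
  by (simp_all add: functional_space_def)

lemma kspace_functional_space:
  assumes "kspace V"
  shows "kspace (functional_space V)"
proof -
  interpret vector_space "fscale :: 'x::field \<Rightarrow> ('y \<Rightarrow> 'x) \<Rightarrow> _" by (rule fscale_vector_space)
  have "subspace (functionals V)"
    using kspace_closed[OF assms]
    by (auto simp: subspace_def functionals_def linear_on_def fscale_def algebra_simps)
  then show ?thesis by (simp add: kspace_def vector_space_axioms)
qed

lemma linear_on_ev:
  assumes "f \<in> functionals V" "linear_on U V g"
  shows "linear_on U scalars (\<lambda>x. ev f (g x))"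
  using linear_on_compose[OF functionalsD(1)[OF assms(1)] assms(2)] by (simp add: ev_def)

lemma linear_on_ev_left:
  assumes "scale W = fscale" "linear_on U W g"
  shows "linear_on U scalars (\<lambda>x. ev (g x) b)"
  using assms unfolding linear_on_def by (simp add: ev_def fscale_def)

text \<open>The finite dual: a basis of the space of translates \<open>\<langle>\<beta>, a _\<rangle>\<close> and its coordinate
  functions split \<open>\<langle>\<beta>, a b\<rangle>\<close> into functionals that lie in the finite dual again.\<close>

lemma dual_space_split:
  fixes B :: "('k::field, 'b::ab_group_add, 'z) algebra_scheme" (structure)
  assumes B: "kalgebra B" and \<beta>: "\<beta> \<in> carrier (dual_space B)"
  obtains qs where "set qs \<subseteq> carrier (dual_space B) \<times> carrier (dual_space B)"
    "\<And>a b. a \<in> carrier B \<Longrightarrow> b \<in> carrier B \<Longrightarrow> \<beta> (a \<cdot> b) = (\<Sum>(f, g)\<leftarrow>qs. f a * g b)"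
proof -
  interpret kalgebra B by (rule B)
  interpret F: vector_space "fscale :: 'k \<Rightarrow> ('b \<Rightarrow> 'k) \<Rightarrow> _" by (rule fscale_vector_space)
  from \<beta> obtain ps where \<beta>f: "\<beta> \<in> functionals B" and ps: "set ps \<subseteq> functionals B \<times> functionals B"
    "\<And>a b. a \<in> carrier B \<Longrightarrow> b \<in> carrier B \<Longrightarrow> \<beta> (a \<cdot> b) = (\<Sum>(f, g)\<leftarrow>ps. f a * g b)"
    unfolding dual_space_def by auto
  define tr where "tr a = restrict0 B (\<lambda>c. ev \<beta> (a \<cdot> c))" for a
  have tr_apply: "tr a c = \<beta> (a \<cdot> c)" if "c \<in> carrier B" for a c
    using that by (simp add: tr_def restrict0_def ev_def)
  have tr_f: "tr a \<in> functionals B" if "a \<in> carrier B" for a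
    unfolding tr_def by (rule restrict0_functional) (use that in \<open>auto intro!: linear_on_ev[OF \<beta>f]\<close>)
  have lin1: "linear_on B scalars (\<lambda>a. ev \<beta> (a \<cdot> c))" if "c \<in> carrier B" for c
    using that by (intro linear_on_ev[OF \<beta>f]) simp
  have tr_add: "tr (a + b) = tr a + tr b" if "a \<in> carrier B" "b \<in> carrier B" for a b
    using linear_onD(2)[OF lin1 that] by (auto simp: tr_def restrict0_def fun_eq_iff)
  have tr_scale: "tr (scale B c a) = fscale c (tr a)" if "a \<in> carrier B" for a c
    using linear_onD(3)[OF lin1 that] by (auto simp: tr_def restrict0_def fscale_def fun_eq_iff)
  \<comment> \<open>Finiteness enters here: every translate lies in the span of the finitely many
    second factors of \<open>ps\<close>.\<close>
  have tr_span: "tr a \<in> F.span (snd ` set ps)" if "a \<in> carrier B" for a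
  proof -
    have "tr a = (\<Sum>(f, g)\<leftarrow>ps. fscale (f a) g)"
    proof
      fix c
      have e: "(\<Sum>(f, g)\<leftarrow>qs. fscale (f a) g) c = (\<Sum>(f, g)\<leftarrow>qs. f a * g c)"
        for qs :: "(('b \<Rightarrow> 'k) \<times> ('b \<Rightarrow> 'k)) list"
        by (induction qs) (auto simp: fscale_def)
      show "tr a c = (\<Sum>(f, g)\<leftarrow>ps. fscale (f a) g) c"
      proof (cases "c \<in> carrier B")
        case True then show ?thesis using ps(2)[OF that True] e by (simp add: tr_apply)
      next
        case False
        have "(\<Sum>(f, g)\<leftarrow>ps. f a * g c) = (\<Sum>(f, g)\<leftarrow>ps. 0)"
          using ps(1) False
            by (intro arg_cong[where f=sum_list] map_cong) (auto simp: functionals_def)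
        then show ?thesis using e False by (simp add: tr_def restrict0_def case_prod_unfold)
      qed
    qed
    moreover have "(\<Sum>(f, g)\<leftarrow>qs. fscale (f a) g) \<in> F.span (snd ` set qs)" for qs
    proof (induction qs)
      case (Cons q qs)
      then have 1: "(\<Sum>(f, g)\<leftarrow>qs. fscale (f a) g) \<in> F.span (snd ` set (q # qs))"
        using F.span_mono[of "snd ` set qs" "snd ` set (q # qs)"] by auto
      have 2: "snd q \<in> F.span (snd ` set (q # qs))" by (rule F.span_base) simp
      show ?case
        using F.span_add[OF F.span_scale[OF 2, of "fst q a"] 1]
          by (simp only: list.map sum_list.Cons case_prod_unfold)
    qed (simp add: F.span_zero del: zero_fun_apply)
    ultimately show ?thesis by simp
  qed
  \<comment> \<open>The basis is taken among the translates themselves. Each basis element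
    \<open>h\<close> is then \<open>tr (p h)\<close>, so its value on a product is again a value of
    \<open>\<beta>\<close> and splits in the same way.\<close>
  obtain H where H: "H \<subseteq> tr ` carrier B" "F.independent H" "tr ` carrier B \<subseteq> F.span H"
    using F.maximal_independent_subset by blast
  have finH: "finite H"
    by (rule F.independent_span_bound[of "snd ` set ps", THEN conjunct1]) (use H tr_span in auto)
  have "\<forall>h\<in>H. \<exists>b. b \<in> carrier B \<and> tr b = h" using H(1) by auto
  from bchoice[OF this] obtain p where p: "\<And>h. h \<in> H \<Longrightarrow> p h \<in> carrier B \<and> tr (p h) = h" by blast
  have tr_H: "tr a \<in> F.span H" if "a \<in> carrier B" for a using H(3) that by auto
  define u where "u h = restrict0 B (\<lambda>a. F.representation H (tr a) h)" for h
  have u_f: "u h \<in> functionals B" for h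
    unfolding u_def
  proof (rule restrict0_functional)
    show "linear_on B scalars (\<lambda>a. F.representation H (tr a) h)"
      unfolding linear_on_def
      using H(2) tr_H
        by (auto simp: tr_add tr_scale F.representation_add F.representation_scale simp del:
          plus_fun_apply)
  qed simp
  have u_eq: "(\<Sum>h\<in>H. fscale (u h a) h) = tr a" if "a \<in> carrier B" for a
    using F.sum_representation_eq[OF H(2) _ finH order_refl, of "tr a"] H(3) that
    by (simp add: u_def restrict0_def image_subset_iff)
  obtain hs where hs: "set hs = H" "distinct hs" using finite_distinct_list[OF finH] by blast
  have sum_hs: "(\<Sum>(f, g)\<leftarrow>map (\<lambda>h. (x h, y h)) hs. f a * g b) = (\<Sum>h\<in>H. x h a * y h b)"
    for x y :: "('b \<Rightarrow> 'k) \<Rightarrow> 'b \<Rightarrow> 'k" and a b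
    using sum_list_distinct_conv_sum_set[OF hs(2), of "\<lambda>h. x h a * y h b"] hs(1)
    by (simp add: comp_def)
  have sum_apply: "(\<Sum>h\<in>H. fscale (x h) (y h)) c = (\<Sum>h\<in>H. x h * y h c)"
    for x :: "('b \<Rightarrow> 'k) \<Rightarrow> 'k" and y c
    using finH by (induction H rule: finite_induct) (auto simp: fscale_def)
  have split: "\<beta> (a \<cdot> b) = (\<Sum>h\<in>H. u h a * h b)" if "a \<in> carrier B" "b \<in> carrier B" for a b
    using u_eq[OF that(1)] that sum_apply[of "\<lambda>h. u h a" "\<lambda>h. h" b] by (simp add: tr_apply)
  define w where "w k h = restrict0 B (\<lambda>b. ev (u k) (p h \<cdot> b))" for k h
  have w_f: "w k h \<in> functionals B" if "h \<in> H" for k h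
    unfolding w_def using that p by (intro restrict0_functional linear_on_ev[OF u_f]) simp_all
  have h_dual: "h \<in> carrier (dual_space B)" if h: "h \<in> H" for h
  proof -
    have "h (a \<cdot> b) = (\<Sum>(f, g)\<leftarrow>map (\<lambda>k. (w k h, k)) hs. f a * g b)"
      if ab: "a \<in> carrier B" "b \<in> carrier B" for a b
    proof -
      have "h (a \<cdot> b) = tr (p h) (a \<cdot> b)" using p[OF h] by simp
      also have "\<dots> = \<beta> (p h \<cdot> a \<cdot> b)"
        using conjunct1[OF p[OF h]] ab by (simp add: tr_apply mult_assoc)
      also have "\<dots> = (\<Sum>k\<in>H. u k (p h \<cdot> a) * k b)"
        using conjunct1[OF p[OF h]] ab by (intro split) auto
      finally show ?thesis
        unfolding sum_hs using ab by (simp add: w_def restrict0_def ev_def)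
    qed
    moreover have "set (map (\<lambda>k. (w k h, k)) hs) \<subseteq> functionals B \<times> functionals B"
      using hs(1) w_f[OF h] tr_f H(1) by auto
    ultimately show ?thesis using h H(1) tr_f unfolding dual_space_def vspace.simps by blast
  qed
  have u_dual: "u k \<in> carrier (dual_space B)" for k
  proof -
    have "u k (a \<cdot> b) = (\<Sum>(f, g)\<leftarrow>map (\<lambda>h. (u h, w k h)) hs. f a * g b)"
      if ab: "a \<in> carrier B" "b \<in> carrier B" for a b
    proof -
      \<comment> \<open>The expansion of \<open>tr a\<close> in the basis is translated further by
        \<open>b\<close>. Its \<open>k\<close>-th coordinate then splits
        \<open>u k (a \<cdot> b)\<close>.\<close>
      have "tr (a \<cdot> b) = (\<Sum>h\<in>H. fscale (u h a) (tr (p h \<cdot> b)))"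
      proof
        fix c
        show "tr (a \<cdot> b) c = (\<Sum>h\<in>H. fscale (u h a) (tr (p h \<cdot> b))) c"
        proof (cases "c \<in> carrier B")
          case True
          have "tr (a \<cdot> b) c = \<beta> (a \<cdot> (b \<cdot> c))" using True ab by (simp add: tr_apply mult_assoc)
          also have "\<dots> = (\<Sum>h\<in>H. u h a * h (b \<cdot> c))" using True ab by (simp add: split)
          also have "\<dots> = (\<Sum>h\<in>H. u h a * tr (p h \<cdot> b) c)"
          proof (rule sum.cong)
            fix h assume "h \<in> H"
            then have "p h \<in> carrier B" "h (b \<cdot> c) = tr (p h) (b \<cdot> c)" using p by auto
            then show "u h a * h (b \<cdot> c) = u h a * tr (p h \<cdot> b) c"
              using True ab by (simp add: tr_apply mult_assoc)
          qed simp
          finally show ?thesis by (simp add: sum_apply)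
        qed (simp add: sum_apply tr_def restrict0_def)
      qed
      moreover have "F.representation H (\<Sum>h\<in>H. fscale (u h a) (tr (p h \<cdot> b))) k
          = (\<Sum>h\<in>H. u h a * F.representation H (tr (p h \<cdot> b)) k)"
      proof -
        have "tr (p h \<cdot> b) \<in> F.span H" if "h \<in> H" for h using H(3) p[OF that] ab by auto
        then show ?thesis using H(2)
          by (subst F.representation_sum) (auto intro: F.span_scale simp: F.representation_scale)
      qed
      moreover have "w k h b = F.representation H (tr (p h \<cdot> b)) k" if "h \<in> H" for h
        using ab p[OF that] by (simp add: w_def u_def restrict0_def ev_def)
      ultimately show ?thesis unfolding sum_hs using ab by (simp add: u_def restrict0_def)
    qed
    moreover have "set (map (\<lambda>h. (u h, w k h)) hs) \<subseteq> functionals B \<times> functionals B"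
      using hs(1) w_f u_f by auto
    ultimately show ?thesis using u_f unfolding dual_space_def vspace.simps by blast
  qed
  show ?thesis
  proof (rule that)
    show "set (map (\<lambda>h. (u h, h)) hs) \<subseteq> carrier (dual_space B) \<times> carrier (dual_space B)"
      using hs(1) h_dual u_dual by auto
    show "\<beta> (a \<cdot> b) = (\<Sum>(f, g)\<leftarrow>map (\<lambda>h. (u h, h)) hs. f a * g b)"
      if "a \<in> carrier B" "b \<in> carrier B" for a b
      unfolding sum_hs by (rule split[OF that])
  qed
qed

lemma tensor_separated_eq:
  fixes V :: "('k::field, 'x \<Rightarrow> 'k, 'z) vspace_scheme" and W :: "('k, 'w::ab_group_add, 'y)
      vspace_scheme"
  assumes V: "kspace V" "scale V = fscale" and W: "kspace W"
    and E: "\<And>i. i \<in> I \<Longrightarrow> linear_on W scalars (e i)"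
      "\<And>w. w \<in> carrier W \<Longrightarrow> (\<And>i. i \<in> I \<Longrightarrow> e i w = 0) \<Longrightarrow> w = 0"
    and P: "\<And>v x. v \<in> carrier V \<Longrightarrow> x \<notin> P \<Longrightarrow> v x = 0"
    and st: "s \<in> carrier (tensor_space V W)" "t \<in> carrier (tensor_space V W)"
    and eq: "\<And>x i. x \<in> P \<Longrightarrow> i \<in> I \<Longrightarrow>
      tsum V W s (\<lambda>v w. ev v x * e i w) = tsum V W t (\<lambda>v w. ev v x * e i w)"
  shows "s = t"
proof -
  let ?T = "tensor_space V W"
  have t': "- t \<in> carrier ?T" using st by (simp add: kspace_closed(4))
  have "s + - t = 0"
  proof (rule tensor_separated[where V=V and W=W and I=I and e=e and P=P])
    show "s + - t \<in> carrier ?T" by (rule kspace_closed(2)[OF kspace_tensor_space st(1) t'])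
    fix x i assume xi: "x \<in> P" "i \<in> I"
    let ?F = "\<lambda>t. tsum V W t (\<lambda>v w. ev v x * e i w)"
    have F: "linear_on ?T scalars ?F"
      using V W E(1)[OF xi(2)] linear_on_ev_left[OF V(2), where U=V and g="\<lambda>x. x"] by simp
    have "?F (t + - t) = ?F t + ?F (- t)" using linear_onD(2)[OF F st(2) t'] .
    then have "?F (- t) = - ?F t"
      using linear_on_zero[OF _ F] by (simp add: eq_neg_iff_add_eq_0 add.commute)
    then show "?F (s + - t) = 0"
      using linear_onD(2)[OF F st(1) t'] eq[OF xi] by simp
  next
    fix w assume "w \<in> carrier W" "\<And>i. i \<in> I \<Longrightarrow> e i w = 0"
    then show "w = 0" by (rule E(2))
  qed (use V W E(1) P in auto)
  then show ?thesis by simp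
qed

lemma tsum_times:
  fixes c :: "'k::field"
  shows "tsum V W t f * c = tsum V W t (\<lambda>x y. f x y * c)" "c * tsum V W t f
      = tsum V W t (\<lambda>x y. c * f x y)"
proof -
  have "(\<Sum>(x, y)\<leftarrow>ps. f x y) * c = (\<Sum>(x, y)\<leftarrow>ps. f x y * c)"
    "c * (\<Sum>(x, y)\<leftarrow>ps. f x y) = (\<Sum>(x, y)\<leftarrow>ps. c * f x y)" for ps
    by (induction ps) (auto simp: algebra_simps)
  then show "tsum V W t f * c = tsum V W t (\<lambda>x y. f x y * c)" "c * tsum V W t f
      = tsum V W t (\<lambda>x y. c * f x y)"
    by (simp_all add: tsum_def)
qed

lemma csum_times:
  fixes c :: "'k::field"
  shows "csum C b f * c = csum C b (\<lambda>x y. f x y * c)" "c * csum C b f = csum C b (\<lambda>x y. c * f x y)"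
  unfolding csum_def by (rule tsum_times)+

lemma csum_product:
  fixes f :: "_ \<Rightarrow> _ \<Rightarrow> 'k::field"
  shows "csum C b f * csum D d g = csum C b (\<lambda>x y. csum D d (\<lambda>u v. f x y * g u v))"
  by (simp only: csum_times(1)) (simp only: csum_times(2))

text \<open>With the coalgebra as an explicit premise that the simplifier discharges, one congruence
  rule serves mixed sums over \<open>B\<close> and over its dual.\<close>

lemma csum_congs:
  assumes "kcoalgebra C" "c = d" "d \<in> carrier C"
    "\<And>x y. x \<in> carrier C \<Longrightarrow> y \<in> carrier C \<Longrightarrow> \<phi> x y = \<psi> x y"
  shows "csum C c \<phi> = csum C d \<psi>"
  using assms by (rule kcoalgebra.csum_cong)

section \<open>Hopf algebra structure on the finite dual\<close>

context hopf_algebra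
begin

abbreviation (input) A where "A \<equiv> dual B"
abbreviation (input) F where "F \<equiv> functional_space B"
abbreviation (input) mult_dual (infixl "\<star>" 70) where "\<alpha> \<star> \<beta> \<equiv> \<alpha> \<cdot>\<^bsub>dual B\<^esub> \<beta>"
abbreviation (input) unit_dual ("\<epsilon>") where "\<epsilon> \<equiv> \<one>\<^bsub>dual B\<^esub>"

lemma scale_dual [simp]: "scale (dual B) = fscale"
  and counit_dual [simp]: "counit (dual B) \<beta> = ev \<beta> \<one>"
  by (simp_all add: dual_def ev_def)

lemma dual_same_space: "carrier (dual B) = carrier (dual_space B)" "scale (dual B)
    = scale (dual_space B)"
  by (simp_all add: dual_def dual_space_def)

lemma dual_functional [simp]: "\<beta> \<in> carrier A \<Longrightarrow> \<beta> \<in> functionals B"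
  by (simp add: dual_def dual_space_def)

lemma dual_outside: "\<beta> \<in> carrier A \<Longrightarrow> b \<notin> carrier B \<Longrightarrow> \<beta> b = 0"
  by (rule functionalsD(2)) auto

lemma kspace_functionals [simp]: "kspace F"
  by (rule kspace_functional_space[OF kspace])

lemma linear_on_ev_functional [simp]:
  "linear_on U (dual B) g \<Longrightarrow> linear_on U scalars (\<lambda>x. ev (g x) b)"
  "\<beta> \<in> carrier A \<Longrightarrow> linear_on U B h \<Longrightarrow> linear_on U scalars (\<lambda>x. ev \<beta> (h x))"
  using linear_on_ev_left[of "dual B" U g b] linear_on_ev[of \<beta> B U h] by auto

lemma linear_on_evF [simp]:
  "linear_on U F g \<Longrightarrow> linear_on U scalars (\<lambda>x. ev (g x) b)"
  "f \<in> functionals B \<Longrightarrow> linear_on U B h \<Longrightarrow> linear_on U scalars (\<lambda>x. ev f (h x))"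
  using linear_on_ev_left[of F U g b] linear_on_ev[of f B U h] by auto

text \<open>Membership asks for a splitting into arbitrary functionals, so the witness is a tensor
  over \<open>F\<close>. Closure of the dual under an operation can thus be shown before the factors
  of the splitting are known to lie in the dual.\<close>

lemma dualI:
  assumes \<beta>: "\<beta> \<in> functionals B" and t: "t \<in> carrier (tensor_space F F)"
    and eq: "\<And>a b. a \<in> carrier B \<Longrightarrow> b \<in> carrier B \<Longrightarrow>
      ev \<beta> (a \<cdot> b) = tsum F F t (\<lambda>x y. ev x a * ev y b)"
  shows "\<beta> \<in> carrier A"
proof -
  have "set (tensor_rep F F t) \<subseteq> functionals B \<times> functionals B"
    using tensor_rep(1)[OF _ _ t] by simp
  moreover have "\<beta> (a \<cdot> b) = (\<Sum>(f, g)\<leftarrow>tensor_rep F F t. f a * g b)"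
    if "a \<in> carrier B" "b \<in> carrier B" for a b
    using eq[OF that] by (simp add: tsum_def ev_def)
  ultimately show ?thesis
    using \<beta> unfolding dual_def dual_space_def hopf.simps vspace.simps by blast
qed

lemma kspace_dual [simp]: "kspace A"
proof -
  interpret vector_space "fscale :: 'k \<Rightarrow> ('b \<Rightarrow> 'k) \<Rightarrow> _" by (rule fscale_vector_space)
  note cl = kspace_closed[OF kspace_functionals, simplified]
  have "subspace (carrier A)"
  proof (rule subspaceI)
    show "0 \<in> carrier A"
      by (rule dualI[where t=0]) (use cl(1) linear_on_zero[of "tensor_space F F" scalars "\<lambda>t.
          tsum F F t (\<lambda>x y. ev x _ * ev y _)"] in
        \<open>simp_all add: kspace_closed(1) ev_def[of 0]\<close>)
    fix x y assume x: "x \<in> carrier A" and y: "y \<in> carrier A"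
    from x y obtain ps qs where ps: "set ps \<subseteq> functionals B \<times> functionals B"
      "set qs \<subseteq> functionals B \<times> functionals B"
      "\<forall>a\<in>carrier B. \<forall>b\<in>carrier B. x (a \<cdot> b) = (\<Sum>(f, g)\<leftarrow>ps. f a * g b)"
      "\<forall>a\<in>carrier B. \<forall>b\<in>carrier B. y (a \<cdot> b) = (\<Sum>(f, g)\<leftarrow>qs. f a * g b)"
      unfolding dual_def dual_space_def by auto
    have "x + y \<in> functionals B" using x y cl(2) by simp
    then show "x + y \<in> carrier A"
      using ps unfolding dual_def dual_space_def hopf.simps vspace.simps
      by (auto intro!: exI[of _ "ps @ qs"])
    fix c
    have "(\<Sum>(f, g)\<leftarrow>map (\<lambda>(f, g). (fscale c f, g)) rs. f a * g b) = c * (\<Sum>(f, g)\<leftarrow>rs. f a * g b)"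
      for rs :: "(('b \<Rightarrow> 'k) \<times> ('b \<Rightarrow> 'k)) list" and a b
      by (induction rs) (auto simp: fscale_def algebra_simps)
    moreover have "fscale c x \<in> functionals B" using x cl(3) by simp
    ultimately show "fscale c x \<in> carrier A"
      using ps cl(3) unfolding dual_def dual_space_def hopf.simps vspace.simps
      by (intro CollectI conjI exI[of _ "map (\<lambda>(f, g). (fscale c f, g)) ps"])
        (auto simp: fscale_def[of c x])
  qed
  then show ?thesis by (simp add: kspace_def vector_space_axioms)
qed

lemma dual_eqI:
  "\<alpha> \<in> carrier A \<Longrightarrow> \<beta> \<in> carrier A \<Longrightarrow> (\<And>b. b \<in> carrier B \<Longrightarrow> ev \<alpha> b = ev \<beta> b) \<Longrightarrow> \<alpha> = \<beta>"
  by (rule functionals_eqI) auto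

lemma dual_tensor_eqI:
  assumes "s \<in> carrier (tensor_space A A)" "t \<in> carrier (tensor_space A A)"
    and "\<And>a b. a \<in> carrier B \<Longrightarrow> b \<in> carrier B \<Longrightarrow>
      tsum A A s (\<lambda>x y. ev x a * ev y b) = tsum A A t (\<lambda>x y. ev x a * ev y b)"
  shows "s = t"
proof (rule tensor_separated_eq[where I="carrier B" and P="carrier B" and e="\<lambda>b \<beta>. ev \<beta> b"])
  show "w = 0" if "w \<in> carrier A" "\<And>b. b \<in> carrier B \<Longrightarrow> ev w b = 0" for w
    using that kspace_closed(1)[OF kspace_dual] by (intro dual_eqI) (auto simp: ev_def)
qed (use assms in \<open>auto intro: dual_outside\<close>)

text \<open>The second factor is itself a tensor square, separated by pairs of points of
  \<open>B\<close> according to \<open>dual_tensor_eqI\<close>.\<close>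

lemma dual_tensor3_eqI:
  fixes s t :: "('k, 'b \<Rightarrow> 'k, ('k, 'b \<Rightarrow> 'k, 'b \<Rightarrow> 'k) tensor) tensor"
  assumes "s \<in> carrier (tensor_space A (tensor_space A A))"
    "t \<in> carrier (tensor_space A (tensor_space A A))"
    and "\<And>a b c. a \<in> carrier B \<Longrightarrow> b \<in> carrier B \<Longrightarrow> c \<in> carrier B \<Longrightarrow>
      tsum A (tensor_space A A) s (\<lambda>x w. ev x a * tsum A A w (\<lambda>y z. ev y b * ev z c))
      = tsum A (tensor_space A A) t (\<lambda>x w. ev x a * tsum A A w (\<lambda>y z. ev y b * ev z c))"
  shows "s = t"
proof (rule tensor_separated_eq[where I="carrier B \<times> carrier B" and P="carrier B"
      and e="\<lambda>i w. tsum A A w (\<lambda>y z. ev y (fst i) * ev z (snd i))"])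
  show "w = 0" if w: "w \<in> carrier (tensor_space A A)"
    "\<And>i. i \<in> carrier B \<times> carrier B \<Longrightarrow> tsum A A w (\<lambda>y z. ev y (fst i) * ev z (snd i)) = 0" for w
  proof (rule dual_tensor_eqI[OF w(1)])
    show "0 \<in> carrier (tensor_space A A)" by (simp add: kspace_closed(1))
    have "linear_on (tensor_space A A) scalars (\<lambda>t. tsum A A t (\<lambda>x y. ev x a * ev y b))" for a b
      by simp
    from linear_on_zero[OF _ this]
    show "tsum A A w (\<lambda>x y. ev x a * ev y b) = tsum A A 0 (\<lambda>x y. ev x a * ev y b)"
      if "a \<in> carrier B" "b \<in> carrier B" for a b
      using w(2)[of "(a, b)"] that by simp
  qed
qed (use assms in \<open>auto intro: dual_outside\<close>)

text \<open>The coproduct is a definite description. Existence comes from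
  \<open>dual_space_split\<close>, whose factors lie in the dual again; uniqueness holds because
  pairs of points of \<open>B\<close> separate the tensor square of the dual.\<close>

lemma dual_comult:
  assumes "\<beta> \<in> carrier A"
  shows "comult A \<beta> \<in> carrier (tensor_space A A)"
    "\<And>a b. a \<in> carrier B \<Longrightarrow> b \<in> carrier B \<Longrightarrow> csum A \<beta> (\<lambda>x y. ev x a * ev y b) = ev \<beta> (a \<cdot> b)"
proof -
  have B: "kalgebra B" by unfold_locales
  let ?P = "\<lambda>t. t \<in> carrier (tensor_space A A) \<and> (\<forall>a\<in>carrier B. \<forall>b\<in>carrier B.
    sweedler A A t (\<lambda>x y. x a * y b) = \<beta> (a \<cdot> b))"
  have sw: "sweedler A A t (\<lambda>x y. x a * y b) = tsum A A t (\<lambda>x y. ev x a * ev y b)"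
    if "t \<in> carrier (tensor_space A A)" for t a b
  proof (rule sweedler_eq_tsum[where U=scalars])
    show "v a * w b = ev v a * ev w b" for v w by (simp add: ev_def)
  qed (use that in auto)
  obtain qs where qs: "set qs \<subseteq> carrier (dual_space B) \<times> carrier (dual_space B)"
    "\<And>a b. a \<in> carrier B \<Longrightarrow> b \<in> carrier B \<Longrightarrow> \<beta> (a \<cdot> b) = (\<Sum>(f, g)\<leftarrow>qs. f a * g b)"
    using dual_space_split[OF B] assms[unfolded dual_same_space] by blast
  let ?t = "\<Sum>(f, g)\<leftarrow>qs. tens A A f g"
  have "?t \<in> carrier (tensor_space A A)"
    by (rule linear_on_sum_list[OF _ linear_on_id, THEN conjunct1])
      (use qs(1) in \<open>auto simp: dual_same_space\<close>)
  moreover have "tsum A A ?t (\<lambda>x y. ev x a * ev y b) = (\<Sum>(f, g)\<leftarrow>qs. ev f a * ev g b)" for a b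
    by (rule tsum_eq[where U=scalars]) (use qs(1) in \<open>auto simp: dual_same_space(1) intro!:
      bilinear_onI\<close>)
  ultimately have "?P ?t" using qs(2) by (simp add: sw) (simp add: ev_def)
  moreover have "s = t" if "?P s" "?P t" for s t
    using that by (intro dual_tensor_eqI) (auto simp: sw)
  ultimately have "?P (THE t. ?P t)" by (intro theI'[of ?P]) blast
  \<comment> \<open>The definition forms its tensors over \<open>dual_space B\<close>, which has the
    carrier and scaling of \<open>dual B\<close>.\<close>
  moreover have "comult A \<beta> = (THE t. ?P t)"
    unfolding tensor_same_space[OF dual_same_space dual_same_space] by (simp add: dual_def)
  ultimately have P: "?P (comult A \<beta>)" by simp
  then show "comult A \<beta> \<in> carrier (tensor_space A A)" by blast
  show "csum A \<beta> (\<lambda>x y. ev x a * ev y b) = ev \<beta> (a \<cdot> b)" if "a \<in> carrier B" "b \<in> carrier B" for a b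
    using P that sw unfolding csum_def by (auto simp: ev_def)
qed

lemma dual_comult_linear: "linear_on A (tensor_space A A) (comult A)"
proof -
  let ?T = "tensor_space A A"
  have G: "linear_on ?T scalars (\<lambda>t. tsum A A t (\<lambda>x y. ev x a * ev y b))" for a b by simp
  note ev = dual_comult(2)[unfolded csum_def]
  note cl = kspace_closed[OF kspace_dual] kspace_closed[OF kspace_tensor_space]
  show ?thesis
    unfolding linear_on_def
  proof (intro conjI ballI allI)
    fix v assume v: "v \<in> carrier A"
    then show cv: "comult A v \<in> carrier ?T" by (rule dual_comult)
    show "comult A (scale A c v) = scale ?T c (comult A v)" for c
    proof (rule dual_tensor_eqI)
      show "comult A (scale A c v) \<in> carrier ?T" using v cl(3) by (intro dual_comult) auto
      show "scale ?T c (comult A v) \<in> carrier ?T" using cv by (rule cl)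
      fix a b assume "a \<in> carrier B" "b \<in> carrier B"
      then show "tsum A A (comult A (scale A c v)) (\<lambda>x y. ev x a * ev y b)
          = tsum A A (scale ?T c (comult A v)) (\<lambda>x y. ev x a * ev y b)"
        using v cl(3)[OF v, of c] ev linear_onD(3)[OF G cv] by (simp add: ev_def fscale_def)
    qed
    fix w assume w: "w \<in> carrier A"
    have cw: "comult A w \<in> carrier ?T" using w by (rule dual_comult)
    show "comult A (v + w) = comult A v + comult A w"
    proof (rule dual_tensor_eqI)
      show "comult A (v + w) \<in> carrier ?T" using v w cl(2) by (intro dual_comult) auto
      show "comult A v + comult A w \<in> carrier ?T" using cv cw by (rule cl)
      fix a b assume "a \<in> carrier B" "b \<in> carrier B"
      then show "tsum A A (comult A (v + w)) (\<lambda>x y. ev x a * ev y b)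
          = tsum A A (comult A v + comult A w) (\<lambda>x y. ev x a * ev y b)"
        using v w cl(2)[OF v w] ev linear_onD(2)[OF G cv cw] by (simp add: ev_def)
    qed
  qed
qed

text \<open>At a, b, c coassociativity reads \<beta>((a b) c) = \<beta>(a (b c)), and the counit
  laws become the unit laws of \<open>B\<close>.\<close>

lemma kcoalgebra_dual: "kcoalgebra A"
proof (intro kcoalgebra.intro kspace_dual kcoalgebra_axioms.intro)
  show lin: "linear_on A (tensor_space A A) (comult A)" by (rule dual_comult_linear)
  have [simp]: "linear_on U A g \<Longrightarrow> linear_on U (tensor_space A A) (\<lambda>x. comult A (g x))"
    for U :: "('k, 'c::ab_group_add, 'd) vspace_scheme" and g
    by (rule linear_on_compose[OF lin])
  show "linear_on A scalars (counit A)" by (simp cong: linear_on_cong)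
  note [simp] = dual_comult(1)
  let ?T2 = "tensor_space A A" and ?T3 = "tensor_space A (tensor_space A A)"
  note ev = dual_comult(2)[unfolded csum_def]
  have pull: "tsum A A t (\<lambda>x y. f x y * c) = tsum A A t f * c" "tsum A A t (\<lambda>x y. c * f x y)
      = c * tsum A A t f"
    if "t \<in> carrier ?T2" for t f and c :: 'k
    using that linear_on_tsum[where X=scalars and Y=scalars and f="\<lambda>x.
        x * c" and V=A and W=A and t=t and \<phi>=f]
      linear_on_tsum[where X=scalars and Y=scalars and f="\<lambda>x.
          c * x" and V=A and W=A and t=t and \<phi>=f]
    by simp_all
  fix \<beta> assume \<beta>: "\<beta> \<in> carrier A"
  have "cop2 A \<beta> (\<lambda>d z. cop2 A d (\<lambda>x y. tens A ?T2 x (tens A A y z)))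
      = tsum A A (comult A \<beta>) (\<lambda>d z. tsum A A (comult A d) (\<lambda>x y. tens A ?T2 x (tens A A y z)))"
    unfolding cop2_def using \<beta>
    by (intro sweedler_eq_tsum[where U="?T3"]) (auto intro!: sweedler_eq_tsum[where U="?T3"])
  moreover have "cop2 A \<beta> (\<lambda>x d. tens A ?T2 x (comult A d))
      = tsum A A (comult A \<beta>) (\<lambda>x d. tens A ?T2 x (comult A d))"
    unfolding cop2_def using \<beta> by (intro sweedler_eq_tsum[where U="?T3"]) auto
  moreover have "tsum A A (comult A \<beta>) (\<lambda>d z. tsum A A (comult A d) (\<lambda>x y.
      tens A ?T2 x (tens A A y z)))
      = tsum A A (comult A \<beta>) (\<lambda>x d. tens A ?T2 x (comult A d))" (is "?L = ?R")
  proof (rule dual_tensor3_eqI)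
    show "?L \<in> carrier ?T3" "?R \<in> carrier ?T3" using \<beta> by simp_all
    fix a b c assume abc: "a \<in> carrier B" "b \<in> carrier B" "c \<in> carrier B"
    let ?G = "\<lambda>t. tsum A ?T2 t (\<lambda>x w. ev x a * tsum A A w (\<lambda>y z. ev y b * ev z c))"
    have G: "linear_on ?T3 scalars ?G" by simp
    have Gt: "?G (tens A ?T2 x (tens A A y z)) = ev x a * ev y b * ev z c"
      if "x \<in> carrier A" "y \<in> carrier A" "z \<in> carrier A" for x y z
      using that by (simp add: tsum_tens[where U=scalars])
    have Gc: "?G (tens A ?T2 x (comult A d)) = ev x a * ev d (b \<cdot> c)"
      if "x \<in> carrier A" "d \<in> carrier A" for x d
      using that abc by (simp add: tsum_tens[where U=scalars] ev)
    have "?G ?L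
        = tsum A A (comult A \<beta>) (\<lambda>d z. tsum A A (comult A d) (\<lambda>x y. ev x a * ev y b * ev z c))"
      using \<beta> by (auto simp: linear_on_tsum[OF _ _ _ G] Gt intro!: tsum_cong)
    also have "\<dots> = tsum A A (comult A \<beta>) (\<lambda>d z. ev d (a \<cdot> b) * ev z c)"
      using \<beta> abc by (intro tsum_cong) (auto simp: pull ev)
    also have "\<dots> = ev \<beta> (a \<cdot> (b \<cdot> c))" using \<beta> abc by (simp add: ev mult_assoc)
    also have "\<dots> = tsum A A (comult A \<beta>) (\<lambda>x d. ev x a * ev d (b \<cdot> c))"
      using \<beta> abc by (simp add: ev)
    also have "\<dots> = ?G ?R"
      using \<beta> by (auto simp: linear_on_tsum[OF _ _ _ G] Gc intro!: tsum_cong)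
    finally show "?G ?L = ?G ?R" .
  qed
  ultimately show "cop2 A \<beta> (\<lambda>d z. cop2 A d (\<lambda>x y. tens A ?T2 x (tens A A y z)))
      = cop2 A \<beta> (\<lambda>x d. tens A ?T2 x (comult A d))" by simp
  have ev_scale: "ev (fscale c \<gamma>) b = c * ev \<gamma> b" for c \<gamma> b by (simp add: ev_def fscale_def)
  have evl: "linear_on A scalars (\<lambda>\<beta>. ev \<beta> b)" for b by simp
  have [simp]: "fscale c \<gamma> \<in> carrier A" if "\<gamma> \<in> carrier A" for c \<gamma>
    using kspace_closed(3)[OF kspace_dual that] by simp
  show "cop2 A \<beta> (\<lambda>x y. scale A (counit A x) y) = \<beta>"
  proof -
    have "cop2 A \<beta> (\<lambda>x y. scale A (counit A x) y) = tsum A A (comult A \<beta>) (\<lambda>x y. fscale (ev x \<one>) y)"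
      unfolding cop2_def using \<beta> by (intro sweedler_eq_tsum[where U=A]) auto
    also have "\<dots> = \<beta>"
      using \<beta> by (intro dual_eqI) (auto simp: linear_on_tsum[OF _ _ _ evl] ev_scale ev)
    finally show ?thesis .
  qed
  show "cop2 A \<beta> (\<lambda>x y. scale A (counit A y) x) = \<beta>"
  proof -
    have "cop2 A \<beta> (\<lambda>x y. scale A (counit A y) x) = tsum A A (comult A \<beta>) (\<lambda>x y. fscale (ev y \<one>) x)"
      unfolding cop2_def using \<beta> by (intro sweedler_eq_tsum[where U=A]) auto
    also have "\<dots> = \<beta>"
      using \<beta>
        by (intro dual_eqI) (auto simp: linear_on_tsum[OF _ _ _ evl] ev_scale ev mult.commute[of
          "ev _ \<one>"])
    finally show ?thesis .
  qed
qed

lemma kcoalgebra [simp]: "kcoalgebra B" "kcoalgebra (dual B)"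
  by (rule kcoalgebra_axioms kcoalgebra_dual)+

interpretation A: kcoalgebra "dual B" by (rule kcoalgebra_dual)

text \<open>Functions are added and scaled pointwise, so linearity may be tested after evaluation at
  each point.\<close>

lemma linear_into_functionals:
  assumes "kspace U" "\<And>x. x \<in> carrier U \<Longrightarrow> g x \<in> functionals B"
    "\<And>b. b \<in> carrier B \<Longrightarrow> linear_on U scalars (\<lambda>x. ev (g x) b)"
  shows "linear_on U F g"
  unfolding linear_on_def
proof (intro conjI ballI allI)
  note cl = kspace_closed[OF assms(1)] and clF = kspace_closed[OF kspace_functionals, simplified]
  fix v c assume v: "v \<in> carrier U"
  then show "g v \<in> carrier F" using assms(2) by simp
  show "g (scale U c v) = scale F c (g v)"
    using linear_onD(3)[OF assms(3) v] v cl(3)[OF v] clF(3)[OF assms(2)[OF v]] assms(2)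
    by (intro functionals_eqI[of _ B]) (auto simp: ev_def fscale_def)
  fix w assume w: "w \<in> carrier U"
  show "g (v + w) = g v + g w"
    using linear_onD(2)[OF assms(3) v w] v w cl(2)[OF v w] clF(2)[OF assms(2)[OF v] assms(2)[OF
      w]] assms(2)
    by (intro functionals_eqI[of _ B]) (auto simp: ev_def)
qed

lemma linear_into_dual:
  assumes "kspace U" "\<And>x. x \<in> carrier U \<Longrightarrow> g x \<in> carrier A"
    "\<And>b. b \<in> carrier B \<Longrightarrow> linear_on U scalars (\<lambda>x. ev (g x) b)"
  shows "linear_on U A g"
  using linear_into_functionals[OF assms(1) _ assms(3)] assms(2) by (simp add: linear_on_def)

text \<open>The product of the dual, but used on all functionals: it is needed before products are
  known to stay in the finite dual.\<close>

definition convolution :: "('b \<Rightarrow> 'k) \<Rightarrow> ('b \<Rightarrow> 'k) \<Rightarrow> 'b \<Rightarrow> 'k"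
  where "convolution \<alpha> \<beta> = restrict0 B (\<lambda>b. csum B b (\<lambda>b1 b2. ev \<alpha> b1 * ev \<beta> b2))"

lemma convolution_functional [simp]:
  "\<alpha> \<in> functionals B \<Longrightarrow> \<beta> \<in> functionals B \<Longrightarrow> convolution \<alpha> \<beta> \<in> functionals B"
  unfolding convolution_def by (intro restrict0_functional) auto

lemma ev_convolution [simp]:
  "b \<in> carrier B \<Longrightarrow> ev (convolution \<alpha> \<beta>) b = csum B b (\<lambda>b1 b2. ev \<alpha> b1 * ev \<beta> b2)"
  by (simp add: convolution_def restrict0_def ev_def)

lemma mult_dual:
  assumes "\<alpha> \<in> functionals B" "\<beta> \<in> functionals B"
  shows "\<alpha> \<star> \<beta> = convolution \<alpha> \<beta>"
proof
  fix b
  have "cop2 B b (\<lambda>b1 b2. \<alpha> b1 * \<beta> b2) = csum B b (\<lambda>b1 b2. ev \<alpha> b1 * ev \<beta> b2)" if "b \<in> carrier B"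
  proof (rule cop2_eq_csum[where U=scalars])
    show "\<alpha> b1 * \<beta> b2 = ev \<alpha> b1 * ev \<beta> b2" for b1 b2 by (simp add: ev_def)
  qed (use that assms in auto)
  then show "(\<alpha> \<star> \<beta>) b = convolution \<alpha> \<beta> b"
    by (simp add: dual_def convolution_def restrict0_def)
qed

lemma ev_mult_dual:
  assumes "\<alpha> \<in> carrier A" "\<beta> \<in> carrier A" "b \<in> carrier B"
  shows "ev (\<alpha> \<star> \<beta>) b = csum B b (\<lambda>b1 b2. ev \<alpha> b1 * ev \<beta> b2)"
  using assms by (simp add: mult_dual)

lemma ev_unit_dual: "b \<in> carrier B \<Longrightarrow> ev \<epsilon> b = counit B b"
  by (simp add: dual_def ev_def)

lemma ev_antipode_dual: "b \<in> carrier B \<Longrightarrow> ev (antipode A \<beta>) b = ev \<beta> (antipode B b)"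
  by (simp add: dual_def ev_def)

lemma unit_dual_closed: "\<epsilon> \<in> carrier A"
proof (rule dualI)
  have "\<epsilon> = restrict0 B (counit B)" by (simp add: dual_def restrict0_def)
  then show f: "\<epsilon> \<in> functionals B"
    using restrict0_functional[OF kspace counit_linear] by simp
  show "tens F F \<epsilon> \<epsilon> \<in> carrier (tensor_space F F)" using f by simp
  show "ev \<epsilon> (a \<cdot> b) = tsum F F (tens F F \<epsilon> \<epsilon>) (\<lambda>x y. ev x a * ev y b)"
    if "a \<in> carrier B" "b \<in> carrier B" for a b
    using that f by (simp add: tsum_tens[where U=scalars] ev_unit_dual counit_mult)
qed

text \<open>The pairing form of the fact that the coproduct of \<open>B\<close> is multiplicative:
  \<open>\<alpha>\<close> and \<open>\<beta>\<close> are each split along a product. It gives both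
  closure of the dual under its product and the multiplicativity of the dual coproduct.\<close>

lemma csum_dual_product:
  assumes "\<alpha> \<in> carrier A" "\<beta> \<in> carrier A" "a \<in> carrier B" "b \<in> carrier B"
  shows "csum A \<alpha> (\<lambda>\<alpha>1 \<alpha>2. csum A \<beta> (\<lambda>\<beta>1 \<beta>2.
      csum B a (\<lambda>a1 a2. ev \<alpha>1 a1 * ev \<beta>1 a2) * csum B b (\<lambda>b1 b2. ev \<alpha>2 b1 * ev \<beta>2 b2)))
    = csum B (a \<cdot> b) (\<lambda>x y. ev \<alpha> x * ev \<beta> y)"
proof -
  have "csum B (a \<cdot> b) (\<lambda>x y. ev \<alpha> x * ev \<beta> y)
      = csum B a (\<lambda>a1 a2. csum B b (\<lambda>b1 b2. ev \<alpha> (a1 \<cdot> b1) * ev \<beta> (a2 \<cdot> b2)))"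
    using assms by (intro csum_mult[where X=scalars]) auto
  also have "\<dots> = csum B a (\<lambda>a1 a2. csum B b (\<lambda>b1 b2.
      csum A \<alpha> (\<lambda>\<alpha>1 \<alpha>2. ev \<alpha>1 a1 * ev \<alpha>2 b1) * csum A \<beta> (\<lambda>\<beta>1 \<beta>2. ev \<beta>1 a2 * ev \<beta>2 b2)))"
    using assms by (simp add: dual_comult(2) cong: csum_cong)
  also have "\<dots> = csum B a (\<lambda>a1 a2. csum B b (\<lambda>b1 b2. csum A \<alpha> (\<lambda>\<alpha>1 \<alpha>2. csum A \<beta> (\<lambda>\<beta>1 \<beta>2.
      ev \<alpha>1 a1 * ev \<beta>1 a2 * (ev \<alpha>2 b1 * ev \<beta>2 b2)))))"
    by (simp only: csum_product mult.assoc mult.left_commute)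
  also have "\<dots> = csum B a (\<lambda>a1 a2. csum A \<alpha> (\<lambda>\<alpha>1 \<alpha>2. csum A \<beta> (\<lambda>\<beta>1 \<beta>2. csum B b (\<lambda>b1 b2.
      ev \<alpha>1 a1 * ev \<beta>1 a2 * (ev \<alpha>2 b1 * ev \<beta>2 b2)))))"
    by (subst csum_swap, subst (2) csum_swap) (rule refl)
  also have "\<dots> = csum A \<alpha> (\<lambda>\<alpha>1 \<alpha>2. csum A \<beta> (\<lambda>\<beta>1 \<beta>2. csum B a (\<lambda>a1 a2. csum B b (\<lambda>b1 b2.
      ev \<alpha>1 a1 * ev \<beta>1 a2 * (ev \<alpha>2 b1 * ev \<beta>2 b2)))))"
    by (subst csum_swap, subst (2) csum_swap) (rule refl)
  finally show ?thesis by (simp add: csum_product)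
qed

lemma mult_dual_closed:
  assumes \<alpha>: "\<alpha> \<in> carrier A" and \<beta>: "\<beta> \<in> carrier A"
  shows "\<alpha> \<star> \<beta> \<in> carrier A"
proof (rule dualI)
  \<comment> \<open>The coproduct that \<open>\<alpha> \<star> \<beta>\<close> is going to have,
    formed over all functionals for the time being.\<close>
  let ?t = "csum A \<alpha> (\<lambda>\<alpha>1 \<alpha>2. csum A \<beta> (\<lambda>\<beta>1 \<beta>2. tens F F (convolution \<alpha>1 \<beta>1) (convolution \<alpha>2 \<beta>2)))"
  show "\<alpha> \<star> \<beta> \<in> functionals B" using assms by (simp add: mult_dual)
  show "?t \<in> carrier (tensor_space F F)" using assms by simp
  fix a b assume ab: "a \<in> carrier B" "b \<in> carrier B"
  have G: "linear_on (tensor_space F F) scalars (\<lambda>t. tsum F F t (\<lambda>x y. ev x a * ev y b))" by simp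
  have "tsum F F ?t (\<lambda>x y. ev x a * ev y b)
      = csum A \<alpha> (\<lambda>\<alpha>1 \<alpha>2. csum A \<beta> (\<lambda>\<beta>1 \<beta>2. ev (convolution \<alpha>1 \<beta>1) a * ev (convolution \<alpha>2 \<beta>2) b))"
    using assms
      by (simp add: A.linear_on_csum[OF _ G] tsum_tens[where U=scalars] del: ev_convolution cong:
        A.csum_cong)
  then show "ev (\<alpha> \<star> \<beta>) (a \<cdot> b) = tsum F F ?t (\<lambda>x y. ev x a * ev y b)"
    using assms ab by (simp add: ev_mult_dual csum_dual_product)
qed

lemma kalgebra_dual: "kalgebra A"
proof (intro kalgebra.intro kspace_dual kalgebra_axioms.intro)
  note [simp] = mult_dual_closed unit_dual_closed
  show "bilinear_on A A A (mult A)"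
    by (intro bilinear_onI linear_into_dual) (auto simp: ev_mult_dual cong: linear_on_cong)
  show "\<epsilon> \<in> carrier A" by simp
  fix x assume x: "x \<in> carrier A"
  show "\<epsilon> \<star> x = x"
    using x csum_counit(1)[of scalars "ev x"]
    by (intro dual_eqI) (auto simp: ev_mult_dual ev_unit_dual cong: csum_cong)
  show "x \<star> \<epsilon> = x"
    using x csum_counit(2)[of scalars "ev x"]
    by (intro dual_eqI) (auto simp: ev_mult_dual ev_unit_dual mult.commute cong: csum_cong)
  fix y z assume yz: "y \<in> carrier A" "z \<in> carrier A"
  show "x \<star> y \<star> z = x \<star> (y \<star> z)"
  proof (rule dual_eqI)
    fix b assume b: "b \<in> carrier B"
    have "ev (x \<star> y \<star> z) b = csum B b (\<lambda>d b3. csum B d (\<lambda>b1 b2. ev x b1 * ev y b2 * ev z b3))"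
      using x yz b by (simp add: ev_mult_dual csum_times cong: csum_cong)
    also have "\<dots> = csum B b (\<lambda>b1 d. csum B d (\<lambda>b2 b3. ev x b1 * ev y b2 * ev z b3))"
      using x yz b by (intro csum_coassoc[where X=scalars]) auto
    also have "\<dots> = ev (x \<star> (y \<star> z)) b"
      using x yz b by (simp add: ev_mult_dual csum_times mult.assoc cong: csum_cong)
    finally show "ev (x \<star> y \<star> z) b = ev (x \<star> (y \<star> z)) b" .
  qed (use x yz in simp_all)
qed

interpretation A: kalgebra "dual B" by (rule kalgebra_dual)

lemma fscale_dual_closed [simp]: "\<beta> \<in> carrier A \<Longrightarrow> fscale c \<beta> \<in> carrier A"
  using A.scale_closed by simp

lemma mult_fscale_dual [simp]:
  assumes "\<alpha> \<in> carrier A" "\<beta> \<in> carrier A"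
  shows "fscale c \<alpha> \<star> \<beta> = fscale c (\<alpha> \<star> \<beta>)" "\<alpha> \<star> fscale c \<beta> = fscale c (\<alpha> \<star> \<beta>)"
  using A.mult_scale[OF assms] by simp_all

lemma ev_csum_dual:
  assumes "\<beta> \<in> carrier A" "\<And>x y. x \<in> carrier A \<Longrightarrow> y \<in> carrier A \<Longrightarrow> \<phi> x y \<in> carrier A"
  shows "ev (csum A \<beta> \<phi>) b = csum A \<beta> (\<lambda>x y. ev (\<phi> x y) b)"
  using assms by (intro A.linear_on_csum[where X=A and Y=scalars]) auto

lemma antipode_dual_closed:
  assumes "\<beta> \<in> carrier A"
  shows "antipode A \<beta> \<in> carrier A"
proof (rule dualI)
  have eq: "antipode A \<gamma> = restrict0 B (\<lambda>b. ev \<gamma> (antipode B b))" for \<gamma>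
    by (simp add: dual_def restrict0_def ev_def)
  have f: "antipode A \<gamma> \<in> functionals B" if "\<gamma> \<in> carrier A" for \<gamma>
    unfolding eq by (rule restrict0_functional) (use that in auto)
  show "antipode A \<beta> \<in> functionals B" using f assms .
  \<comment> \<open>The factors are exchanged because the antipode of \<open>B\<close> reverses
    products.\<close>
  let ?t = "csum A \<beta> (\<lambda>x y. tens F F (antipode A y) (antipode A x))"
  show "?t \<in> carrier (tensor_space F F)" using assms f by simp
  fix a b assume ab: "a \<in> carrier B" "b \<in> carrier B"
  have G: "linear_on (tensor_space F F) scalars (\<lambda>t. tsum F F t (\<lambda>x y. ev x a * ev y b))" by simp
  have "tsum F F ?t (\<lambda>x y. ev x a * ev y b)
      = csum A \<beta> (\<lambda>x y. ev x (antipode B b) * ev y (antipode B a))"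
    using assms ab f
      by (simp add: A.linear_on_csum[OF _ G] tsum_tens[where U=scalars] ev_antipode_dual
        mult.commute cong: A.csum_cong)
  then show "ev (antipode A \<beta>) (a \<cdot> b) = tsum F F ?t (\<lambda>x y. ev x a * ev y b)"
    using assms ab by (simp add: ev_antipode_dual antipode_mult dual_comult(2))
qed

lemma antipode_dual_linear: "linear_on A A (antipode A)"
  by (rule linear_into_dual) (auto simp: ev_antipode_dual antipode_dual_closed)

text \<open>Evaluation on \<open>B\<close> turns each remaining axiom into one of \<open>B\<close>
  with product and coproduct, unit and counit exchanged.\<close>

theorem hopf_algebra_dual: "hopf_algebra A"
proof (intro hopf_algebra.intro kalgebra_dual kcoalgebra_dual hopf_algebra_axioms.intro)
  let ?T = "tensor_space A A"
  note [simp] = antipode_dual_closed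
  have lin [simp]: "linear_on U A g \<Longrightarrow> linear_on U A (\<lambda>x. antipode A (g x))"
    for U :: "('k, 'c::ab_group_add, 'd) vspace_scheme" and g
    by (rule linear_on_compose[OF antipode_dual_linear])
  have G: "linear_on ?T scalars (\<lambda>t. tsum A A t (\<lambda>x y. ev x a * ev y b))" for a b by simp
  have ev: "tsum A A (comult A \<gamma>) (\<lambda>x y. ev x a * ev y b) = ev \<gamma> (a \<cdot> b)"
    if "\<gamma> \<in> carrier A" "a \<in> carrier B" "b \<in> carrier B" for \<gamma> a b
    using dual_comult(2)[OF that] by (simp add: csum_def)
  fix \<alpha> assume \<alpha>: "\<alpha> \<in> carrier A"
  show "comult A (\<alpha> \<star> \<beta>) = cop2 A \<alpha> (\<lambda>a1 a2. cop2 A \<beta> (\<lambda>b1 b2. tens A A (a1 \<star> b1) (a2 \<star> b2)))"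
    if \<beta>: "\<beta> \<in> carrier A" for \<beta>
  proof -
    have "cop2 A \<alpha> (\<lambda>a1 a2. cop2 A \<beta> (\<lambda>b1 b2. tens A A (a1 \<star> b1) (a2 \<star> b2)))
        = csum A \<alpha> (\<lambda>a1 a2. csum A \<beta> (\<lambda>b1 b2. tens A A (a1 \<star> b1) (a2 \<star> b2)))"
      using \<alpha> \<beta> by (intro A.cop2_eq_csum[where U="?T"]) (auto intro!: A.cop2_eq_csum[where U="?T"])
    also have "\<dots> = comult A (\<alpha> \<star> \<beta>)"
    proof (rule dual_tensor_eqI)
      show "tsum A A (csum A \<alpha> (\<lambda>a1 a2. csum A \<beta> (\<lambda>b1 b2. tens A A (a1 \<star> b1) (a2 \<star> b2)))) (\<lambda>x y.
          ev x a * ev y b)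
          = tsum A A (comult A (\<alpha> \<star> \<beta>)) (\<lambda>x y. ev x a * ev y b)"
        if ab: "a \<in> carrier B" "b \<in> carrier B" for a b
        using csum_dual_product[OF \<alpha> \<beta> ab] \<alpha> \<beta> ab
        by (simp add: A.linear_on_csum[OF _ G] tsum_tens[where U=scalars] ev ev_mult_dual cong:
          A.csum_cong)
    qed (use \<alpha> \<beta> in auto)
    finally show ?thesis by simp
  qed
  show "counit A (\<alpha> \<star> \<beta>) = counit A \<alpha> * counit A \<beta>" if "\<beta> \<in> carrier A" for \<beta>
    using \<alpha> that by (simp add: ev_mult_dual csum_unit[where X=scalars])
  have unit: "scale A (counit A \<alpha>) \<epsilon> \<in> carrier A" by simp
  have ev_unit: "ev (scale A (counit A \<alpha>) \<epsilon>) b = counit B b * ev \<alpha> \<one>" if "b \<in> carrier B" for b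
    using ev_unit_dual[OF that] by (simp add: ev_def fscale_def mult.commute)
  have ev_scale: "ev \<alpha> (scale B c b) = c * ev \<alpha> b" if "b \<in> carrier B" for c b
    using linear_onD(3)[OF functionalsD(1)[of \<alpha> B] that] \<alpha> by (simp add: ev_def)
  show "cop2 A \<alpha> (\<lambda>x y. antipode A x \<star> y) = scale A (counit A \<alpha>) \<epsilon>"
  proof -
    have "cop2 A \<alpha> (\<lambda>x y. antipode A x \<star> y) = csum A \<alpha> (\<lambda>x y. antipode A x \<star> y)"
      using \<alpha> lin by (intro A.cop2_eq_csum[where U=A]) auto
    also have "\<dots> = scale A (counit A \<alpha>) \<epsilon>"
    proof (rule dual_eqI[OF _ unit])
      fix b assume b: "b \<in> carrier B"
      have "ev (csum A \<alpha> (\<lambda>x y. antipode A x \<star> y)) b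
          = csum A \<alpha> (\<lambda>x y. csum B b (\<lambda>b1 b2. ev x (antipode B b1) * ev y b2))"
        using \<alpha> b by (simp add: ev_csum_dual ev_mult_dual ev_antipode_dual cong: csum_congs)
      also have "\<dots> = csum B b (\<lambda>b1 b2. csum A \<alpha> (\<lambda>x y. ev x (antipode B b1) * ev y b2))"
        by (rule csum_swap)
      also have "\<dots> = counit B b * ev \<alpha> \<one>"
        using \<alpha> b csum_antipode(1)[of scalars "ev \<alpha>" b]
          by (simp add: dual_comult(2) cong: csum_cong)
      finally show "ev (csum A \<alpha> (\<lambda>x y. antipode A x \<star> y)) b = ev (scale A (counit A \<alpha>) \<epsilon>) b"
        using ev_unit[OF b] by simp
    qed (use \<alpha> in simp)
    finally show ?thesis .
  qed
  show "cop2 A \<alpha> (\<lambda>x y. x \<star> antipode A y) = scale A (counit A \<alpha>) \<epsilon>"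
  proof -
    have "cop2 A \<alpha> (\<lambda>x y. x \<star> antipode A y) = csum A \<alpha> (\<lambda>x y. x \<star> antipode A y)"
      using \<alpha> lin by (intro A.cop2_eq_csum[where U=A]) auto
    also have "\<dots> = scale A (counit A \<alpha>) \<epsilon>"
    proof (rule dual_eqI[OF _ unit])
      fix b assume b: "b \<in> carrier B"
      have "ev (csum A \<alpha> (\<lambda>x y. x \<star> antipode A y)) b
          = csum A \<alpha> (\<lambda>x y. csum B b (\<lambda>b1 b2. ev x b1 * ev y (antipode B b2)))"
        using \<alpha> b by (simp add: ev_csum_dual ev_mult_dual ev_antipode_dual cong: csum_congs)
      also have "\<dots> = csum B b (\<lambda>b1 b2. csum A \<alpha> (\<lambda>x y. ev x b1 * ev y (antipode B b2)))"
        by (rule csum_swap)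
      also have "\<dots> = counit B b * ev \<alpha> \<one>"
        using \<alpha> b csum_antipode(2)[of scalars "ev \<alpha>" b]
          by (simp add: dual_comult(2) cong: csum_cong)
      finally show "ev (csum A \<alpha> (\<lambda>x y. x \<star> antipode A y)) b = ev (scale A (counit A \<alpha>) \<epsilon>) b"
        using ev_unit[OF b] by simp
    qed (use \<alpha> in simp)
    finally show ?thesis .
  qed
next
  show "comult A \<epsilon> = tens A A \<epsilon> \<epsilon>"
  proof (rule dual_tensor_eqI)
    show "tsum A A (comult A \<epsilon>) (\<lambda>x y. ev x a * ev y b)
        = tsum A A (tens A A \<epsilon> \<epsilon>) (\<lambda>x y. ev x a * ev y b)"
      if "a \<in> carrier B" "b \<in> carrier B" for a b
      using that dual_comult(2)[of "\<epsilon>" a b]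
      by (simp add: csum_def tsum_tens[where U=scalars] ev_unit_dual counit_mult)
  qed simp_all
  show "counit A \<epsilon> = 1" by (simp add: ev_unit_dual counit_unit)
  show "linear_on A A (antipode A)"
    by (rule antipode_dual_linear)
qed

end

lemma tsum_same_space:
  assumes "carrier V = carrier V'" "scale V = scale V'" "carrier W = carrier W'" "scale W
      = scale W'"
  shows "tsum V W = tsum V' W'"
  by (intro ext) (simp add: tsum_def tensor_rep_def tensor_same_space(1)[OF assms] assms)

text \<open>Of the five components, \<open>p\<close>, \<open>q\<close>, \<open>r\<close> will come
  from the product of \<open>D\<close> and \<open>u\<close>, \<open>v\<close> from that of the
  Heisenberg double. The regrouping makes \<open>r\<close> and \<open>u\<close> the coproduct of one
  element \<open>w\<close>, the pair that cancels when the coaction is shown to be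
  multiplicative.\<close>

lemma (in kcoalgebra) csum_reassoc5:
  assumes "kspace X" "c \<in> carrier C"
    "\<And>q r u v. \<lbrakk>q \<in> carrier C; r \<in> carrier C; u \<in> carrier C; v \<in> carrier C\<rbrakk> \<Longrightarrow> linear_on C X (\<lambda>p.
        \<phi> p q r u v)"
    "\<And>p r u v. \<lbrakk>p \<in> carrier C; r \<in> carrier C; u \<in> carrier C; v \<in> carrier C\<rbrakk> \<Longrightarrow> linear_on C X (\<lambda>q.
        \<phi> p q r u v)"
    "\<And>p q u v. \<lbrakk>p \<in> carrier C; q \<in> carrier C; u \<in> carrier C; v \<in> carrier C\<rbrakk> \<Longrightarrow> linear_on C X (\<lambda>r.
        \<phi> p q r u v)"
    "\<And>p q r v. \<lbrakk>p \<in> carrier C; q \<in> carrier C; r \<in> carrier C; v \<in> carrier C\<rbrakk> \<Longrightarrow> linear_on C X (\<lambda>u.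
        \<phi> p q r u v)"
    "\<And>p q r u. \<lbrakk>p \<in> carrier C; q \<in> carrier C; r \<in> carrier C; u \<in> carrier C\<rbrakk> \<Longrightarrow> linear_on C X
        (\<phi> p q r u)"
  shows "csum C c (\<lambda>c1 c2. csum C c1 (\<lambda>p d. csum C d (\<lambda>q r. csum C c2 (\<lambda>u v. \<phi> p q r u v))))
    = csum C c (\<lambda>p d. csum C d (\<lambda>q e. csum C e (\<lambda>w v. csum C w (\<lambda>r u. \<phi> p q r u v))))"
proof -
  have "csum C c (\<lambda>c1 c2. csum C c1 (\<lambda>p d. csum C d (\<lambda>q r. csum C c2 (\<lambda>u v. \<phi> p q r u v))))
      = csum C c (\<lambda>p c'. csum C c' (\<lambda>d c2. csum C d (\<lambda>q r. csum C c2 (\<lambda>u v. \<phi> p q r u v))))"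
    using assms by (intro csum_coassoc[where X=X]) auto
  also have "\<dots>
      = csum C c (\<lambda>p c'. csum C c' (\<lambda>q e. csum C e (\<lambda>r c2. csum C c2 (\<lambda>u v. \<phi> p q r u v))))"
    using assms by (intro csum_cong refl csum_coassoc[where X=X]) auto
  also have "\<dots> = csum C c (\<lambda>p d. csum C d (\<lambda>q e. csum C e (\<lambda>w v. csum C w (\<lambda>r u. \<phi> p q r u v))))"
    using assms by (intro csum_cong refl csum_coassoc[where X=X, symmetric]) auto
  finally show ?thesis .
qed

context bijective_hopf_algebra
begin

section \<open>The regular actions\<close>

interpretation A: hopf_algebra "dual B" by (rule hopf_algebra_dual)

text \<open>The inverse is composition with the inverse antipode of \<open>B\<close>. It preserves
  the finite dual because that map, too, reverses products, which gives the exchanged splitting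
  \<open>?t\<close>.\<close>

lemma bijective_antipode_dual: "bij_betw (antipode A) (carrier A) (carrier A)"
proof -
  define inv where "inv \<beta> = restrict0 B (\<lambda>b. ev \<beta> (inv_antipode B b))" for \<beta>
  have ev_inv: "ev (inv \<beta>) b = ev \<beta> (inv_antipode B b)" if "b \<in> carrier B" for \<beta> b
    using that by (simp add: inv_def restrict0_def ev_def)
  have f: "inv \<beta> \<in> functionals B" if "\<beta> \<in> carrier A" for \<beta>
    unfolding inv_def by (rule restrict0_functional) (use that in auto)
  have cl: "inv \<beta> \<in> carrier A" if \<beta>: "\<beta> \<in> carrier A" for \<beta>
  proof (rule dualI)
    show "inv \<beta> \<in> functionals B" by (rule f[OF \<beta>])
    let ?t = "csum A \<beta> (\<lambda>x y. tens F F (inv y) (inv x))"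
    show "?t \<in> carrier (tensor_space F F)" using \<beta> f by simp
    fix a b assume ab: "a \<in> carrier B" "b \<in> carrier B"
    have G: "linear_on (tensor_space F F) scalars (\<lambda>t. tsum F F t (\<lambda>x y. ev x a * ev y b))" by simp
    have "tsum F F ?t (\<lambda>x y. ev x a * ev y b)
        = csum A \<beta> (\<lambda>x y. ev x (inv_antipode B b) * ev y (inv_antipode B a))"
      using \<beta> ab f
        by (simp add: A.linear_on_csum[OF _ G] tsum_tens[where U=scalars] ev_inv mult.commute
          cong: A.csum_cong)
    then show "ev (inv \<beta>) (a \<cdot> b) = tsum F F ?t (\<lambda>x y. ev x a * ev y b)"
      using \<beta> ab by (simp add: ev_inv inv_antipode_mult dual_comult(2))
  qed
  show ?thesis
  proof (rule bij_betw_byWitness[where f'=inv])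
    show "\<forall>\<beta>\<in>carrier A. inv (antipode A \<beta>) = \<beta>"
      using cl by (auto intro!: dual_eqI simp: ev_inv ev_antipode_dual)
    show "\<forall>\<beta>\<in>carrier A. antipode A (inv \<beta>) = \<beta>"
      using cl by (auto intro!: dual_eqI simp: ev_inv ev_antipode_dual)
  qed (use cl in auto)
qed

lemma bijective_hopf_algebra_dual: "bijective_hopf_algebra A"
  by (intro bijective_hopf_algebra.intro hopf_algebra_dual bijective_hopf_algebra_axioms.intro
      bijective_antipode_dual)

interpretation A: bijective_hopf_algebra "dual B" by (rule bijective_hopf_algebra_dual)

lemma ev_inv_antipode_dual:
  assumes "\<beta> \<in> carrier A" "b \<in> carrier B"
  shows "ev (inv_antipode A \<beta>) b = ev \<beta> (inv_antipode B b)"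
  using ev_antipode_dual[of "inv_antipode B b" "inv_antipode A \<beta>"] assms by simp

text \<open>On points of \<open>B\<close> this is the reversal of products by the inverse antipode;
  as a statement on the dual it says that coproducts are reversed.\<close>

lemma csum_dual_inv_antipode:
  assumes "kspace X" "\<mu> \<in> carrier A"
    "\<And>u. u \<in> carrier A \<Longrightarrow> linear_on A X (\<phi> u)"
    "\<And>v. v \<in> carrier A \<Longrightarrow> linear_on A X (\<lambda>u. \<phi> u v)"
  shows "csum A (inv_antipode A \<mu>) \<phi> = csum A \<mu> (\<lambda>\<mu>1 \<mu>2. \<phi> (inv_antipode A \<mu>2) (inv_antipode A \<mu>1))"
proof -
  let ?S = "inv_antipode A" and ?T = "tensor_space A A"
  let ?t = "csum A \<mu> (\<lambda>\<mu>1 \<mu>2. tens A A (?S \<mu>2) (?S \<mu>1))"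
  have t: "comult A (?S \<mu>) = ?t"
  proof (rule dual_tensor_eqI)
    fix a b assume ab: "a \<in> carrier B" "b \<in> carrier B"
    have G: "linear_on ?T scalars (\<lambda>t. tsum A A t (\<lambda>x y. ev x a * ev y b))" by simp
    have "tsum A A ?t (\<lambda>x y. ev x a * ev y b)
        = csum A \<mu> (\<lambda>x y. ev x (inv_antipode B b) * ev y (inv_antipode B a))"
      using assms(2) ab
        by (simp add: A.linear_on_csum[OF _ G] tsum_tens[where U=scalars] ev_inv_antipode_dual
          mult.commute cong: A.csum_cong)
    then show "tsum A A (comult A (?S \<mu>)) (\<lambda>x y. ev x a * ev y b)
        = tsum A A ?t (\<lambda>x y. ev x a * ev y b)"
      using assms(2) ab dual_comult(2)[of "?S \<mu>" a b]
      by (simp add: csum_def[of A "?S \<mu>"] ev_inv_antipode_dual inv_antipode_mult dual_comult(2))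
  qed (use assms(2) in auto)
  have L: "linear_on ?T X (\<lambda>t. tsum A A t \<phi>)" using assms by simp
  show ?thesis
    unfolding csum_def[of A "?S \<mu>"] t using assms
    by (simp add: A.linear_on_csum[OF _ L] tsum_tens[where U=X] cong: A.csum_cong)
qed

lemma lreg_eq:
  assumes "b \<in> carrier B" "\<beta> \<in> carrier A"
  shows "lreg B b \<beta> = csum A \<beta> (\<lambda>\<beta>1 \<beta>2. fscale (ev \<beta>2 b) \<beta>1)"
  unfolding lreg_def
proof (rule A.cop2_eq_csum[where U="dual B"])
  show "fscale (\<beta>2 b) \<beta>1 = fscale (ev \<beta>2 b) \<beta>1" for \<beta>1 \<beta>2 by (simp add: ev_def)
qed (use assms in auto)

lemma rreg_eq:
  assumes "b \<in> carrier B" "\<beta> \<in> carrier A"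
  shows "rreg B \<beta> b = csum A \<beta> (\<lambda>\<beta>1 \<beta>2. fscale (ev \<beta>1 b) \<beta>2)"
  unfolding rreg_def
proof (rule A.cop2_eq_csum[where U="dual B"])
  show "fscale (\<beta>1 b) \<beta>2 = fscale (ev \<beta>1 b) \<beta>2" for \<beta>1 \<beta>2 by (simp add: ev_def)
qed (use assms in auto)

lemma rcoreg_eq:
  assumes "b \<in> carrier B" "\<mu> \<in> carrier A"
  shows "rcoreg B b \<mu> = csum B b (\<lambda>b1 b2. scale B (ev \<mu> b1) b2)"
  unfolding rcoreg_def
proof (rule cop2_eq_csum[where U=B])
  show "scale B (\<mu> b1) b2 = scale B (ev \<mu> b1) b2" for b1 b2 by (simp add: ev_def)
qed (use assms in auto)

lemma reg_closed [simp]: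
  "b \<in> carrier B \<Longrightarrow> \<beta> \<in> carrier A \<Longrightarrow> lreg B b \<beta> \<in> carrier A"
  "b \<in> carrier B \<Longrightarrow> \<beta> \<in> carrier A \<Longrightarrow> rreg B \<beta> b \<in> carrier A"
  "b \<in> carrier B \<Longrightarrow> \<beta> \<in> carrier A \<Longrightarrow> rcoreg B b \<beta> \<in> carrier B"
  by (simp_all add: lreg_eq rreg_eq rcoreg_eq)

lemma ev_fscale: "ev (fscale c \<beta>) b = c * ev \<beta> b"
  by (simp add: ev_def fscale_def)

lemma ev_reg [simp]:
  assumes "b \<in> carrier B" "x \<in> carrier B" "\<beta> \<in> carrier A"
  shows "ev (lreg B b \<beta>) x = ev \<beta> (x \<cdot> b)" "ev (rreg B \<beta> b) x = ev \<beta> (b \<cdot> x)"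
  using assms dual_comult(2)[of \<beta> x b] dual_comult(2)[of \<beta> b x]
  by (simp_all add: lreg_eq rreg_eq ev_csum_dual ev_fscale mult.commute)

lemma linear_on_lreg [simp]:
  assumes "kspace U"
  shows "\<beta> \<in> carrier A \<Longrightarrow> linear_on U B g \<Longrightarrow> linear_on U A (\<lambda>x. lreg B (g x) \<beta>)"
    "b \<in> carrier B \<Longrightarrow> linear_on U A h \<Longrightarrow> linear_on U A (\<lambda>x. lreg B b (h x))"
proof -
  show "linear_on U A (\<lambda>x. lreg B (g x) \<beta>)" if "\<beta> \<in> carrier A" "linear_on U B g"
    using assms that linear_onD(1)[OF that(2)]
    by (intro linear_into_dual) (auto cong: linear_on_cong)
  show "linear_on U A (\<lambda>x. lreg B b (h x))" if "b \<in> carrier B" "linear_on U A h"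
    using assms that linear_onD(1)[OF that(2)]
    by (intro linear_into_dual) (auto cong: linear_on_cong)
qed

lemma linear_on_rreg [simp]:
  assumes "kspace U"
  shows "\<beta> \<in> carrier A \<Longrightarrow> linear_on U B g \<Longrightarrow> linear_on U A (\<lambda>x. rreg B \<beta> (g x))"
    "b \<in> carrier B \<Longrightarrow> linear_on U A h \<Longrightarrow> linear_on U A (\<lambda>x. rreg B (h x) b)"
proof -
  show "linear_on U A (\<lambda>x. rreg B \<beta> (g x))" if "\<beta> \<in> carrier A" "linear_on U B g"
    using assms that linear_onD(1)[OF that(2)]
    by (intro linear_into_dual) (auto cong: linear_on_cong)
  show "linear_on U A (\<lambda>x. rreg B (h x) b)" if "b \<in> carrier B" "linear_on U A h"
    using assms that linear_onD(1)[OF that(2)]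
    by (intro linear_into_dual) (auto cong: linear_on_cong)
qed

lemma linear_on_rcoreg [simp]:
  assumes "kspace U"
  shows "\<mu> \<in> carrier A \<Longrightarrow> linear_on U B g \<Longrightarrow> linear_on U B (\<lambda>x. rcoreg B (g x) \<mu>)"
    "b \<in> carrier B \<Longrightarrow> linear_on U A h \<Longrightarrow> linear_on U B (\<lambda>x. rcoreg B b (h x))"
proof -
  show "linear_on U B (\<lambda>x. rcoreg B (g x) \<mu>)" if "\<mu> \<in> carrier A" "linear_on U B g"
    using assms that linear_onD(1)[OF that(2)]
    by (simp add: rcoreg_eq cong: linear_on_cong)
  show "linear_on U B (\<lambda>x. rcoreg B b (h x))" if "b \<in> carrier B" "linear_on U A h"
    using assms that linear_onD(1)[OF that(2)]
    by (simp add: rcoreg_eq cong: linear_on_cong)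
qed

lemma lreg_unit [simp]: "\<beta> \<in> carrier A \<Longrightarrow> lreg B \<one> \<beta> = \<beta>"
  by (rule dual_eqI) auto

lemma lreg_one: "b \<in> carrier B \<Longrightarrow> lreg B b \<epsilon> = fscale (counit B b) \<epsilon>"
  by (rule dual_eqI) (auto simp: ev_unit_dual ev_fscale counit_mult)

lemma lreg_lreg:
  "\<lbrakk>a \<in> carrier B; b \<in> carrier B; \<beta> \<in> carrier A\<rbrakk> \<Longrightarrow> lreg B (a \<cdot> b) \<beta> = lreg B a (lreg B b \<beta>)"
  by (rule dual_eqI) (auto simp: mult_assoc)

text \<open>This property, that the dual is a \<open>B\<close>-module algebra, is what makes the
  smash product associative.\<close>

lemma lreg_mult:
  assumes "b \<in> carrier B" "\<beta> \<in> carrier A" "\<gamma> \<in> carrier A"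
  shows "lreg B b (\<beta> \<star> \<gamma>) = csum B b (\<lambda>b1 b2. lreg B b1 \<beta> \<star> lreg B b2 \<gamma>)"
proof (rule dual_eqI)
  fix x assume x: "x \<in> carrier B"
  have evl: "linear_on A scalars (\<lambda>\<beta>. ev \<beta> x)" by simp
  have "ev (lreg B b (\<beta> \<star> \<gamma>)) x = csum B (x \<cdot> b) (\<lambda>u v. ev \<beta> u * ev \<gamma> v)"
    using assms x by (simp add: ev_mult_dual)
  also have "\<dots> = csum B x (\<lambda>x1 x2. csum B b (\<lambda>b1 b2. ev \<beta> (x1 \<cdot> b1) * ev \<gamma> (x2 \<cdot> b2)))"
    using assms x by (intro csum_mult[where X=scalars]) auto
  also have "\<dots> = csum B b (\<lambda>b1 b2. csum B x (\<lambda>x1 x2. ev \<beta> (x1 \<cdot> b1) * ev \<gamma> (x2 \<cdot> b2)))"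
    by (rule csum_swap)
  also have "\<dots> = ev (csum B b (\<lambda>b1 b2. lreg B b1 \<beta> \<star> lreg B b2 \<gamma>)) x"
    using assms x by (simp add: linear_on_csum[OF _ evl] ev_mult_dual cong: csum_cong)
  finally show "ev (lreg B b (\<beta> \<star> \<gamma>)) x = ev (csum B b (\<lambda>b1 b2. lreg B b1 \<beta> \<star> lreg B b2 \<gamma>)) x" .
qed (use assms in auto)

text \<open>The functional b \<rightharpoonup> \<beta> evaluates \<beta> after multiplication by b
  on the right, so only the second component of its coproduct feels b.\<close>

lemma csum_lreg:
  assumes "kspace X" "b \<in> carrier B" "\<beta> \<in> carrier A"
    "\<And>u. u \<in> carrier A \<Longrightarrow> linear_on A X (\<phi> u)"
    "\<And>v. v \<in> carrier A \<Longrightarrow> linear_on A X (\<lambda>u. \<phi> u v)"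
  shows "csum A (lreg B b \<beta>) \<phi> = csum A \<beta> (\<lambda>\<beta>1 \<beta>2. \<phi> \<beta>1 (lreg B b \<beta>2))"
proof -
  let ?T = "tensor_space A A"
  let ?t = "csum A \<beta> (\<lambda>\<beta>1 \<beta>2. tens A A \<beta>1 (lreg B b \<beta>2))"
  have t: "comult A (lreg B b \<beta>) = ?t"
  proof (rule dual_tensor_eqI)
    fix x y assume xy: "x \<in> carrier B" "y \<in> carrier B"
    have G: "linear_on ?T scalars (\<lambda>t. tsum A A t (\<lambda>u v. ev u x * ev v y))" by simp
    have "tsum A A ?t (\<lambda>u v. ev u x * ev v y) = csum A \<beta> (\<lambda>u v. ev u x * ev v (y \<cdot> b))"
      using assms(2,3) xy
        by (simp add: A.linear_on_csum[OF _ G] tsum_tens[where U=scalars] cong: A.csum_cong)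
    then show "tsum A A (comult A (lreg B b \<beta>)) (\<lambda>u v. ev u x * ev v y)
        = tsum A A ?t (\<lambda>u v. ev u x * ev v y)"
      using assms(2,3) xy dual_comult(2)[of "lreg B b \<beta>" x y]
      by (simp add: csum_def[of A "lreg B b \<beta>"] dual_comult(2) mult_assoc)
  qed (use assms(2,3) in auto)
  have L: "linear_on ?T X (\<lambda>t. tsum A A t \<phi>)" using assms by simp
  show ?thesis
    unfolding csum_def[of A "lreg B b \<beta>"] t using assms
    by (simp add: A.linear_on_csum[OF _ L] tsum_tens[where U=X] cong: A.csum_cong)
qed

text \<open>Evaluated at \<open>x\<close> and \<open>y\<close>, this is
  \<open>\<langle>\<beta>, y b'' S\<^sup>-\<^sup>1(b') x\<rangle> = \<epsilon>(b) \<langle>\<beta>, y x\<rangle>\<close>.\<close>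

lemma csum_lreg_rreg_cancel:
  assumes "kspace X" "b \<in> carrier B" "\<beta> \<in> carrier A"
    "\<And>u. u \<in> carrier A \<Longrightarrow> linear_on A X (\<phi> u)"
    "\<And>v. v \<in> carrier A \<Longrightarrow> linear_on A X (\<lambda>u. \<phi> u v)"
  shows "csum B b (\<lambda>b1 b2. csum A \<beta> (\<lambda>\<beta>1 \<beta>2. \<phi> (lreg B b2 \<beta>1) (rreg B \<beta>2 (inv_antipode B b1))))
    = scale X (counit B b) (csum A \<beta> \<phi>)"
proof -
  let ?T = "tensor_space A A"
  let ?t
    = "csum B b (\<lambda>b1 b2. csum A \<beta> (\<lambda>\<beta>1 \<beta>2.
        tens A A (lreg B b2 \<beta>1) (rreg B \<beta>2 (inv_antipode B b1))))"
  have t: "?t = fscale (counit B b) (comult A \<beta>)"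
  proof (rule dual_tensor_eqI)
    show "fscale (counit B b) (comult A \<beta>) \<in> carrier ?T"
      using kspace_closed(3)[OF kspace_tensor_space, of "comult A \<beta>" A A] assms(3) by simp
    fix y x assume xy: "y \<in> carrier B" "x \<in> carrier B"
    have G: "linear_on ?T scalars (\<lambda>t. tsum A A t (\<lambda>u v. ev u y * ev v x))" by simp
    have "tsum A A ?t (\<lambda>u v. ev u y * ev v x)
        = csum B b (\<lambda>b1 b2. csum A \<beta> (\<lambda>u v. ev u (y \<cdot> b2) * ev v (inv_antipode B b1 \<cdot> x)))"
      using assms(2,3) xy
        by (simp add: A.linear_on_csum[OF _ G] linear_on_csum[OF _ G] tsum_tens[where U=scalars]
          cong: csum_congs)
    also have "\<dots> = csum B b (\<lambda>b1 b2. ev \<beta> (y \<cdot> (b2 \<cdot> inv_antipode B b1) \<cdot> x))"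
      using assms(2,3) xy by (simp add: dual_comult(2) mult_assoc cong: csum_congs)
    also have "\<dots> = counit B b * ev \<beta> (y \<cdot> x)"
      using assms(2,3) xy csum_inv_antipode(2)[of scalars "\<lambda>u. ev \<beta> (y \<cdot> u \<cdot> x)" b] by simp
    also have "\<dots> = tsum A A (fscale (counit B b) (comult A \<beta>)) (\<lambda>u v. ev u y * ev v x)"
      using assms(3) xy dual_comult(2)[of \<beta> y x] linear_onD(3)[OF G, of "comult A \<beta>"]
        by (simp add: csum_def)
    finally show "tsum A A ?t (\<lambda>u v. ev u y * ev v x)
      = tsum A A (fscale (counit B b) (comult A \<beta>)) (\<lambda>u v. ev u y * ev v x)" .
  qed (use assms(2,3) in auto)
  have L: "linear_on ?T X (\<lambda>t. tsum A A t \<phi>)" using assms by simp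
  have "csum B b (\<lambda>b1 b2. csum A \<beta> (\<lambda>\<beta>1 \<beta>2. \<phi> (lreg B b2 \<beta>1) (rreg B \<beta>2 (inv_antipode B b1))))
    = tsum A A ?t \<phi>"
    using assms
      by (simp add: A.linear_on_csum[OF _ L] linear_on_csum[OF _ L] tsum_tens[where U=X] cong:
        csum_congs)
  then show ?thesis
    unfolding t using linear_onD(3)[OF L, of "comult A \<beta>"] assms(3) by (simp add: csum_def)
qed

section \<open>The Heisenberg double and the Drinfeld double\<close>

abbreviation (input) T where "T \<equiv> tensor_space A B"
abbreviation (input) t where "t \<equiv> tens A B"
abbreviation (input) H where "H \<equiv> heisenberg_double B"
abbreviation (input) D where "D \<equiv> drinfeld_double B"
abbreviation (input) heis_mult (infixl "\<bullet>" 70)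
  where "x \<bullet> y \<equiv> x \<cdot>\<^bsub>heisenberg_double B\<^esub> y"
abbreviation (input) drin_mult (infixl "\<diamondop>" 70)
  where "x \<diamondop> y \<equiv> x \<cdot>\<^bsub>drinfeld_double B\<^esub> y"

section \<open>Products of the two doubles on pure tensors\<close>

lemma double_simps [simp]:
  "carrier H = carrier T" "scale H = fscale" "\<one>\<^bsub>H\<^esub> = t \<epsilon> \<one>"
  "carrier D = carrier T" "scale D = fscale" "\<one>\<^bsub>D\<^esub> = t \<epsilon> \<one>"
  by (simp_all add: heisenberg_double_def drinfeld_double_def Let_def)

lemma kspace_double [simp]: "kspace H" "kspace D"
  using kspace_same_space[of H T] kspace_same_space[of D T] by simp_all

lemma heis_mult_eq:
  assumes "x \<in> carrier T" "y \<in> carrier T"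
  shows "x \<bullet> y = tsum A B x (\<lambda>\<alpha> a. tsum A B y (\<lambda>\<beta> b.
    csum B a (\<lambda>a1 a2. t (\<alpha> \<star> lreg B a1 \<beta>) (a2 \<cdot> b))))"
  unfolding heisenberg_double_def Let_def algebra.simps
  by (intro sweedler_eq_tsum[where U=T])
    (use assms in \<open>auto intro!: sweedler_eq_tsum[where U=T] cop2_eq_csum[where U=T]\<close>)

lemma drin_mult_eq:
  assumes "x \<in> carrier T" "y \<in> carrier T"
  shows "x \<diamondop> y = tsum A B x (\<lambda>\<mu> m. tsum A B y (\<lambda>\<nu> n.
    csum B m (\<lambda>m1 d. csum B d (\<lambda>m2 m3.
      t (\<mu> \<star> rreg B (lreg B m1 \<nu>) (inv_antipode B m3)) (m2 \<cdot> n)))))"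
  unfolding drinfeld_double_def Let_def algebra.simps
  by (intro sweedler_eq_tsum[where U=T])
    (use assms in \<open>auto intro!: sweedler_eq_tsum[where U=T] cop3_eq_csum[where U=T]\<close>)

lemma drin_comult_eq:
  assumes "x \<in> carrier T"
  shows "comult D x = tsum A B x (\<lambda>\<mu> m. csum A \<mu> (\<lambda>\<mu>1 \<mu>2. csum B m (\<lambda>m1 m2.
    tens T T (t \<mu>2 m1) (t \<mu>1 m2))))"
  unfolding drinfeld_double_def Let_def bialgebra.simps
  by (intro sweedler_eq_tsum[where U="tensor_space T T"])
    (use assms in \<open>auto intro!: A.cop2_eq_csum[where U="tensor_space T T"] cop2_eq_csum[where
      U="tensor_space T T"]\<close>)

lemma drin_counit_eq:
  assumes "x \<in> carrier T"
  shows "counit D x = tsum A B x (\<lambda>\<mu> m. ev \<mu> \<one> * counit B m)"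
  unfolding drinfeld_double_def Let_def bialgebra.simps
  by (intro sweedler_eq_tsum[where U=scalars]) (use assms in auto)

lemma heis_mult_closed [simp]: "x \<in> carrier T \<Longrightarrow> y \<in> carrier T \<Longrightarrow> x \<bullet> y \<in> carrier T"
  by (simp add: heis_mult_eq)

lemma drin_mult_closed [simp]: "x \<in> carrier T \<Longrightarrow> y \<in> carrier T \<Longrightarrow> x \<diamondop> y \<in> carrier T"
  by (simp add: drin_mult_eq)

lemma bilinear_heis_mult: "bilinear_on T T T (mult H)"
  by (rule bilinear_onI) (simp_all add: heis_mult_eq cong: linear_on_cong)

lemma bilinear_drin_mult: "bilinear_on T T T (mult D)"
  by (rule bilinear_onI) (simp_all add: drin_mult_eq cong: linear_on_cong)

lemma linear_on_heis_mult [simp]: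
  "a \<in> carrier T \<Longrightarrow> linear_on U T g \<Longrightarrow> linear_on U T (\<lambda>x. a \<bullet> g x)"
  "a \<in> carrier T \<Longrightarrow> linear_on U T g \<Longrightarrow> linear_on U T (\<lambda>x. g x \<bullet> a)"
  using bilinear_onD(1,2)[OF bilinear_heis_mult] by simp_all

lemma linear_on_drin_mult [simp]:
  "a \<in> carrier T \<Longrightarrow> linear_on U T g \<Longrightarrow> linear_on U T (\<lambda>x. a \<diamondop> g x)"
  "a \<in> carrier T \<Longrightarrow> linear_on U T g \<Longrightarrow> linear_on U T (\<lambda>x. g x \<diamondop> a)"
  using bilinear_onD(1,2)[OF bilinear_drin_mult] by simp_all

lemma heis_mult_tens:
  assumes "\<alpha> \<in> carrier A" "a \<in> carrier B" "\<beta> \<in> carrier A" "b \<in> carrier B"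
  shows "t \<alpha> a \<bullet> t \<beta> b = csum B a (\<lambda>a1 a2. t (\<alpha> \<star> lreg B a1 \<beta>) (a2 \<cdot> b))"
  using assms by (simp add: heis_mult_eq tsum_tens[where U=T])

lemma drin_mult_tens:
  assumes "\<mu> \<in> carrier A" "m \<in> carrier B" "\<nu> \<in> carrier A" "n \<in> carrier B"
  shows "t \<mu> m \<diamondop> t \<nu> n = csum B m (\<lambda>m1 d. csum B d (\<lambda>m2 m3.
      t (\<mu> \<star> rreg B (lreg B m1 \<nu>) (inv_antipode B m3)) (m2 \<cdot> n)))"
  using assms by (simp add: drin_mult_eq tsum_tens[where U=T])

lemma tens_fscale:
  "t (fscale c \<alpha>) b = fscale c (t \<alpha> b)" "t \<alpha> (scale B c b) = fscale c (t \<alpha> b)"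
  using tens_additive(3)[of A B c \<alpha> b] tens_additive(4)[of A B \<alpha> c b] by simp_all

lemma heis_mult_dual_tens:
  assumes "\<alpha> \<in> carrier A" "\<beta> \<in> carrier A" "b \<in> carrier B"
  shows "t \<alpha> \<one> \<bullet> t \<beta> b = t (\<alpha> \<star> \<beta>) b"
  using assms by (simp add: heis_mult_tens csum_unit[where X=T])

lemma heis_mult_tens_hopf:
  assumes "\<alpha> \<in> carrier A" "a \<in> carrier B" "b \<in> carrier B"
  shows "t \<alpha> a \<bullet> t \<epsilon> b = t \<alpha> (a \<cdot> b)"
  using assms csum_counit(1)[of T "\<lambda>x. t \<alpha> (x \<cdot> b)" a]
  by (simp add: heis_mult_tens lreg_one tens_fscale cong: csum_congs)

lemmas heis_mult_tens_unit = heis_mult_dual_tens heis_mult_tens_hopf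

lemma tens3_ext:
  assumes "\<And>y z. y \<in> carrier T \<Longrightarrow> z \<in> carrier T \<Longrightarrow> linear_on T X (\<lambda>x. f x y z)"
    "\<And>y z. y \<in> carrier T \<Longrightarrow> z \<in> carrier T \<Longrightarrow> linear_on T X (\<lambda>x. g x y z)"
    "\<And>x z. x \<in> carrier T \<Longrightarrow> z \<in> carrier T \<Longrightarrow> linear_on T X (\<lambda>y. f x y z)"
    "\<And>x z. x \<in> carrier T \<Longrightarrow> z \<in> carrier T \<Longrightarrow> linear_on T X (\<lambda>y. g x y z)"
    "\<And>x y. x \<in> carrier T \<Longrightarrow> y \<in> carrier T \<Longrightarrow> linear_on T X (f x y)"
    "\<And>x y. x \<in> carrier T \<Longrightarrow> y \<in> carrier T \<Longrightarrow> linear_on T X (g x y)"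
    "\<And>\<alpha> a \<beta> b \<gamma> c. \<lbrakk>\<alpha> \<in> carrier A; a \<in> carrier B; \<beta> \<in> carrier A; b \<in> carrier B; \<gamma> \<in> carrier A; c \<in>
        carrier B\<rbrakk>
      \<Longrightarrow> f (t \<alpha> a) (t \<beta> b) (t \<gamma> c) = g (t \<alpha> a) (t \<beta> b) (t \<gamma> c)"
    and xyz: "x \<in> carrier T" "y \<in> carrier T" "z \<in> carrier T"
  shows "f x y z = g x y z"
proof (rule tensor_ext[where X=X and f="\<lambda>x. f x y z" and g="\<lambda>x. g x y z"])
  fix \<alpha> a assume 1: "\<alpha> \<in> carrier A" "a \<in> carrier B"
  show "f (t \<alpha> a) y z = g (t \<alpha> a) y z"
  proof (rule tensor_ext[where X=X and f="\<lambda>y. f (t \<alpha> a) y z" and g="\<lambda>y. g (t \<alpha> a) y z"])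
    fix \<beta> b assume 2: "\<beta> \<in> carrier A" "b \<in> carrier B"
    show "f (t \<alpha> a) (t \<beta> b) z = g (t \<alpha> a) (t \<beta> b) z"
      by (rule tensor_ext[where X=X and f="f (t \<alpha> a) (t \<beta> b)" and g="g (t \<alpha> a) (t \<beta> b)"])
        (use assms 1 2 in auto)
  qed (use assms 1 in auto)
qed (use assms in auto)

text \<open>Both sides equal the sum of \<open>?\<phi>\<close> over three components of
  \<open>a\<close> and two of \<open>b\<close>. The left one uses multiplicativity of the coproduct
  on e b and the module law, the right one uses \<open>lreg_mult\<close>.\<close>

lemma heis_assoc_tens:
  assumes "\<alpha> \<in> carrier A" "a \<in> carrier B" "\<beta> \<in> carrier A" "b \<in> carrier B" "\<gamma> \<in> carrier A"
    "c \<in> carrier B"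
  shows "t \<alpha> a \<bullet> t \<beta> b \<bullet> t \<gamma> c = t \<alpha> a \<bullet> (t \<beta> b \<bullet> t \<gamma> c)"
proof -
  let ?\<phi> = "\<lambda>a1 a2 a3 b1 b2. t (\<alpha> \<star> (lreg B a1 \<beta> \<star> lreg B a2 (lreg B b1 \<gamma>))) (a3 \<cdot> (b2 \<cdot> c))"
  have lin: "linear_on T T (\<lambda>x. x \<bullet> t \<gamma> c)" "linear_on T T (\<lambda>x. t \<alpha> a \<bullet> x)"
    using assms by simp_all
  have "t \<alpha> a \<bullet> t \<beta> b \<bullet> t \<gamma> c
      = csum B a (\<lambda>a1 e. csum B (e \<cdot> b) (\<lambda>u v. t (\<alpha> \<star> lreg B a1 \<beta> \<star> lreg B u \<gamma>) (v \<cdot> c)))"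
    using assms
      by (simp add: heis_mult_tens[of _ a] linear_on_csum[OF _ lin(1)] heis_mult_tens cong:
        csum_congs)
  also have "\<dots> = csum B a (\<lambda>a1 e. csum B e (\<lambda>a2 a3. csum B b (\<lambda>b1 b2. ?\<phi> a1 a2 a3 b1 b2)))"
    using assms
      by (simp add: csum_mult[where X=T] A.mult_assoc mult_assoc lreg_lreg cong: csum_congs)
  also have "\<dots> = csum B a (\<lambda>d a3. csum B d (\<lambda>a1 a2. csum B b (\<lambda>b1 b2. ?\<phi> a1 a2 a3 b1 b2)))"
    using assms by (intro csum_coassoc[where X=T, symmetric]) auto
  also have "\<dots> = csum B a (\<lambda>d a3. csum B b (\<lambda>b1 b2. csum B d (\<lambda>a1 a2. ?\<phi> a1 a2 a3 b1 b2)))"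
    by (subst (2) csum_swap) (rule refl)
  also have "\<dots> = csum B b (\<lambda>b1 b2. csum B a (\<lambda>d a3. csum B d (\<lambda>a1 a2. ?\<phi> a1 a2 a3 b1 b2)))"
    by (rule csum_swap)
  also have "\<dots>
      = csum B b (\<lambda>b1 b2. csum B a (\<lambda>d a3. t (\<alpha> \<star> lreg B d (\<beta> \<star> lreg B b1 \<gamma>)) (a3 \<cdot> (b2 \<cdot> c))))"
  proof -
    have "csum B d (\<lambda>a1 a2. ?\<phi> a1 a2 a3 b1 b2) = t (\<alpha> \<star> lreg B d (\<beta> \<star> lreg B b1 \<gamma>)) (a3 \<cdot> (b2 \<cdot> c))"
      if "d \<in> carrier B" "a3 \<in> carrier B" "b1 \<in> carrier B" "b2 \<in> carrier B" for d a3 b1 b2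
    proof -
      have "linear_on A T (\<lambda>x. t (\<alpha> \<star> x) (a3 \<cdot> (b2 \<cdot> c)))" using that assms by simp
      from linear_on_csum[OF _ this] show ?thesis using that assms by (simp add: lreg_mult)
    qed
    then show ?thesis using assms by (simp cong: csum_congs)
  qed
  also have "\<dots> = t \<alpha> a \<bullet> (t \<beta> b \<bullet> t \<gamma> c)"
    using assms
      by (simp add: heis_mult_tens[of _ b] linear_on_csum[OF _ lin(2)] heis_mult_tens cong:
        csum_congs)
  finally show ?thesis .
qed

lemma kalgebra_heis: "kalgebra H"
proof (intro kalgebra.intro kspace_double kalgebra_axioms.intro)
  show "bilinear_on H H H (mult H)"
    using bilinear_heis_mult by (simp add: bilinear_on_def linear_on_def)
  show "\<one>\<^bsub>H\<^esub> \<in> carrier H" by simp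
  show "x \<bullet> y \<bullet> z = x \<bullet> (y \<bullet> z)" if "x \<in> carrier H" "y \<in> carrier H" "z \<in> carrier H" for x y z
    by (rule tens3_ext[where f="\<lambda>x y z. x \<bullet> y \<bullet> z" and g="\<lambda>x y z. x \<bullet> (y \<bullet> z)" and X=T])
      (use that heis_assoc_tens in auto)
  fix x assume x: "x \<in> carrier H"
  show "\<one>\<^bsub>H\<^esub> \<bullet> x = x"
    by (rule tensor_ext[where f="\<lambda>x. \<one>\<^bsub>H\<^esub> \<bullet> x" and g="\<lambda>x. x" and X=T])
      (use x in \<open>auto simp: heis_mult_tens_unit\<close>)
  show "x \<bullet> \<one>\<^bsub>H\<^esub> = x"
    by (rule tensor_ext[where f="\<lambda>x. x \<bullet> \<one>\<^bsub>H\<^esub>" and g="\<lambda>x. x" and X=T])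
      (use x in \<open>auto simp: heis_mult_tens_unit\<close>)
qed

interpretation H: kalgebra "heisenberg_double B" by (rule kalgebra_heis)

text \<open>Both doubles are records over the space \<open>T\<close>. Rewriting statements about
  linearity and tensors to \<open>T\<close> makes one set of rules suffice for all three.\<close>

lemma linear_from_double [simp]: "linear_on D V f = linear_on T V f" "linear_on H V f
    = linear_on T V f"
  by (simp_all add: linear_on_def)

lemma linear_to_double [simp]: "linear_on V D f = linear_on V T f" "linear_on V H f
    = linear_on V T f"
  by (simp_all add: linear_on_def)

lemma tens_double_left:
  "tens D V = tens T V" "tensor_space D V = tensor_space T V" "sweedler D V = sweedler T V"
    "tsum D V = tsum T V"
  using tensor_same_space[of D T V V] tsum_same_space[of D T V V] by simp_all

lemma tens_double_right:
  "tens V D = tens V T" "tensor_space V D = tensor_space V T" "sweedler V D = sweedler V T"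
    "tsum V D = tsum V T"
  "tens V H = tens V T" "tensor_space V H = tensor_space V T" "sweedler V H = sweedler V T"
    "tsum V H = tsum V T"
  using tensor_same_space[of V V D T] tsum_same_space[of V V D T]
    tensor_same_space[of V V H T] tsum_same_space[of V V H T] by simp_all

lemmas [simp] = tens_double_left tens_double_right

section \<open>The coalgebra of the Drinfeld double\<close>

lemma drin_comult_tens:
  assumes "\<mu> \<in> carrier A" "m \<in> carrier B"
  shows "comult D (t \<mu> m) = csum A \<mu> (\<lambda>\<mu>1 \<mu>2. csum B m (\<lambda>m1 m2. tens T T (t \<mu>2 m1) (t \<mu>1 m2)))"
  using assms by (simp add: drin_comult_eq tsum_tens[where U="tensor_space T T"])

lemma drin_comult_linear: "linear_on T (tensor_space T T) (comult D)"
  by (simp add: drin_comult_eq cong: linear_on_cong)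

lemma drin_comult_closed: "x \<in> carrier T \<Longrightarrow> comult D x \<in> carrier (tensor_space T T)"
  by (rule linear_onD(1)[OF drin_comult_linear])

lemma csum_drin_tens:
  assumes "kspace X" "\<mu> \<in> carrier A" "m \<in> carrier B"
    "\<And>u. u \<in> carrier T \<Longrightarrow> linear_on T X (\<phi> u)"
    "\<And>v. v \<in> carrier T \<Longrightarrow> linear_on T X (\<lambda>u. \<phi> u v)"
  shows "csum D (t \<mu> m) \<phi> = csum A \<mu> (\<lambda>\<mu>1 \<mu>2. csum B m (\<lambda>m1 m2. \<phi> (t \<mu>2 m1) (t \<mu>1 m2)))"
proof -
  have L: "linear_on (tensor_space T T) X (\<lambda>t. tsum T T t \<phi>)" using assms by simp
  show ?thesis
    using assms unfolding csum_def[of D]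
    by (simp add: drin_comult_tens A.linear_on_csum[OF _ L] linear_on_csum[OF _ L] tsum_tens[where
      U=X] cong: csum_congs)
qed

text \<open>Stands in for \<open>cop2_eq_csum\<close>, whose locale asks for the coalgebra structure
  about to be proved.\<close>

lemma drin_cop2_csum:
  assumes "c \<in> carrier T" "\<And>v w. v \<in> carrier T \<Longrightarrow> w \<in> carrier T \<Longrightarrow> \<phi> v w = \<psi> v w"
    "\<And>v. v \<in> carrier T \<Longrightarrow> linear_on T U (\<psi> v)"
    "\<And>w. w \<in> carrier T \<Longrightarrow> linear_on T U (\<lambda>v. \<psi> v w)"
  shows "cop2 D c \<phi> = csum D c \<psi>"
  unfolding cop2_def csum_def tens_double_left tens_double_right
  using assms drin_comult_closed by (intro sweedler_eq_tsum[where U=U]) auto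

text \<open>The sums over the dual and over \<open>B\<close> are independent, so the laws hold
  factor by factor. Since the coproduct is opposite on the dual, coassociativity is used in opposite
  directions in the two factors.\<close>

lemma kcoalgebra_drin: "kcoalgebra D"
proof (intro kcoalgebra.intro kspace_double kcoalgebra_axioms.intro)
  let ?T2 = "tensor_space T T" and ?T3 = "tensor_space T (tensor_space T T)"
  note [simp] = drin_comult_closed
  have lin [simp]: "linear_on U T g \<Longrightarrow> linear_on U ?T2 (\<lambda>x. comult D (g x))"
    for U :: "('k, 'c::ab_group_add, 'd) vspace_scheme" and g
    by (rule linear_on_compose[OF drin_comult_linear])
  have csum_arg [simp]: "linear_on U X (\<lambda>x. csum D (g x) \<phi>)"
    if "kspace X" "linear_on U T g" "\<And>u. u \<in> carrier T \<Longrightarrow> linear_on T X (\<phi> u)"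
      "\<And>v. v \<in> carrier T \<Longrightarrow> linear_on T X (\<lambda>u. \<phi> u v)"
    for U :: "('k, 'c::ab_group_add, 'd) vspace_scheme" and g
      and X :: "('k, 'e::ab_group_add, 'f) vspace_scheme" and \<phi>
    using that by (simp add: csum_def)
  have csum_param [simp]: "linear_on U X (\<lambda>x. csum D c (\<phi> x))"
    if "kspace X" "kspace U" "c \<in> carrier T"
      "\<And>u v. u \<in> carrier T \<Longrightarrow> v \<in> carrier T \<Longrightarrow> linear_on U X (\<lambda>x. \<phi> x u v)"
    for U :: "('k, 'c::ab_group_add, 'd) vspace_scheme" and c
      and X :: "('k, 'e::ab_group_add, 'f) vspace_scheme" and \<phi>
    using that by (simp add: csum_def)
  show "linear_on D (tensor_space D D) (comult D)" using drin_comult_linear by simp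
  show "linear_on D scalars (counit D)"
    by (simp add: drin_counit_eq cong: linear_on_cong)
  fix c assume "c \<in> carrier D"
  then have c: "c \<in> carrier T" by simp
  have "cop2 D c (\<lambda>d z. cop2 D d (\<lambda>x y. tens T ?T2 x (tens T T y z)))
      = csum D c (\<lambda>d z. csum D d (\<lambda>x y. tens T ?T2 x (tens T T y z)))"
    using c by (intro drin_cop2_csum[where U="?T3"]) (auto intro!: drin_cop2_csum[where U="?T3"])
  also have "\<dots> = csum D c (\<lambda>x d. tens T ?T2 x (comult D d))"
  proof (rule tensor_ext[where X="?T3" and f="\<lambda>c. csum D c (\<lambda>d z. csum D d (\<lambda>x y.
      tens T ?T2 x (tens T T y z)))"
        and g="\<lambda>c. csum D c (\<lambda>x d. tens T ?T2 x (comult D d))"])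
    fix \<mu> m assume \<mu>m: "\<mu> \<in> carrier A" "m \<in> carrier B"
    let ?\<phi> = "\<lambda>\<mu>1 \<mu>2 \<mu>3 m1 m2 m3. tens T ?T2 (t \<mu>3 m1) (tens T T (t \<mu>2 m2) (t \<mu>1 m3))"
    have "csum D (t \<mu> m) (\<lambda>d z. csum D d (\<lambda>x y. tens T ?T2 x (tens T T y z)))
        = csum A \<mu> (\<lambda>\<mu>1 d. csum B m (\<lambda>e m3. csum A d (\<lambda>\<mu>2 \<mu>3. csum B e (\<lambda>m1 m2.
          ?\<phi> \<mu>1 \<mu>2 \<mu>3 m1 m2 m3))))"
      using \<mu>m by (simp add: csum_drin_tens[where X="?T3"] cong: csum_congs)
    also have "\<dots>
        = csum A \<mu> (\<lambda>\<mu>1 d. csum A d (\<lambda>\<mu>2 \<mu>3. csum B m (\<lambda>e m3. csum B e (\<lambda>m1 m2.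
          ?\<phi> \<mu>1 \<mu>2 \<mu>3 m1 m2 m3))))"
      \<comment> \<open>Fixing both coalgebras directs the exchange: sums over \<open>B\<close> move
        inside sums over the dual, and both sides reach the same order.\<close>
      by (simp only: csum_swap[where C=B and D="dual B"])
    also have "\<dots>
        = csum A \<mu> (\<lambda>d \<mu>3. csum A d (\<lambda>\<mu>1 \<mu>2. csum B m (\<lambda>e m3. csum B e (\<lambda>m1 m2.
          ?\<phi> \<mu>1 \<mu>2 \<mu>3 m1 m2 m3))))"
      using \<mu>m by (intro A.csum_coassoc[where X="?T3", symmetric]) auto
    also have "\<dots>
        = csum A \<mu> (\<lambda>d \<mu>3. csum A d (\<lambda>\<mu>1 \<mu>2. csum B m (\<lambda>m1 e. csum B e (\<lambda>m2 m3.
          ?\<phi> \<mu>1 \<mu>2 \<mu>3 m1 m2 m3))))"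
      using \<mu>m by (intro A.csum_cong refl csum_coassoc[where X="?T3"]) auto
    also have "\<dots>
        = csum A \<mu> (\<lambda>d \<mu>3. csum B m (\<lambda>m1 e. csum A d (\<lambda>\<mu>1 \<mu>2. csum B e (\<lambda>m2 m3.
          ?\<phi> \<mu>1 \<mu>2 \<mu>3 m1 m2 m3))))"
      by (simp only: csum_swap[where C=B and D="dual B"])
    also have "\<dots> = csum D (t \<mu> m) (\<lambda>x d. tens T ?T2 x (comult D d))"
    proof -
      have L: "linear_on ?T2 ?T3 (tens T ?T2 x)" if "x \<in> carrier T" for x using that by simp
      have "tens T ?T2 x (comult D (t \<nu> n))
          = csum A \<nu> (\<lambda>\<mu>1 \<mu>2. csum B n (\<lambda>m2 m3. tens T ?T2 x (tens T T (t \<mu>2 m2) (t \<mu>1 m3))))"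
        if "x \<in> carrier T" "\<nu> \<in> carrier A" "n \<in> carrier B" for x \<nu> n
        using that
          by (simp add: drin_comult_tens A.linear_on_csum[OF _ L] linear_on_csum[OF _ L] cong:
            csum_congs)
      then show ?thesis
        using \<mu>m by (simp add: csum_drin_tens[where X="?T3"] cong: csum_congs)
    qed
    finally show "csum D (t \<mu> m) (\<lambda>d z. csum D d (\<lambda>x y. tens T ?T2 x (tens T T y z)))
      = csum D (t \<mu> m) (\<lambda>x d. tens T ?T2 x (comult D d))" .
  qed (use c in auto)
  also have "\<dots> = cop2 D c (\<lambda>x d. tens T ?T2 x (comult D d))"
    using c by (intro drin_cop2_csum[where U="?T3", symmetric]) auto
  finally show "cop2 D c (\<lambda>d z. cop2 D d (\<lambda>x y. tens D (tensor_space D D) x (tens D D y z)))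
    = cop2 D c (\<lambda>x d. tens D (tensor_space D D) x (comult D d))" by simp
  have [simp]: "linear_on U T g \<Longrightarrow> linear_on U scalars (\<lambda>x. counit D (g x))"
    for U :: "('k, 'c::ab_group_add, 'd) vspace_scheme" and g
    by (rule linear_on_compose[of T]) (simp add: drin_counit_eq cong: linear_on_cong)
  have counit: "counit D (t \<mu> m) = ev \<mu> \<one> * counit B m" if "\<mu> \<in> carrier A" "m \<in> carrier B" for \<mu> m
    using that by (simp add: drin_counit_eq tsum_tens[where U=scalars])
  have fs: "fscale (a * b) x = fscale a (fscale b x)" for a b :: 'k and x :: "_ \<Rightarrow> 'k"
    by (simp add: fscale_def mult.assoc)
  show "cop2 D c (\<lambda>x y. scale D (counit D x) y) = c"
  proof -
    have "cop2 D c (\<lambda>x y. scale D (counit D x) y) = csum D c (\<lambda>x y. fscale (counit D x) y)"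
      using c by (intro drin_cop2_csum[where U=T]) auto
    also have "\<dots> = c"
    proof (rule tensor_ext[where X=T and f="\<lambda>c. csum D c (\<lambda>x y. fscale (counit D x) y)" and g="\<lambda>c.
        c"])
      fix \<mu> m assume \<mu>m: "\<mu> \<in> carrier A" "m \<in> carrier B"
      have "csum D (t \<mu> m) (\<lambda>x y. fscale (counit D x) y)
          = csum A \<mu> (\<lambda>\<mu>1 \<mu>2. csum B m (\<lambda>m1 m2. fscale (counit B m1) (fscale (ev \<mu>2 \<one>) (t \<mu>1 m2))))"
        using \<mu>m by (simp add: csum_drin_tens[where X=T] counit mult.commute fs cong: csum_congs)
      also have "\<dots> = csum A \<mu> (\<lambda>\<mu>1 \<mu>2. fscale (ev \<mu>2 \<one>) (t \<mu>1 m))"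
        using \<mu>m csum_counit(1)[of T "\<lambda>x. fscale (ev _ \<one>) (t _ x)" m]
          by (intro A.csum_cong refl) auto
      also have "\<dots> = t \<mu> m"
        using \<mu>m A.csum_counit(2)[of T "\<lambda>x. t x m" \<mu>] by simp
      finally show "csum D (t \<mu> m) (\<lambda>x y. fscale (counit D x) y) = t \<mu> m" .
    qed (use c in auto)
    finally show ?thesis .
  qed
  show "cop2 D c (\<lambda>x y. scale D (counit D y) x) = c"
  proof -
    have "cop2 D c (\<lambda>x y. scale D (counit D y) x) = csum D c (\<lambda>x y. fscale (counit D y) x)"
      using c by (intro drin_cop2_csum[where U=T]) auto
    also have "\<dots> = c"
    proof (rule tensor_ext[where X=T and f="\<lambda>c. csum D c (\<lambda>x y. fscale (counit D y) x)" and g="\<lambda>c.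
        c"])
      fix \<mu> m assume \<mu>m: "\<mu> \<in> carrier A" "m \<in> carrier B"
      have "csum D (t \<mu> m) (\<lambda>x y. fscale (counit D y) x)
          = csum A \<mu> (\<lambda>\<mu>1 \<mu>2. csum B m (\<lambda>m1 m2. fscale (counit B m2) (fscale (ev \<mu>1 \<one>) (t \<mu>2 m1))))"
        using \<mu>m by (simp add: csum_drin_tens[where X=T] counit mult.commute fs cong: csum_congs)
      also have "\<dots> = csum A \<mu> (\<lambda>\<mu>1 \<mu>2. fscale (ev \<mu>1 \<one>) (t \<mu>2 m))"
        using \<mu>m csum_counit(2)[of T "\<lambda>x. fscale (ev _ \<one>) (t _ x)" m]
          by (intro A.csum_cong refl) auto
      also have "\<dots> = t \<mu> m"
        using \<mu>m A.csum_counit(1)[of T "\<lambda>x. t x m" \<mu>] by simp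
      finally show "csum D (t \<mu> m) (\<lambda>x y. fscale (counit D y) x) = t \<mu> m" .
    qed (use c in auto)
    finally show ?thesis .
  qed
qed

interpretation D: kcoalgebra "drinfeld_double B" by (rule kcoalgebra_drin)

lemma linear_on_drin_comult [simp]: "linear_on U T g \<Longrightarrow> linear_on U (tensor_space T T) (\<lambda>x.
    comult D (g x))"
  by (rule linear_on_compose[OF drin_comult_linear])

lemma linear_on_csum_drin [simp]:
  assumes "kspace X" "linear_on U T g"
    "\<And>v. v \<in> carrier T \<Longrightarrow> linear_on T X (\<phi> v)"
    "\<And>w. w \<in> carrier T \<Longrightarrow> linear_on T X (\<lambda>v. \<phi> v w)"
  shows "linear_on U X (\<lambda>x. csum D (g x) \<phi>)"
  using assms by (simp add: csum_def)

lemma linear_on_csum_drin_param [simp]: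
  assumes "kspace X" "kspace U" "c \<in> carrier T"
    "\<And>v w. v \<in> carrier T \<Longrightarrow> w \<in> carrier T \<Longrightarrow> linear_on U X (\<lambda>x. \<phi> x v w)"
  shows "linear_on U X (\<lambda>x. csum D c (\<phi> x))"
  using assms by (simp add: csum_def drin_comult_closed)

section \<open>Multiplicativity of the coaction\<close>

lemma rreg_lreg:
  "\<lbrakk>a \<in> carrier B; b \<in> carrier B; \<beta> \<in> carrier A\<rbrakk> \<Longrightarrow> rreg B (lreg B a \<beta>) b = lreg B a (rreg B \<beta> b)"
  by (rule dual_eqI) (auto simp: mult_assoc)

text \<open>In the expanded right side the product of \<open>D\<close> contributes \<beta>''
  \<leftharpoonup> \<open>S\<^sup>-\<^sup>1(r)\<close>, acted on further by p, and the Heisenberg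
  product contributes u \<rightharpoonup> \<beta>', with r and u adjacent components of
  \<open>a\<close>. By \<open>csum_lreg_rreg_cancel\<close> the two actions annihilate each other,
  and the counit left behind removes their common component \<open>w\<close>. The result is
  \<open>?N\<close>, which is also the direct expansion of the left side.\<close>

lemma drin_comult_heis_mult_tens:
  assumes \<alpha>: "\<alpha> \<in> carrier A" and a: "a \<in> carrier B" and \<beta>: "\<beta> \<in> carrier A" and b: "b \<in> carrier B"
  shows "comult D (t \<alpha> a \<bullet> t \<beta> b) = csum D (t \<alpha> a) (\<lambda>x1 x2. csum D (t \<beta> b) (\<lambda>y1 y2.
    tens T T (x1 \<diamondop> y1) (x2 \<bullet> y2)))"
proof -
  let ?T2 = "tensor_space T T"
  let ?N = "csum B b (\<lambda>b1 b2. csum A \<alpha> (\<lambda>\<alpha>1 \<alpha>2. csum B a (\<lambda>p d. csum B d (\<lambda>q e. csum A \<beta> (\<lambda>\<beta>1 \<beta>2.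
    tens T T (t (\<alpha>2 \<star> lreg B p \<beta>2) (q \<cdot> b1)) (t (\<alpha>1 \<star> \<beta>1) (e \<cdot> b2)))))))"
  \<comment> \<open>Directed instances of the exchange: the sum over \<open>b\<close> moves outward,
    the one over \<open>\<beta>\<close> inward, and the one over \<open>\<alpha>\<close> out of the
    one over \<open>a\<close>.\<close>
  note swaps = csum_swap[where D=B and d=b] csum_swap[where C="dual B" and c=\<beta>]
    csum_swap[where C=B and c=a and D="dual B" and d=\<alpha>]
  have "comult D (t \<alpha> a \<bullet> t \<beta> b)
      = csum B a (\<lambda>p d. csum A \<alpha> (\<lambda>\<alpha>1 \<alpha>2. csum A \<beta> (\<lambda>\<beta>1 \<beta>2. csum B d (\<lambda>q e. csum B b (\<lambda>b1 b2.
        tens T T (t (\<alpha>2 \<star> lreg B p \<beta>2) (q \<cdot> b1)) (t (\<alpha>1 \<star> \<beta>1) (e \<cdot> b2)))))))"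
    using assms
    by (simp add: heis_mult_tens linear_on_csum[OF _ drin_comult_linear] drin_comult_tens
        A.csum_mult[where X="?T2"] csum_lreg[where X="?T2"] csum_mult[where X="?T2"] cong:
          csum_congs)
  also have "\<dots> = ?N" by (simp only: swaps)
  finally have L: "comult D (t \<alpha> a \<bullet> t \<beta> b) = ?N" .
  let ?G = "\<lambda>\<alpha>1 \<alpha>2 \<beta>1 \<beta>2 b1 b2 p q r u v.
    tens T T (t (\<alpha>2 \<star> lreg B p (rreg B \<beta>2 (inv_antipode B r))) (q \<cdot> b1)) (t (\<alpha>1 \<star> lreg B u \<beta>1)
      (v \<cdot> b2))"
  have "tens T T (t \<alpha>2 a1 \<diamondop> t \<beta>2 b1) (t \<alpha>1 a2 \<bullet> t \<beta>1 b2)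
      = csum B a1 (\<lambda>p d. csum B d (\<lambda>q r. csum B a2 (\<lambda>u v. ?G \<alpha>1 \<alpha>2 \<beta>1 \<beta>2 b1 b2 p q r u v)))"
    if "\<alpha>1 \<in> carrier A" "\<alpha>2 \<in> carrier A" "\<beta>1 \<in> carrier A" "\<beta>2 \<in> carrier A" "a1 \<in> carrier B"
      "a2 \<in> carrier B"
      "b1 \<in> carrier B" "b2 \<in> carrier B" for \<alpha>1 \<alpha>2 \<beta>1 \<beta>2 a1 a2 b1 b2
  proof -
    have L1: "linear_on T ?T2 (\<lambda>x. tens T T x y)" if "y \<in> carrier T" for y using that by simp
    have L2: "linear_on T ?T2 (tens T T x)" if "x \<in> carrier T" for x using that by simp
    have "tens T T (t \<alpha>2 a1 \<diamondop> t \<beta>2 b1) (t \<alpha>1 a2 \<bullet> t \<beta>1 b2)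
        = csum B a1 (\<lambda>p d. csum B d (\<lambda>q r. tens T T
            (t (\<alpha>2 \<star> lreg B p (rreg B \<beta>2 (inv_antipode B r))) (q \<cdot> b1)) (t \<alpha>1 a2 \<bullet> t \<beta>1 b2)))"
      using that by (simp add: drin_mult_tens rreg_lreg linear_on_csum[OF _ L1] cong: csum_congs)
    then show ?thesis using that
      by (simp add: heis_mult_tens linear_on_csum[OF _ L2] cong: csum_congs)
  qed
  then have "csum D (t \<alpha> a) (\<lambda>x1 x2. csum D (t \<beta> b) (\<lambda>y1 y2. tens T T (x1 \<diamondop> y1) (x2 \<bullet> y2)))
      = csum A \<alpha> (\<lambda>\<alpha>1 \<alpha>2. csum B a (\<lambda>a1 a2. csum A \<beta> (\<lambda>\<beta>1 \<beta>2. csum B b (\<lambda>b1 b2.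
        csum B a1 (\<lambda>p d. csum B d (\<lambda>q r. csum B a2 (\<lambda>u v. ?G \<alpha>1 \<alpha>2 \<beta>1 \<beta>2 b1 b2 p q r u v)))))))"
    using assms by (simp add: csum_drin_tens[where X="?T2"] cong: csum_congs)
  also have "\<dots>
      = csum B b (\<lambda>b1 b2. csum A \<alpha> (\<lambda>\<alpha>1 \<alpha>2. csum B a (\<lambda>a1 a2. csum B a1 (\<lambda>p d. csum B d (\<lambda>q r.
      csum B a2 (\<lambda>u v. csum A \<beta> (\<lambda>\<beta>1 \<beta>2. ?G \<alpha>1 \<alpha>2 \<beta>1 \<beta>2 b1 b2 p q r u v)))))))"
    by (simp only: swaps)
  also have "\<dots> = csum B b (\<lambda>b1 b2. csum A \<alpha> (\<lambda>\<alpha>1 \<alpha>2. csum B a (\<lambda>p d. csum B d (\<lambda>q e. csum B e (\<lambda>w v.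
      csum B w (\<lambda>r u. csum A \<beta> (\<lambda>\<beta>1 \<beta>2. ?G \<alpha>1 \<alpha>2 \<beta>1 \<beta>2 b1 b2 p q r u v)))))))"
    using assms by (simp add: csum_reassoc5[where X="?T2"] cong: csum_congs)
  also have "\<dots> = csum B b (\<lambda>b1 b2. csum A \<alpha> (\<lambda>\<alpha>1 \<alpha>2. csum B a (\<lambda>p d. csum B d (\<lambda>q e. csum B e (\<lambda>w v.
      scale ?T2 (counit B w) (csum A \<beta> (\<lambda>\<beta>1 \<beta>2. tens T T (t (\<alpha>2 \<star> lreg B p \<beta>2) (q \<cdot> b1))
        (t (\<alpha>1 \<star> \<beta>1) (v \<cdot> b2)))))))))"
  proof -
    have "csum B w (\<lambda>r u. csum A \<beta> (\<lambda>\<beta>1 \<beta>2. ?G \<alpha>1 \<alpha>2 \<beta>1 \<beta>2 b1 b2 p q r u v))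
        = scale ?T2 (counit B w) (csum A \<beta> (\<lambda>\<beta>1 \<beta>2. tens T T (t (\<alpha>2 \<star> lreg B p \<beta>2) (q \<cdot> b1))
          (t (\<alpha>1 \<star> \<beta>1) (v \<cdot> b2))))"
      if "\<alpha>1 \<in> carrier A" "\<alpha>2 \<in> carrier A" "p \<in> carrier B" "q \<in> carrier B" "w \<in> carrier B"
        "v \<in> carrier B"
        "b1 \<in> carrier B" "b2 \<in> carrier B" for \<alpha>1 \<alpha>2 p q w v b1 b2
      using that \<beta> by (intro csum_lreg_rreg_cancel) auto
    then show ?thesis using assms by (simp cong: csum_congs)
  qed
  also have "\<dots> = ?N"
    using assms by (intro csum_cong A.csum_cong refl csum_counit(1)) auto
  finally show ?thesis using L by simp
qed

section \<open>The convolution inverse of the identity\<close>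

definition \<iota> :: "('k, 'b \<Rightarrow> 'k, 'b) tensor \<Rightarrow> ('k, 'b \<Rightarrow> 'k, 'b) tensor"
  where "\<iota> x = tsum A B x (\<lambda>\<mu> m. t \<epsilon> (antipode B m) \<bullet> t (inv_antipode A \<mu>) \<one>)"

lemma \<iota>_tens:
  "\<mu> \<in> carrier A \<Longrightarrow> m \<in> carrier B \<Longrightarrow>
    \<iota> (t \<mu> m) = t \<epsilon> (antipode B m) \<bullet> t (inv_antipode A \<mu>) \<one>"
  by (simp add: \<iota>_def tsum_tens[where U=T])

lemma linear_\<iota>: "linear_on T T \<iota>"
proof -
  have "linear_on T T (\<lambda>x. \<iota> x)" by (simp add: \<iota>_def)
  then show ?thesis .
qed

lemma linear_on_\<iota> [simp]: "linear_on U T g \<Longrightarrow> linear_on U T (\<lambda>x. \<iota> (g x))"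
  by (rule linear_on_compose[OF linear_\<iota>])

lemma \<iota>_closed [simp]: "x \<in> carrier T \<Longrightarrow> \<iota> x \<in> carrier T"
  by (rule linear_onD(1)[OF linear_\<iota>])

lemma drin_counit_tens: "\<mu> \<in> carrier A \<Longrightarrow> m \<in> carrier B \<Longrightarrow> counit D (t \<mu> m) = ev \<mu> \<one> * counit B m"
  by (simp add: drin_counit_eq tsum_tens[where U=scalars])

lemma heis_assoc:
  "x \<in> carrier T \<Longrightarrow> y \<in> carrier T \<Longrightarrow> z \<in> carrier T \<Longrightarrow> x \<bullet> y \<bullet> z = x \<bullet> (y \<bullet> z)"
  using H.mult_assoc by simp

lemma fscale_fscale: "fscale a (fscale b x) = fscale (a * b) x"
  by (simp add: fscale_def mult.assoc)

text \<open>Keeping the values of \<open>\<iota>\<close> as products makes the inner factors match.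
  Here they are m' and S(m''), both in \<open>B\<close>, and collapse first; then \<mu>'' meets the
  inverse antipode of \<mu>'. In the left identity the inner factors lie in the dual and collapse
  before those in \<open>B\<close>.\<close>

lemma \<iota>_right_tens:
  assumes "\<mu> \<in> carrier A" "m \<in> carrier B"
  shows "csum D (t \<mu> m) (\<lambda>x1 x2. x1 \<bullet> \<iota> x2) = fscale (counit D (t \<mu> m)) (t \<epsilon> \<one>)"
proof -
  let ?S = "inv_antipode A"
  have "csum D (t \<mu> m) (\<lambda>x1 x2. x1 \<bullet> \<iota> x2)
      = csum A \<mu> (\<lambda>\<mu>1 \<mu>2. csum B m (\<lambda>m1 m2. t \<mu>2 m1 \<bullet> \<iota> (t \<mu>1 m2)))"
    using assms by (intro csum_drin_tens[where X=T]) auto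
  also have "\<dots> = csum A \<mu> (\<lambda>\<mu>1 \<mu>2. csum B m (\<lambda>m1 m2. t \<mu>2 (m1 \<cdot> antipode B m2) \<bullet> t (?S \<mu>1) \<one>))"
    using assms by (simp add: \<iota>_tens heis_mult_tens_unit flip: heis_assoc cong: csum_congs)
  also have "\<dots> = csum A \<mu> (\<lambda>\<mu>1 \<mu>2. fscale (counit B m) (t (\<mu>2 \<star> ?S \<mu>1) \<one>))"
  proof -
    have "csum B m (\<lambda>m1 m2. t \<mu>2 (m1 \<cdot> antipode B m2) \<bullet> t (?S \<mu>1) \<one>)
        = fscale (counit B m) (t (\<mu>2 \<star> ?S \<mu>1) \<one>)"
      if "\<mu>1 \<in> carrier A" "\<mu>2 \<in> carrier A" for \<mu>1 \<mu>2
      using that assms csum_antipode(2)[of T "\<lambda>u. t \<mu>2 u \<bullet> t (?S \<mu>1) \<one>" m]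
        by (simp add: heis_mult_tens_unit)
    then show ?thesis using assms by (simp cong: csum_congs)
  qed
  also have "\<dots> = fscale (ev \<mu> \<one>) (fscale (counit B m) (t \<epsilon> \<one>))"
    using assms A.csum_inv_antipode(2)[of T "\<lambda>u. fscale (counit B m) (t u \<one>)" \<mu>] by simp
  finally show ?thesis using assms by (simp add: drin_counit_tens fscale_fscale)
qed

lemma \<iota>_left_tens:
  assumes "\<mu> \<in> carrier A" "m \<in> carrier B"
  shows "csum D (t \<mu> m) (\<lambda>x1 x2. \<iota> x1 \<bullet> x2) = fscale (counit D (t \<mu> m)) (t \<epsilon> \<one>)"
proof -
  let ?S = "inv_antipode A"
  have "csum D (t \<mu> m) (\<lambda>x1 x2. \<iota> x1 \<bullet> x2)
      = csum A \<mu> (\<lambda>\<mu>1 \<mu>2. csum B m (\<lambda>m1 m2. \<iota> (t \<mu>2 m1) \<bullet> t \<mu>1 m2))"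
    using assms by (intro csum_drin_tens[where X=T]) auto
  also have "\<dots> = csum A \<mu> (\<lambda>\<mu>1 \<mu>2. csum B m (\<lambda>m1 m2.
      t \<epsilon> (antipode B m1) \<bullet> t (?S \<mu>2 \<star> \<mu>1) m2))"
    using assms by (simp add: \<iota>_tens heis_mult_tens_unit heis_assoc cong: csum_congs)
  also have "\<dots> = csum B m (\<lambda>m1 m2. csum A \<mu> (\<lambda>\<mu>1 \<mu>2.
      t \<epsilon> (antipode B m1) \<bullet> t (?S \<mu>2 \<star> \<mu>1) m2))"
    by (rule csum_swap)
  also have "\<dots> = csum B m (\<lambda>m1 m2. fscale (ev \<mu> \<one>) (t \<epsilon> (antipode B m1 \<cdot> m2)))"
  proof -
    have "csum A \<mu> (\<lambda>\<mu>1 \<mu>2. t \<epsilon> (antipode B m1) \<bullet> t (?S \<mu>2 \<star> \<mu>1) m2)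
        = fscale (ev \<mu> \<one>) (t \<epsilon> (antipode B m1 \<cdot> m2))" if "m1 \<in> carrier B" "m2 \<in> carrier B" for m1 m2
      using that assms A.csum_inv_antipode(1)[of T "\<lambda>u. t \<epsilon> (antipode B m1) \<bullet> t u m2" \<mu>]
      by (simp add: heis_mult_tens_unit)
    then show ?thesis using assms by (simp cong: csum_congs)
  qed
  also have "\<dots> = fscale (counit B m) (fscale (ev \<mu> \<one>) (t \<epsilon> \<one>))"
    using assms csum_antipode(1)[of T "\<lambda>u. fscale (ev \<mu> \<one>) (t \<epsilon> u)" m] by simp
  finally show ?thesis using assms by (simp add: drin_counit_tens fscale_fscale mult.commute)
qed

section \<open>The action as conjugation\<close>

lemma heis_act_eq:
  assumes "d \<in> carrier T" "x \<in> carrier T"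
  shows "act H d x = tsum A B d (\<lambda>\<mu> m. tsum A B x (\<lambda>\<beta> b.
    csum A \<mu> (\<lambda>\<mu>1 e. csum A e (\<lambda>\<mu>2 \<mu>3. csum B m (\<lambda>m1 f. csum B f (\<lambda>m2 m3.
      t (\<mu>3 \<star> lreg B m1 \<beta> \<star> inv_antipode A \<mu>2)
        (rcoreg B (m2 \<cdot> b \<cdot> antipode B m3) (inv_antipode A \<mu>1))))))))"
  unfolding heisenberg_double_def Let_def yd_algebra.simps
  by (intro sweedler_eq_tsum[where U=T])
    (use assms in \<open>auto intro!: sweedler_eq_tsum[where U=T] cop3_eq_csum[where U=T]
      A.cop3_eq_csum[where U=T]\<close>)

lemma heis_act_tens:
  assumes "\<mu> \<in> carrier A" "m \<in> carrier B" "\<beta> \<in> carrier A" "b \<in> carrier B"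
  shows "act H (t \<mu> m) (t \<beta> b) =
    csum A \<mu> (\<lambda>\<mu>1 e. csum A e (\<lambda>\<mu>2 \<mu>3. csum B m (\<lambda>m1 f. csum B f (\<lambda>m2 m3.
      t (\<mu>3 \<star> lreg B m1 \<beta> \<star> inv_antipode A \<mu>2)
        (rcoreg B (m2 \<cdot> b \<cdot> antipode B m3) (inv_antipode A \<mu>1))))))"
  using assms by (simp add: heis_act_eq tsum_tens[where U=T])

lemma linear_on_heis_act:
  "d \<in> carrier T \<Longrightarrow> linear_on T T (act H d)" "x \<in> carrier T \<Longrightarrow> linear_on T T (\<lambda>d. act H d x)"
  by (simp_all add: heis_act_eq cong: linear_on_cong)

lemma heis_coact_eq: "coact H = comult D"
proof -
  have "comult D = (\<lambda>x. sweedler A B x (\<lambda>\<beta> b. cop2 A \<beta> (\<lambda>\<beta>1 \<beta>2. cop2 B b (\<lambda>b1 b2.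
      tens T T (t \<beta>2 b1) (t \<beta>1 b2)))))"
    by (simp add: drinfeld_double_def Let_def)
  then show ?thesis by (simp add: heisenberg_double_def Let_def)
qed

text \<open>The scalar obtained by pairing \<nu>'' with y' may be read as y' acting on \<nu> or as
  \<nu>'' acting on y. The second reading is the origin of the coregular action in the formula for
  the action of \<open>D\<close>.\<close>

lemma heis_tens_mult_dual:
  assumes "\<gamma> \<in> carrier A" "y \<in> carrier B" "\<nu> \<in> carrier A"
  shows "t \<gamma> y \<bullet> t \<nu> \<one> = csum A \<nu> (\<lambda>\<nu>1 \<nu>2. t (\<gamma> \<star> \<nu>1) (rcoreg B y \<nu>2))"
proof -
  have "t \<gamma> y \<bullet> t \<nu> \<one> = csum B y (\<lambda>y1 y2. csum A \<nu> (\<lambda>\<nu>1 \<nu>2. fscale (ev \<nu>2 y1) (t (\<gamma> \<star> \<nu>1) y2)))"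
  proof -
    have "t (\<gamma> \<star> lreg B y1 \<nu>) y2 = csum A \<nu> (\<lambda>\<nu>1 \<nu>2. fscale (ev \<nu>2 y1) (t (\<gamma> \<star> \<nu>1) y2))"
      if "y1 \<in> carrier B" "y2 \<in> carrier B" for y1 y2
    proof -
      have "linear_on A T (\<lambda>x. t (\<gamma> \<star> x) y2)" using that assms by simp
      from A.linear_on_csum[OF _ this] show ?thesis
        using that assms by (simp add: lreg_eq tens_fscale cong: csum_congs)
    qed
    then show ?thesis using assms by (simp add: heis_mult_tens cong: csum_congs)
  qed
  also have "\<dots> = csum A \<nu> (\<lambda>\<nu>1 \<nu>2. csum B y (\<lambda>y1 y2. fscale (ev \<nu>2 y1) (t (\<gamma> \<star> \<nu>1) y2)))"
    by (rule csum_swap)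
  also have "\<dots> = csum A \<nu> (\<lambda>\<nu>1 \<nu>2. t (\<gamma> \<star> \<nu>1) (rcoreg B y \<nu>2))"
  proof (rule A.csum_cong)
    fix \<nu>1 \<nu>2 assume *: "\<nu>1 \<in> carrier A" "\<nu>2 \<in> carrier A"
    have "linear_on B T (t (\<gamma> \<star> \<nu>1))" using * assms by simp
    from linear_on_csum[OF _ this]
    show "csum B y (\<lambda>y1 y2. fscale (ev \<nu>2 y1) (t (\<gamma> \<star> \<nu>1) y2)) = t (\<gamma> \<star> \<nu>1) (rcoreg B y \<nu>2)"
      using * assms by (simp add: rcoreg_eq tens_fscale)
  qed (use assms in auto)
  finally show ?thesis .
qed

text \<open>Multiplying out \<mu>'' # m', \<beta> # b, 1 # S(m'') and the inverse antipode of \<mu>'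
  from left to right, the last factor is moved past the \<open>B\<close> component by
  \<open>heis_tens_mult_dual\<close>. Its coproduct is reversed, so the component that stays in the
  dual stems from the second leg of \<mu>' and the one acting on \<open>B\<close> from the first, as
  the formula for the action prescribes.\<close>

lemma heis_conjugation_tens:
  assumes "\<mu> \<in> carrier A" "m \<in> carrier B" "\<beta> \<in> carrier A" "b \<in> carrier B"
  shows "csum D (t \<mu> m) (\<lambda>h1 h2. h1 \<bullet> t \<beta> b \<bullet> \<iota> h2) = act H (t \<mu> m) (t \<beta> b)"
proof -
  let ?S = "inv_antipode A"
  let ?\<phi> = "\<lambda>u v \<mu>2 p q m2. t (\<mu>2 \<star> lreg B p \<beta> \<star> ?S v) (rcoreg B (q \<cdot> b \<cdot> antipode B m2) (?S u))"
  have "csum D (t \<mu> m) (\<lambda>h1 h2. h1 \<bullet> t \<beta> b \<bullet> \<iota> h2)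
      = csum A \<mu> (\<lambda>\<mu>1 \<mu>2. csum B m (\<lambda>m1 m2. t \<mu>2 m1 \<bullet> t \<beta> b \<bullet> \<iota> (t \<mu>1 m2)))"
    using assms by (intro csum_drin_tens[where X=T]) auto
  also have "\<dots>
      = csum A \<mu> (\<lambda>\<mu>1 \<mu>2. csum B m (\<lambda>m1 m2. csum B m1 (\<lambda>p q. csum A \<mu>1 (\<lambda>u v. ?\<phi> u v \<mu>2 p q m2))))"
  proof -
    have "t \<mu>2 m1 \<bullet> t \<beta> b \<bullet> \<iota> (t \<mu>1 m2) = csum B m1 (\<lambda>p q. csum A \<mu>1 (\<lambda>u v. ?\<phi> u v \<mu>2 p q m2))"
      if "\<mu>1 \<in> carrier A" "\<mu>2 \<in> carrier A" "m1 \<in> carrier B" "m2 \<in> carrier B" for \<mu>1 \<mu>2 m1 m2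
    proof -
      have L: "linear_on T T (\<lambda>x. x \<bullet> t \<epsilon> (antipode B m2) \<bullet> t (?S \<mu>1) \<one>)"
        using that by simp
      have "t \<mu>2 m1 \<bullet> t \<beta> b \<bullet> \<iota> (t \<mu>1 m2)
          = t \<mu>2 m1 \<bullet> t \<beta> b \<bullet> t \<epsilon> (antipode B m2) \<bullet> t (?S \<mu>1) \<one>"
        using that assms by (simp add: \<iota>_tens heis_assoc)
      also have "\<dots> = csum B m1 (\<lambda>p q. t (\<mu>2 \<star> lreg B p \<beta>) (q \<cdot> b \<cdot> antipode B m2) \<bullet> t (?S \<mu>1) \<one>)"
        using that assms
        by (simp add: heis_mult_tens[of \<mu>2 m1] linear_on_csum[OF _ L] heis_mult_tens_unit(2) cong:
          csum_congs)
      also have "\<dots> = csum B m1 (\<lambda>p q. csum A \<mu>1 (\<lambda>u v. ?\<phi> u v \<mu>2 p q m2))"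
        using that assms
          by (simp add: heis_tens_mult_dual csum_dual_inv_antipode[where X=T] cong: csum_congs)
      finally show ?thesis .
    qed
    then show ?thesis using assms by (simp cong: csum_congs)
  qed
  also have "\<dots>
      = csum A \<mu> (\<lambda>\<mu>1 \<mu>2. csum A \<mu>1 (\<lambda>u v. csum B m (\<lambda>m1 m2. csum B m1 (\<lambda>p q. ?\<phi> u v \<mu>2 p q m2))))"
    by (simp only: csum_swap[where C=B and D="dual B"])
  also have "\<dots>
      = csum A \<mu> (\<lambda>\<mu>1 \<mu>2. csum A \<mu>1 (\<lambda>u v. csum B m (\<lambda>p f. csum B f (\<lambda>q m2. ?\<phi> u v \<mu>2 p q m2))))"
    using assms by (intro A.csum_cong refl csum_coassoc[where X=T]) auto
  also have "\<dots>
      = csum A \<mu> (\<lambda>u e. csum A e (\<lambda>v \<mu>2. csum B m (\<lambda>p f. csum B f (\<lambda>q m2. ?\<phi> u v \<mu>2 p q m2))))"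
    using assms by (intro A.csum_coassoc[where X=T]) auto
  finally show ?thesis using assms by (simp add: heis_act_tens)
qed

lemma tens2_ext:
  assumes "\<And>y. y \<in> carrier T \<Longrightarrow> linear_on T X (\<lambda>x. f x y)"
    "\<And>y. y \<in> carrier T \<Longrightarrow> linear_on T X (\<lambda>x. g x y)"
    "\<And>x. x \<in> carrier T \<Longrightarrow> linear_on T X (f x)"
    "\<And>x. x \<in> carrier T \<Longrightarrow> linear_on T X (g x)"
    "\<And>\<alpha> a \<beta> b. \<lbrakk>\<alpha> \<in> carrier A; a \<in> carrier B; \<beta> \<in> carrier A; b \<in> carrier B\<rbrakk>
      \<Longrightarrow> f (t \<alpha> a) (t \<beta> b) = g (t \<alpha> a) (t \<beta> b)"
    and xy: "x \<in> carrier T" "y \<in> carrier T"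
  shows "f x y = g x y"
proof (rule tensor_ext[where X=X and f="\<lambda>x. f x y" and g="\<lambda>x. g x y"])
  fix \<alpha> a assume 1: "\<alpha> \<in> carrier A" "a \<in> carrier B"
  show "f (t \<alpha> a) y = g (t \<alpha> a) y"
    by (rule tensor_ext[where X=X and f="f (t \<alpha> a)" and g="g (t \<alpha> a)"]) (use assms 1 in auto)
qed (use assms in auto)

theorem cleft_object_heisenberg: "cleft_object D H \<iota>"
proof (intro cleft_object.intro kcoalgebra_drin cleft_object_axioms.intro kalgebra_heis)
  show "bilinear_on D D D (mult D)"
    using bilinear_drin_mult by (simp add: bilinear_on_def)
  show "comult D \<one>\<^bsub>D\<^esub> = tens D D \<one>\<^bsub>D\<^esub> \<one>\<^bsub>D\<^esub>"
    by (simp add: drin_comult_tens csum_unit[where X="tensor_space T T"] A.csum_unit[where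
      X="tensor_space T T"])
  show "counit D \<one>\<^bsub>D\<^esub> = 1" by (simp add: drin_counit_tens ev_unit_dual counit_unit)
  show "coact H = comult D" by (rule heis_coact_eq)
  show "linear_on D D \<iota>" using linear_\<iota> by simp
  show "comult D (x \<bullet> y) = csum D x (\<lambda>x1 x2. csum D y (\<lambda>y1 y2. tens D D (x1 \<diamondop> y1) (x2 \<bullet> y2)))"
    if "x \<in> carrier D" "y \<in> carrier D" for x y
    by (rule tens2_ext[where X="tensor_space T T" and f="\<lambda>x y. comult D (x \<bullet> y)"
          and g="\<lambda>x y. csum D x (\<lambda>x1 x2. csum D y (\<lambda>y1 y2. tens D D (x1 \<diamondop> y1) (x2 \<bullet> y2)))"])
      (use that drin_comult_heis_mult_tens in auto)
  fix x assume x: "x \<in> carrier D"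
  have L: "linear_on T T (\<lambda>x. fscale (counit D x) (t \<epsilon> \<one>))"
    using D.linear_on_counit[of T "\<lambda>x. x"] by simp
  show "csum D x (\<lambda>x1 x2. \<iota> x1 \<bullet> x2) = scale D (counit D x) \<one>\<^bsub>D\<^esub>"
    by (rule tensor_ext[where X=T and f="\<lambda>x. csum D x (\<lambda>x1 x2. \<iota> x1 \<bullet> x2)"
          and g="\<lambda>x. scale D (counit D x) \<one>\<^bsub>D\<^esub>"])
      (use x L \<iota>_left_tens in auto)
  show "csum D x (\<lambda>x1 x2. x1 \<bullet> \<iota> x2) = scale D (counit D x) \<one>\<^bsub>D\<^esub>"
    by (rule tensor_ext[where X=T and f="\<lambda>x. csum D x (\<lambda>x1 x2. x1 \<bullet> \<iota> x2)"
          and g="\<lambda>x. scale D (counit D x) \<one>\<^bsub>D\<^esub>"])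
      (use x L \<iota>_right_tens in auto)
  show "act H h x = csum D h (\<lambda>h1 h2. h1 \<bullet> x \<bullet> \<iota> h2)" if "h \<in> carrier D" for h
    by (rule tens2_ext[where X=T and f="\<lambda>h x. act H h x" and g="\<lambda>h x. csum D h (\<lambda>h1 h2.
        h1 \<bullet> x \<bullet> \<iota> h2)"])
      (use that x linear_on_heis_act heis_conjugation_tens in auto)
qed simp_all

section \<open>The two factors and the braided product\<close>

abbreviation (input) X where "X \<equiv> dual_cop_yd B"
abbreviation (input) Y where "Y \<equiv> hopf_yd B"

lemma factor_simps [simp]:
  "carrier X = carrier A" "scale X = fscale" "mult X = mult A" "\<one>\<^bsub>X\<^esub> = \<epsilon>"
  "carrier Y = carrier B" "scale Y = scale B" "mult Y = mult B" "\<one>\<^bsub>Y\<^esub> = \<one>"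
  by (simp_all add: dual_cop_yd_def hopf_yd_def)

lemma linear_from_factor [simp]: "linear_on X V f = linear_on A V f" "linear_on Y W g
    = linear_on B W g"
  by (simp_all add: linear_on_def)

lemma linear_to_factor [simp]: "linear_on V X f = linear_on V A f" "linear_on W Y g
    = linear_on W B g"
  by (simp_all add: linear_on_def)

lemma tens_factor [simp]:
  "tens V X = tens V A" "tensor_space V X = tensor_space V A" "sweedler V X = sweedler V A"
    "tsum V X = tsum V A"
  "tens V Y = tens V B" "tensor_space V Y = tensor_space V B" "sweedler V Y = sweedler V B"
    "tsum V Y = tsum V B"
  using tensor_same_space[of V V X A] tsum_same_space[of V V X A]
    tensor_same_space[of V V Y B] tsum_same_space[of V V Y B] by simp_all

lemma tens_factors [simp]:
  "tens X B = t" "tensor_space X B = T" "sweedler X B = sweedler A B"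
  using tensor_same_space[of X A B B] by simp_all

lemma kalgebra_factors: "kalgebra X" "kalgebra Y"
proof -
  have "kspace X" "kspace Y" using kspace_same_space[of X A] kspace_same_space[of Y B] by simp_all
  moreover have "bilinear_on X X X (mult X)" "bilinear_on Y Y Y (mult Y)"
    by (auto intro!: bilinear_onI)
  ultimately show "kalgebra X" "kalgebra Y"
    by (auto intro!: kalgebra.intro kalgebra_axioms.intro simp: A.mult_assoc mult_assoc)
qed

lemma act_X_eq:
  assumes "d \<in> carrier T" "\<beta> \<in> carrier A"
  shows "act X d \<beta> = tsum A B d (\<lambda>\<mu> m. csum A \<mu> (\<lambda>\<mu>1 \<mu>2.
    \<mu>2 \<star> lreg B m \<beta> \<star> inv_antipode A \<mu>1))"
  unfolding dual_cop_yd_def yd_algebra.simps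
  by (intro sweedler_eq_tsum[where U=A]) (use assms in \<open>auto intro!: A.cop2_eq_csum[where U=A]\<close>)

lemma act_X_tens:
  assumes "\<mu> \<in> carrier A" "m \<in> carrier B" "\<beta> \<in> carrier A"
  shows "act X (t \<mu> m) \<beta> = csum A \<mu> (\<lambda>\<mu>1 \<mu>2. \<mu>2 \<star> lreg B m \<beta> \<star> inv_antipode A \<mu>1)"
  using assms by (simp add: act_X_eq tsum_tens[where U=A])

lemma act_Y_eq:
  assumes "d \<in> carrier T" "b \<in> carrier B"
  shows "act Y d b = tsum A B d (\<lambda>\<mu> m. csum B m (\<lambda>m1 m2.
    rcoreg B (m1 \<cdot> b \<cdot> antipode B m2) (inv_antipode A \<mu>)))"
  unfolding hopf_yd_def yd_algebra.simps
  by (intro sweedler_eq_tsum[where U=B]) (use assms in \<open>auto intro!: cop2_eq_csum[where U=B]\<close>)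

lemma act_Y_tens:
  assumes "\<mu> \<in> carrier A" "m \<in> carrier B" "b \<in> carrier B"
  shows "act Y (t \<mu> m) b = csum B m (\<lambda>m1 m2. rcoreg B (m1 \<cdot> b \<cdot> antipode B m2) (inv_antipode A \<mu>))"
  using assms by (simp add: act_Y_eq tsum_tens[where U=B])

lemma act_X_bilinear: "bilinear_on T A A (act X)"
  by (rule bilinear_onI) (simp_all add: act_X_eq cong: linear_on_cong)

lemma act_Y_bilinear: "bilinear_on T B B (act Y)"
  by (rule bilinear_onI) (simp_all add: act_Y_eq cong: linear_on_cong)

lemmas act_factor_linear [simp]
  = bilinear_onD[OF act_X_bilinear kspace_dual] bilinear_onD[OF act_Y_bilinear kspace]

lemma coact_X_eq: "\<beta> \<in> carrier A \<Longrightarrow> coact X \<beta> = csum A \<beta> (\<lambda>\<beta>1 \<beta>2. tens T A (t \<beta>2 \<one>) \<beta>1)"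
  unfolding dual_cop_yd_def yd_algebra.simps tens_double_left
  by (intro A.cop2_eq_csum[where U="tensor_space T A"]) auto

lemma coact_Y_eq: "b \<in> carrier B \<Longrightarrow> coact Y b = csum B b (\<lambda>b1 b2. tens T B (t \<epsilon> b1) b2)"
  unfolding hopf_yd_def yd_algebra.simps tens_double_left
  by (intro cop2_eq_csum[where U="tensor_space T B"]) auto

lemma coact_factor_linear: "linear_on A (tensor_space T A) (coact X)"
  "linear_on B (tensor_space T B) (coact Y)"
  by (simp_all add: coact_X_eq coact_Y_eq cong: linear_on_cong)

lemma sweedler_coact_X:
  assumes "kspace U" "\<beta> \<in> carrier A"
    "\<And>h x. h \<in> carrier T \<Longrightarrow> x \<in> carrier A \<Longrightarrow> \<phi> h x = \<psi> h x"
    "\<And>h. h \<in> carrier T \<Longrightarrow> linear_on A U (\<psi> h)"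
    "\<And>x. x \<in> carrier A \<Longrightarrow> linear_on T U (\<lambda>h. \<psi> h x)"
  shows "sweedler T A (coact X \<beta>) \<phi> = csum A \<beta> (\<lambda>\<beta>1 \<beta>2. \<psi> (t \<beta>2 \<one>) \<beta>1)"
proof -
  have "sweedler T A (coact X \<beta>) \<phi> = tsum T A (coact X \<beta>) \<psi>"
    using assms linear_onD(1)[OF coact_factor_linear(1)] by (intro sweedler_eq_tsum[where U=U]) auto
  moreover have L: "linear_on (tensor_space T A) U (\<lambda>t. tsum T A t \<psi>)" using assms by simp
  ultimately show ?thesis
    using assms
      by (simp add: coact_X_eq A.linear_on_csum[OF _ L] tsum_tens[where U=U] cong: csum_congs)
qed

lemma sweedler_coact_Y:
  assumes "kspace U" "b \<in> carrier B"
    "\<And>h x. h \<in> carrier T \<Longrightarrow> x \<in> carrier B \<Longrightarrow> \<phi> h x = \<psi> h x"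
    "\<And>h. h \<in> carrier T \<Longrightarrow> linear_on B U (\<psi> h)"
    "\<And>x. x \<in> carrier B \<Longrightarrow> linear_on T U (\<lambda>h. \<psi> h x)"
  shows "sweedler T B (coact Y b) \<phi> = csum B b (\<lambda>b1 b2. \<psi> (t \<epsilon> b1) b2)"
proof -
  have "sweedler T B (coact Y b) \<phi> = tsum T B (coact Y b) \<psi>"
    using assms linear_onD(1)[OF coact_factor_linear(2)] by (intro sweedler_eq_tsum[where U=U]) auto
  moreover have L: "linear_on (tensor_space T B) U (\<lambda>t. tsum T B t \<psi>)" using assms by simp
  ultimately show ?thesis
    using assms
      by (simp add: coact_Y_eq linear_on_csum[OF _ L] tsum_tens[where U=U] cong: csum_congs)
qed

section \<open>Restriction of the structure to the two factors\<close>

lemma rcoreg_one: "\<nu> \<in> carrier A \<Longrightarrow> rcoreg B \<one> \<nu> = scale B (ev \<nu> \<one>) \<one>"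
  by (simp add: rcoreg_eq csum_unit[where X=B])

text \<open>With b = 1 the product m'' S(m''') collapses to a counit, and 1 \<leftharpoonup> \<nu>
  is a multiple of 1. The resulting counits absorb the surplus components of m and \<mu>.\<close>

lemma heis_act_dual:
  assumes "d \<in> carrier T" "\<beta> \<in> carrier A"
  shows "act H d (t \<beta> \<one>) = t (act X d \<beta>) \<one>"
proof (rule tensor_ext[where X=T and f="\<lambda>d. act H d (t \<beta> \<one>)" and g="\<lambda>d. t (act X d \<beta>) \<one>"])
  let ?S = "inv_antipode A"
  fix \<mu> m assume \<mu>m: "\<mu> \<in> carrier A" "m \<in> carrier B"
  have "act H (t \<mu> m) (t \<beta> \<one>) = csum A \<mu> (\<lambda>\<mu>1 e. csum A e (\<lambda>\<mu>2 \<mu>3. csum B m (\<lambda>m1 f.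
      scale T (counit B f) (fscale (ev \<mu>1 \<one>) (t (\<mu>3 \<star> lreg B m1 \<beta> \<star> ?S \<mu>2) \<one>)))))"
  proof -
    have "csum B f (\<lambda>m2 m3. t \<gamma> (rcoreg B (m2 \<cdot> antipode B m3) (?S \<nu>)))
        = scale T (counit B f) (fscale (ev \<nu> \<one>) (t \<gamma> \<one>))"
      if "\<gamma> \<in> carrier A" "\<nu> \<in> carrier A" "f \<in> carrier B" for \<gamma> \<nu> f
      using that csum_antipode(2)[of T "\<lambda>u. t \<gamma> (rcoreg B u (?S \<nu>))" f]
      by (simp add: rcoreg_one tens_fscale ev_inv_antipode_dual)
    then show ?thesis using \<mu>m assms by (simp add: heis_act_tens cong: csum_congs)
  qed
  also have "\<dots>
      = csum A \<mu> (\<lambda>\<mu>1 e. csum A e (\<lambda>\<mu>2 \<mu>3. fscale (ev \<mu>1 \<one>) (t (\<mu>3 \<star> lreg B m \<beta> \<star> ?S \<mu>2) \<one>)))"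
    using \<mu>m assms by (intro A.csum_cong refl csum_counit(2)) auto
  also have "\<dots>
      = csum A \<mu> (\<lambda>\<mu>1 e. scale T (counit A \<mu>1) (csum A e (\<lambda>\<mu>2 \<mu>3. t (\<mu>3 \<star> lreg B m \<beta> \<star> ?S \<mu>2) \<one>)))"
  proof -
    have "linear_on T T (fscale c)" for c by simp
    from A.linear_on_csum[OF _ this] show ?thesis using \<mu>m assms by (simp cong: csum_congs)
  qed
  also have "\<dots> = csum A \<mu> (\<lambda>\<mu>2 \<mu>3. t (\<mu>3 \<star> lreg B m \<beta> \<star> ?S \<mu>2) \<one>)"
    using \<mu>m assms by (intro A.csum_counit(1)) auto
  also have "\<dots> = t (act X (t \<mu> m) \<beta>) \<one>"
  proof -
    have "linear_on A T (\<lambda>x. t x \<one>)" by simp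
    from A.linear_on_csum[OF _ this] show ?thesis using \<mu>m assms by (simp add: act_X_tens)
  qed
  finally show "act H (t \<mu> m) (t \<beta> \<one>) = t (act X (t \<mu> m) \<beta>) \<one>" .
qed (use assms linear_on_heis_act in auto)

text \<open>The unit of the dual is invariant under m' up to a counit, after which \<mu>''' meets
  the inverse antipode of \<mu>'' and both collapse; the counits absorb the surplus
  components.\<close>

lemma heis_act_hopf:
  assumes "d \<in> carrier T" "b \<in> carrier B"
  shows "act H d (t \<epsilon> b) = t \<epsilon> (act Y d b)"
proof (rule tensor_ext[where X=T and f="\<lambda>d. act H d (t \<epsilon> b)" and g="\<lambda>d. t \<epsilon> (act Y d b)"])
  let ?S = "inv_antipode A"
  fix \<mu> m assume \<mu>m: "\<mu> \<in> carrier A" "m \<in> carrier B"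
  let ?r = "\<lambda>m2 m3 \<mu>1. rcoreg B (m2 \<cdot> b \<cdot> antipode B m3) (?S \<mu>1)"
  have "act H (t \<mu> m) (t \<epsilon> b) = csum A \<mu> (\<lambda>\<mu>1 e. csum A e (\<lambda>\<mu>2 \<mu>3. csum B m (\<lambda>m1 f.
      fscale (counit B m1) (csum B f (\<lambda>m2 m3. t (\<mu>3 \<star> ?S \<mu>2) (?r m2 m3 \<mu>1))))))"
  proof -
    have "linear_on T T (fscale c)" for c by simp
    from linear_on_csum[OF _ this] show ?thesis
      using \<mu>m assms by (simp add: heis_act_tens lreg_one tens_fscale cong: csum_congs)
  qed
  also have "\<dots>
      = csum A \<mu> (\<lambda>\<mu>1 e. csum A e (\<lambda>\<mu>2 \<mu>3. csum B m (\<lambda>m2 m3. t (\<mu>3 \<star> ?S \<mu>2) (?r m2 m3 \<mu>1))))"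
    using \<mu>m assms csum_counit(1)[where X=T and c=m] by (intro A.csum_cong refl) auto
  also have "\<dots> = csum A \<mu> (\<lambda>\<mu>1 e. scale T (counit A e) (csum B m (\<lambda>m2 m3. t \<epsilon> (?r m2 m3 \<mu>1))))"
  proof (intro A.csum_cong refl)
    fix \<mu>1 e assume "\<mu>1 \<in> carrier A" "e \<in> carrier A"
    then show "csum A e (\<lambda>\<mu>2 \<mu>3. csum B m (\<lambda>m2 m3. t (\<mu>3 \<star> ?S \<mu>2) (?r m2 m3 \<mu>1)))
        = scale T (counit A e) (csum B m (\<lambda>m2 m3. t \<epsilon> (?r m2 m3 \<mu>1)))"
      using \<mu>m assms
        by (intro A.csum_inv_antipode(2)[where f="\<lambda>u. csum B m (\<lambda>m2 m3. t u (?r m2 m3 \<mu>1))"]) auto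
  qed (use \<mu>m in auto)
  also have "\<dots> = csum B m (\<lambda>m2 m3. t \<epsilon> (?r m2 m3 \<mu>))"
    using \<mu>m assms by (intro A.csum_counit(2)) auto
  also have "\<dots> = t \<epsilon> (act Y (t \<mu> m) b)"
  proof -
    have "linear_on B T (t \<epsilon>)" by simp
    from linear_on_csum[OF _ this] show ?thesis using \<mu>m assms by (simp add: act_Y_tens)
  qed
  finally show "act H (t \<mu> m) (t \<epsilon> b) = t \<epsilon> (act Y (t \<mu> m) b)" .
qed (use assms linear_on_heis_act in auto)

text \<open>The retraction applies the counit of \<open>B\<close> to the second tensor factor; the
  one onto \<open>B\<close> below applies evaluation at 1, the counit of the dual, to the
  first.\<close>

lemma retract_dual:
  assumes "\<beta> \<in> carrier A"
  shows "tsum A B (t \<beta> \<one>) (\<lambda>\<alpha> a. fscale (counit B a) \<alpha>) = \<beta>"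
  using assms kspace_scale(4)[OF kspace_dual, of \<beta>] by (simp add: tsum_tens[where U=A] counit_unit)

lemma retract_hopf:
  assumes "b \<in> carrier B"
  shows "tsum A B (t \<epsilon> b) (\<lambda>\<alpha> a. scale B (ev \<alpha> \<one>) a) = b"
  using assms by (simp add: tsum_tens[where U=B] ev_unit_dual counit_unit kspace_scale)

lemma restriction_dual: "yd_restriction D X H (\<lambda>\<beta>. t \<beta> \<one>)"
  unfolding yd_restriction_def
proof (intro conjI ballI)
  show "inj_on (\<lambda>\<beta>. t \<beta> \<one>) (carrier X)"
    by (rule inj_on_inverseI[where g="\<lambda>x. tsum A B x (\<lambda>\<alpha> a. fscale (counit B a) \<alpha>)"])
      (simp add: retract_dual)
  fix \<beta> assume "\<beta> \<in> carrier X"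
  then have \<beta>: "\<beta> \<in> carrier A" by simp
  show "coact H (t \<beta> \<one>) = sweedler D X (coact X \<beta>) (\<lambda>h x0. tens D H h (t x0 \<one>))"
    using \<beta> by (simp add: heis_coact_eq drin_comult_tens csum_unit[where X="tensor_space T T"]
        sweedler_coact_X[where U="tensor_space T T" and \<psi>="\<lambda>h x0.
            tens T T h (t x0 \<one>)"] cong: csum_congs)
qed (auto simp: heis_mult_tens_unit heis_act_dual)

lemma restriction_hopf: "yd_restriction D Y H (\<lambda>b. t \<epsilon> b)"
  unfolding yd_restriction_def
proof (intro conjI ballI)
  show "inj_on (\<lambda>b. t \<epsilon> b) (carrier Y)"
    by (rule inj_on_inverseI[where g="\<lambda>x. tsum A B x (\<lambda>\<alpha> a. scale B (ev \<alpha> \<one>) a)"])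
      (simp add: retract_hopf)
  fix b assume "b \<in> carrier Y"
  then have b: "b \<in> carrier B" by simp
  show "coact H (t \<epsilon> b) = sweedler D Y (coact Y b) (\<lambda>h x0. tens D H h (t \<epsilon> x0))"
    using b by (simp add: heis_coact_eq drin_comult_tens A.csum_unit[where X="tensor_space T T"]
        sweedler_coact_Y[where U="tensor_space T T" and \<psi>="\<lambda>h x0.
            tens T T h (t \<epsilon> x0)"] cong: csum_congs)
qed (auto simp: heis_mult_tens_unit heis_act_hopf)

lemma yd_heisenberg: "yd_module_algebra D H" "braided_commutative D H"
  using cleft_object.yd_module_algebra[OF cleft_object_heisenberg]
    cleft_object.braided_commutative[OF cleft_object_heisenberg] by simp_all

lemma yd_retract_dual: "yd_retract D X H (\<lambda>\<beta>. t \<beta> \<one>) (\<lambda>x. tsum A B x (\<lambda>\<alpha> a. fscale (counit B a) \<alpha>))"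
proof (intro yd_retract.intro yd_retract_axioms.intro kcoalgebra_drin kalgebra_factors
  yd_heisenberg restriction_dual)
  show "bilinear_on D D D (mult D)" using bilinear_drin_mult by (simp add: bilinear_on_def)
  show "bilinear_on D X X (act X)" using act_X_bilinear by (simp add: bilinear_on_def)
qed (use coact_factor_linear in \<open>auto simp: retract_dual\<close>)

lemma yd_retract_hopf: "yd_retract D Y H (\<lambda>b. t \<epsilon> b) (\<lambda>x. tsum A B x (\<lambda>\<alpha> a. scale B (ev \<alpha> \<one>) a))"
proof (intro yd_retract.intro yd_retract_axioms.intro kcoalgebra_drin kalgebra_factors
  yd_heisenberg restriction_hopf)
  show "bilinear_on D D D (mult D)" using bilinear_drin_mult by (simp add: bilinear_on_def)
  show "bilinear_on D Y Y (act Y)" using act_Y_bilinear by (simp add: bilinear_on_def)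
qed (use coact_factor_linear in \<open>auto simp: retract_hopf\<close>)

section \<open>Comparison with the braided product\<close>

lemma act_X_unit: "b \<in> carrier B \<Longrightarrow> \<beta> \<in> carrier A \<Longrightarrow> act X (t \<epsilon> b) \<beta> = lreg B b \<beta>"
  by (simp add: act_X_tens A.csum_unit[where X=A])

lemma rreg_one: "rreg B \<epsilon> \<one> = \<epsilon>"
  by (rule dual_eqI) auto

lemma drin_mult_split:
  assumes "\<beta> \<in> carrier A" "b \<in> carrier B"
  shows "t \<beta> \<one> \<diamondop> t \<epsilon> b = t \<beta> b"
  using assms by (simp add: drin_mult_tens csum_unit[where X=T] rreg_one)

text \<open>Product: the coaction of b contributes \<epsilon> \<otimes> b', which acts on the dual
  by b' \<rightharpoonup>, so braiding the two factors gives the smash product. Coaction: the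
  contributions \<beta>'' \<otimes> 1 and \<epsilon> \<otimes> b' multiply in \<open>D\<close> to
  \<beta>'' \<otimes> b' (\<open>drin_mult_split\<close>). Action: the coproduct of \<mu> \<otimes>
  m hands \<mu>'' and m' to \<beta>, and \<mu>' and m'' to b; splitting \<mu>'' and m'' once more
  gives the formula of \<open>heis_act_tens\<close>.\<close>

theorem braided_product_eq: "yd_algebra_eq D H (braided_product D X Y)"
  unfolding yd_algebra_eq_def
proof (intro conjI ballI)
  show "carrier H = carrier (braided_product D X Y)" "scale H = scale (braided_product D X Y)"
    "\<one>\<^bsub>H\<^esub> = \<one>\<^bsub>braided_product D X Y\<^esub>"
    by (simp_all add: braided_product_def Let_def)
  fix x assume "x \<in> carrier H"
  then have x: "x \<in> carrier T" by simp
  show "x \<bullet> y = x \<cdot>\<^bsub>braided_product D X Y\<^esub> y" if "y \<in> carrier H" for y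
  proof -
    have y: "y \<in> carrier T" using that by simp
    have "sweedler T B (coact Y a) (\<lambda>h y0. t (\<alpha> \<star> act X h \<beta>) (y0 \<cdot> b))
        = csum B a (\<lambda>a1 a2. t (\<alpha> \<star> lreg B a1 \<beta>) (a2 \<cdot> b))"
      if "\<alpha> \<in> carrier A" "a \<in> carrier B" "\<beta> \<in> carrier A" "b \<in> carrier B" for \<alpha> a \<beta> b
      using that sweedler_coact_Y[where U=T and b=a and \<phi>="\<lambda>h y0. t (\<alpha> \<star> act X h \<beta>) (y0 \<cdot> b)"
          and \<psi>="\<lambda>h y0. t (\<alpha> \<star> act X h \<beta>) (y0 \<cdot> b)"]
      by (simp add: act_X_unit cong: csum_congs)
    then have "x \<cdot>\<^bsub>braided_product D X Y\<^esub> y = tsum A B x (\<lambda>\<alpha> a. tsum A B y (\<lambda>\<beta> b.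
        csum B a (\<lambda>a1 a2. t (\<alpha> \<star> lreg B a1 \<beta>) (a2 \<cdot> b))))"
      using x y unfolding braided_product_def Let_def algebra.simps
      by simp (intro sweedler_eq_tsum[where U=T], auto intro!: sweedler_eq_tsum[where U=T])
    then show ?thesis using x y by (simp add: heis_mult_eq)
  qed
  show "coact H x = coact (braided_product D X Y) x"
  proof -
    have inner: "sweedler T B (coact Y b) (\<lambda>k y0. tens T T (h \<diamondop> k) (t x0 y0))
        = csum B b (\<lambda>b1 b2. tens T T (h \<diamondop> t \<epsilon> b1) (t x0 b2))"
      if "h \<in> carrier T" "x0 \<in> carrier A" "b \<in> carrier B" for h x0 b
      using that
        by (intro sweedler_coact_Y[where U="tensor_space T T" and \<psi>="\<lambda>k y0.
            tens T T (h \<diamondop> k) (t x0 y0)"]) auto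
    have "sweedler T A (coact X \<beta>) (\<lambda>h x0. sweedler T B (coact Y b) (\<lambda>k y0.
        tens T T (h \<diamondop> k) (t x0 y0)))
        = csum A \<beta> (\<lambda>\<beta>1 \<beta>2. csum B b (\<lambda>b1 b2. tens T T (t \<beta>2 b1) (t \<beta>1 b2)))"
      if "\<beta> \<in> carrier A" "b \<in> carrier B" for \<beta> b
      using that sweedler_coact_X[where U="tensor_space T T" and \<beta>=\<beta>
          and \<phi>="\<lambda>h x0. sweedler T B (coact Y b) (\<lambda>k y0. tens T T (h \<diamondop> k) (t x0 y0))"
          and \<psi>="\<lambda>h x0. csum B b (\<lambda>b1 b2. tens T T (h \<diamondop> t \<epsilon> b1) (t x0 b2))", OF _ _ inner]
      by (simp add: drin_mult_split cong: csum_congs)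
    then have "coact (braided_product D X Y) x
        = tsum A B x (\<lambda>\<beta> b. csum A \<beta> (\<lambda>\<beta>1 \<beta>2. csum B b (\<lambda>b1 b2.
        tens T T (t \<beta>2 b1) (t \<beta>1 b2))))"
      using x unfolding braided_product_def Let_def yd_algebra.simps
      by simp (intro sweedler_eq_tsum[where U="tensor_space T T"], auto)
    then show ?thesis using x by (simp add: heis_coact_eq drin_comult_eq)
  qed
  fix d assume "d \<in> carrier D"
  then have d: "d \<in> carrier T" by simp
  show "act H d x = act (braided_product D X Y) d x"
  proof -
    have "act H d x = csum D d (\<lambda>h1 h2. tsum A B x (\<lambda>\<beta> b. t (act X h1 \<beta>) (act Y h2 b)))"
    proof (rule tens2_ext[where X=T and f="\<lambda>d x. act H d x"
          and g="\<lambda>d x. csum D d (\<lambda>h1 h2. tsum A B x (\<lambda>\<beta> b. t (act X h1 \<beta>) (act Y h2 b)))"])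
      fix \<mu> m \<beta> b assume *: "\<mu> \<in> carrier A" "m \<in> carrier B" "\<beta> \<in> carrier A" "b \<in> carrier B"
      let ?\<phi> = "\<lambda>\<mu>1 \<mu>2 \<mu>3 m1 m2 m3. t (\<mu>3 \<star> lreg B m1 \<beta> \<star> inv_antipode A \<mu>2)
        (rcoreg B (m2 \<cdot> b \<cdot> antipode B m3) (inv_antipode A \<mu>1))"
      have "csum D (t \<mu> m) (\<lambda>h1 h2. tsum A B (t \<beta> b) (\<lambda>\<beta> b. t (act X h1 \<beta>) (act Y h2 b)))
          = csum A \<mu> (\<lambda>\<mu>1 e. csum B m (\<lambda>m1 f. t (act X (t e m1) \<beta>) (act Y (t \<mu>1 f) b)))"
        using * by (simp add: csum_drin_tens[where X=T] tsum_tens[where U=T] cong: csum_congs)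
      also have "\<dots>
          = csum A \<mu> (\<lambda>\<mu>1 e. csum B m (\<lambda>m1 f. csum B f (\<lambda>m2 m3. csum A e (\<lambda>\<mu>2 \<mu>3.
            ?\<phi> \<mu>1 \<mu>2 \<mu>3 m1 m2 m3))))"
      proof -
        have L1: "linear_on A T (\<lambda>u. t u v)" if "v \<in> carrier B" for v using that by simp
        have L2: "linear_on B T (t u)" if "u \<in> carrier A" for u using that by simp
        show ?thesis using *
          by (simp add: act_X_tens act_Y_tens A.linear_on_csum[OF _ L1] linear_on_csum[OF _ L2]
            cong: csum_congs)
      qed
      also have "\<dots>
          = csum A \<mu> (\<lambda>\<mu>1 e. csum A e (\<lambda>\<mu>2 \<mu>3. csum B m (\<lambda>m1 f. csum B f (\<lambda>m2 m3.
            ?\<phi> \<mu>1 \<mu>2 \<mu>3 m1 m2 m3))))"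
        by (simp only: csum_swap[where C=B and D="dual B"])
      finally show "act H (t \<mu> m) (t \<beta> b)
          = csum D (t \<mu> m) (\<lambda>h1 h2. tsum A B (t \<beta> b) (\<lambda>\<beta> b. t (act X h1 \<beta>) (act Y h2 b)))"
        using * by (simp add: heis_act_tens)
    qed (use d x linear_on_heis_act in auto)
    also have "\<dots> = cop2 D d (\<lambda>h1 h2. sweedler A B x (\<lambda>\<beta> b. t (act X h1 \<beta>) (act Y h2 b)))"
      using d x
        by (intro drin_cop2_csum[where U=T, symmetric]) (auto intro!: sweedler_eq_tsum[where U=T])
    also have "\<dots> = act (braided_product D X Y) d x"
      by (simp add: braided_product_def Let_def)
    finally show ?thesis .
  qed
qed

end

theorem theorem1p2:
  fixes B :: "('k::field, 'b::ab_group_add) hopf"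
  assumes "hopf_algebra B"
    and "bij_betw (antipode B) (carrier B) (carrier B)"
  shows
    "yd_module_algebra (drinfeld_double B) (heisenberg_double B) \<and>
     braided_commutative (drinfeld_double B) (heisenberg_double B) \<and>
     yd_module_algebra (drinfeld_double B) (dual_cop_yd B) \<and>
     braided_commutative (drinfeld_double B) (dual_cop_yd B) \<and>
     yd_module_algebra (drinfeld_double B) (hopf_yd B) \<and>
     braided_commutative (drinfeld_double B) (hopf_yd B) \<and>
     yd_restriction (drinfeld_double B) (dual_cop_yd B) (heisenberg_double B)
       (\<lambda>\<beta>. tens (dual B) B \<beta> \<one>\<^bsub>B\<^esub>) \<and>
     yd_restriction (drinfeld_double B) (hopf_yd B) (heisenberg_double B)
       (\<lambda>b. tens (dual B) B \<one>\<^bsub>dual B\<^esub> b) \<and>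
     yd_algebra_eq (drinfeld_double B) (heisenberg_double B)
       (braided_product (drinfeld_double B) (dual_cop_yd B) (hopf_yd B))"
proof -
  interpret hopf_algebra B by (rule assms(1))
  interpret bijective_hopf_algebra B by unfold_locales (rule assms(2))
  show ?thesis
    using yd_heisenberg restriction_dual restriction_hopf braided_product_eq
      yd_retract.yd_module_algebra_retract[OF yd_retract_dual]
      yd_retract.braided_commutative_retract[OF yd_retract_dual yd_heisenberg(2)]
      yd_retract.yd_module_algebra_retract[OF yd_retract_hopf]
      yd_retract.braided_commutative_retract[OF yd_retract_hopf yd_heisenberg(2)]
    by blast
qed

end
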